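(* Let $N\ge 1$, let $\phi:\mathbb{P}^N\to\mathbb{P}^N$ be a morphism defined over $\mathbb{Q}$ of degree $d\ge 2$, let $D$ be the hyperplane $X_N=0$, let $D^{(n)}_{\mathrm{nc}}$ be a normal-crossings part of $(\phi^{(n)})^*D$, and let $$c=\sup_n\frac{\deg D^{(n)}_{\mathrm{nc}}-(N+1)}{d^n}.$$ Assume Vojta's conjecture on $\mathbb{P}^N$. For $P\in\mathbb{P}^N(\mathbb{Q})$ write $\phi^{(m)}(P)=[a_0^{(m)}:\cdots:a_N^{(m)}]$ with $a_i^{(m)}\in\mathbb{Z}$ having greatest common divisor $1$. Then for any $P\in\mathbb{P}^N(\mathbb{Q})$ and any $\epsilon>0$, the set $$\left\{\phi^{(m)}(P):\frac{\log|a_N^{(m)}|}{\log\max_i|a_i^{(m)}|}\le c-\epsilon\right\}$$ is not Zariski-dense in $\mathbb{P}^N$.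
   Context: $\phi^{(m)}$ is the $m$-fold composition of $\phi$ with itself ($\phi^{(0)}=\mathrm{id}$); indices $m,n$ range over nonnegative integers. The degree of $\phi$ is the common degree of the homogeneous polynomials (without common factor) defining it. The quotient of logarithms is considered only for those $m$ for which it is defined ($a_N^{(m)}\ne0$ and $\max_i|a_i^{(m)}|>1$). Normal crossings: a divisor is normal-crossings if near each point it is defined by $x_1\cdots x_k=0$ where $x_1,\ldots,x_k$ is part of a local (analytic) coordinate system; in particular each irreducible component has multiplicity $1$. A normal-crossings part $E_{\mathrm{nc}}$ of an effective divisor $E$ is a normal-crossings subdivisor of $E$ over $\overline{\mathbb{Q}}$ (i.e. $E-E_{\mathrm{nc}}$ effective) of highest possible degree; fix one if there are several. Heights: For a number field $k$, $M_k$ is the set of its places; for $v\in M_k$, $|\cdot|_v$ is the $\frac{[k_v:\mathbb{Q}_v]}{[k:\mathbb{Q}]}$-th power of the extension of the normalized absolute value on $\mathbb{Q}$, and $v(x)=-\log|x|_v$ (with $v(0)=+\infty$). The Weil height is $h([x_0:\cdots:x_N])=\sum_{v\in M_k}\log\max_i|x_i|_v$. If an effective divisor $E$ on $\mathbb{P}^N$ defined over $k$ is given by a homogeneous polynomial $F$ with coefficients in the ring of integers of $k$ (fix one choice of $F$), the local height is $\lambda_v(E,[x_0:\cdots:x_N])=v(F(x_0,\ldots,x_N))-\deg(E)\min_i v(x_i)$ (equal to $+\infty$ on $|E|$). Vojta's conjecture on $\mathbb{P}^N$: for every number field $k$, every normal-crossings divisor $E$ on $\mathbb{P}^N$ defined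 over $k$, every finite set $S\subset M_k$ and every $\epsilon>0$, there exist a finite union $Z_\epsilon$ of hypersurfaces and a constant $C$ such that $\sum_{v\in S}\lambda_v(E,P)<(N+1+\epsilon)h(P)+C$ for all $P\in\mathbb{P}^N(k)\setminus Z_\epsilon$. *)

theory Defs
  imports
    "HOL-Analysis.Analysis"
    "HOL-Algebra.Embedded_Algebras"
    "HOL-Algebra.QuotRing"
    "HOL-Algebra.Algebraic_Closure_Type"
    "HOL-Library.Poly_Mapping"
begin

text \<open>A polynomial over the complex numbers is a finitely supported map from exponent vectors
  to coefficients, with the convolution product of \<^theory>\<open>HOL-Library.Poly_Mapping\<close>.
  The homogeneous coordinates on $N$-dimensional projective space are the variables
  with indices $0,\dots,N$.\<close>

type_synonym mpoly = "(nat \<Rightarrow>\<^sub>0 nat) \<Rightarrow>\<^sub>0 complex"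

definition pvar :: "nat \<Rightarrow> mpoly" where
  "pvar i = Poly_Mapping.single (Poly_Mapping.single i 1) 1"

definition peval :: "mpoly \<Rightarrow> (nat \<Rightarrow> complex) \<Rightarrow> complex" where
  "peval F x = (\<Sum>m\<in>Poly_Mapping.keys F. Poly_Mapping.lookup F m *
     (\<Prod>i\<in>Poly_Mapping.keys m. x i ^ Poly_Mapping.lookup m i))"

definition psubst :: "mpoly \<Rightarrow> (nat \<Rightarrow> mpoly) \<Rightarrow> mpoly" where
  "psubst F G = (\<Sum>m\<in>Poly_Mapping.keys F. Poly_Mapping.single 0 (Poly_Mapping.lookup F m) *
     (\<Prod>i\<in>Poly_Mapping.keys m. G i ^ Poly_Mapping.lookup m i))"

definition mon_degree :: "(nat \<Rightarrow>\<^sub>0 nat) \<Rightarrow> nat" where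
  "mon_degree m = (\<Sum>i\<in>Poly_Mapping.keys m. Poly_Mapping.lookup m i)"

definition form :: "nat \<Rightarrow> complex set \<Rightarrow> nat \<Rightarrow> mpoly \<Rightarrow> bool" where
  "form N A e F \<longleftrightarrow> (\<forall>m\<in>Poly_Mapping.keys F.
     Poly_Mapping.lookup F m \<in> A \<and> Poly_Mapping.keys m \<subseteq> {..N} \<and> mon_degree m = e)"

text \<open>An effective divisor on projective space is represented by a nonzero form defining it.
  In this representation, \<open>E - E'\<close> is effective iff the form of \<open>E'\<close> divides that of \<open>E\<close>.\<close>

definition divisor :: "nat \<Rightarrow> complex set \<Rightarrow> mpoly \<Rightarrow> bool" where
  "divisor N A F \<longleftrightarrow> F \<noteq> 0 \<and> (\<exists>e. form N A e F)"

definition divisor_degree :: "mpoly \<Rightarrow> nat" where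
  "divisor_degree F = Max (mon_degree ` Poly_Mapping.keys F)"

definition homog_coords :: "nat \<Rightarrow> complex set \<Rightarrow> (nat \<Rightarrow> complex) \<Rightarrow> bool" where
  "homog_coords N K x \<longleftrightarrow> (\<forall>i\<le>N. x i \<in> K) \<and> (\<exists>i\<le>N. x i \<noteq> 0)"

definition proj_point :: "nat \<Rightarrow> (nat \<Rightarrow> complex) \<Rightarrow> (nat \<Rightarrow> complex) set" where
  "proj_point N x = {(\<lambda>i. if i \<le> N then c * x i else 0) | c. c \<noteq> 0}"

text \<open>\<open>proj_space N UNIV\<close> is the set of geometric points; \<open>proj_space N K\<close> is the set
  of \<open>K\<close>-rational points in it.\<close>

definition proj_space :: "nat \<Rightarrow> complex set \<Rightarrow> (nat \<Rightarrow> complex) set set" where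
  "proj_space N K = proj_point N ` {x. homog_coords N K x}"

definition zero_locus :: "nat \<Rightarrow> mpoly set \<Rightarrow> (nat \<Rightarrow> complex) set set" where
  "zero_locus N T = {P \<in> proj_space N UNIV. \<forall>F\<in>T. \<forall>x\<in>P. peval F x = 0}"

definition zariski_closed :: "nat \<Rightarrow> (nat \<Rightarrow> complex) set set \<Rightarrow> bool" where
  "zariski_closed N V \<longleftrightarrow> (\<exists>T. (\<forall>F\<in>T. \<exists>e. form N UNIV e F) \<and> V = zero_locus N T)"

definition zariski_dense :: "nat \<Rightarrow> (nat \<Rightarrow> complex) set set \<Rightarrow> bool" where
  "zariski_dense N A \<longleftrightarrow> (\<forall>V. zariski_closed N V \<and> A \<subseteq> V \<longrightarrow> V = proj_space N UNIV)"

definition hypersurface :: "nat \<Rightarrow> (nat \<Rightarrow> complex) set set \<Rightarrow> bool" where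
  "hypersurface N V \<longleftrightarrow> (\<exists>F e. F \<noteq> 0 \<and> e > 0 \<and> form N UNIV e F \<and> V = zero_locus N {F})"

text \<open>An endomorphism of degree \<open>d\<close> defined over \<open>A\<close> is given by forms
  \<open>\<phi> 0, \<dots>, \<phi> N\<close> of degree \<open>d\<close> without common zero (hence without common factor).\<close>

definition proj_morphism :: "nat \<Rightarrow> complex set \<Rightarrow> nat \<Rightarrow> (nat \<Rightarrow> mpoly) \<Rightarrow> bool" where
  "proj_morphism N A d \<phi> \<longleftrightarrow> (\<forall>i\<le>N. form N A d (\<phi> i)) \<and>
     (\<forall>x. homog_coords N UNIV x \<longrightarrow> (\<exists>i\<le>N. peval (\<phi> i) x \<noteq> 0))"

definition proj_map ::
  "nat \<Rightarrow> (nat \<Rightarrow> mpoly) \<Rightarrow> (nat \<Rightarrow> complex) set \<Rightarrow> (nat \<Rightarrow> complex) set" where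
  "proj_map N \<phi> P = proj_point N (\<lambda>i. peval (\<phi> i) (SOME x. x \<in> P))"

primrec iter_forms :: "(nat \<Rightarrow> mpoly) \<Rightarrow> nat \<Rightarrow> nat \<Rightarrow> mpoly" where
  "iter_forms \<phi> 0 = pvar"
| "iter_forms \<phi> (Suc n) = (\<lambda>i. psubst (\<phi> i) (iter_forms \<phi> n))"

abbreviation pullback :: "(nat \<Rightarrow> mpoly) \<Rightarrow> mpoly \<Rightarrow> mpoly" where
  "pullback \<psi> F \<equiv> psubst F \<psi>"

text \<open>Functions on complex $N$-space are functions of \<open>nat \<Rightarrow> complex\<close> depending only on the
  coordinates with index \<open>< N\<close>; analytic at \<open>p\<close> means being the sum of a power
  series on a polydisc around \<open>p\<close>.\<close>

definition polydisc :: "nat \<Rightarrow> (nat \<Rightarrow> complex) \<Rightarrow> real \<Rightarrow> (nat \<Rightarrow> complex) set" where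
  "polydisc N p r = {y. \<forall>i<N. cmod (y i - p i) < r}"

definition analytic_at_point ::
  "nat \<Rightarrow> ((nat \<Rightarrow> complex) \<Rightarrow> complex) \<Rightarrow> (nat \<Rightarrow> complex) \<Rightarrow> bool" where
  "analytic_at_point N f p \<longleftrightarrow> (\<exists>r>0. \<exists>a :: (nat \<Rightarrow>\<^sub>0 nat) \<Rightarrow> complex. \<forall>y\<in>polydisc N p r.
     ((\<lambda>m. a m * (\<Prod>i<N. (y i - p i) ^ Poly_Mapping.lookup m i)) has_sum f y)
       {m. Poly_Mapping.keys m \<subseteq> {..<N}})"

definition partial_deriv ::
  "nat \<Rightarrow> ((nat \<Rightarrow> complex) \<Rightarrow> complex) \<Rightarrow> (nat \<Rightarrow> complex) \<Rightarrow> complex" where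
  "partial_deriv i f p = deriv (\<lambda>t. f (p(i := t))) (p i)"

text \<open>By the inverse function theorem, analytic functions vanishing at \<open>p\<close> form a local
  coordinate system there iff their differentials at \<open>p\<close> are linearly independent.\<close>

definition local_coordinates ::
  "nat \<Rightarrow> (nat \<Rightarrow> (nat \<Rightarrow> complex) \<Rightarrow> complex) \<Rightarrow> (nat \<Rightarrow> complex) \<Rightarrow> bool" where
  "local_coordinates N g p \<longleftrightarrow>
     (\<forall>l<N. analytic_at_point N (g l) p \<and> g l p = 0) \<and>
     (\<forall>b :: nat \<Rightarrow> complex. (\<forall>i<N. (\<Sum>l<N. b l * partial_deriv i (g l) p) = 0) \<longrightarrow> (\<forall>l<N. b l = 0))"

definition normal_crossings_at ::
  "nat \<Rightarrow> ((nat \<Rightarrow> complex) \<Rightarrow> complex) \<Rightarrow> (nat \<Rightarrow> complex) \<Rightarrow> bool" where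
  "normal_crossings_at N f p \<longleftrightarrow> (\<exists>g k u r. local_coordinates N g p \<and> k \<le> N \<and>
     analytic_at_point N u p \<and> u p \<noteq> 0 \<and> r > 0 \<and>
     (\<forall>y\<in>polydisc N p r. f y = u y * (\<Prod>l<k. g l y)))"

text \<open>\<open>chart j\<close> identifies complex $N$-space with the open subset $X_j \neq 0$ of projective space.\<close>

definition chart :: "nat \<Rightarrow> (nat \<Rightarrow> complex) \<Rightarrow> nat \<Rightarrow> complex" where
  "chart j y i = (if i < j then y i else if i = j then 1 else y (i - 1))"

definition normal_crossings :: "nat \<Rightarrow> mpoly \<Rightarrow> bool" where
  "normal_crossings N F \<longleftrightarrow> (\<forall>j\<le>N. \<forall>p. normal_crossings_at N (\<lambda>y. peval F (chart j y)) p)"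

definition nc_subdivisor :: "nat \<Rightarrow> mpoly \<Rightarrow> mpoly \<Rightarrow> bool" where
  "nc_subdivisor N F E \<longleftrightarrow> divisor N {z. algebraic z} E \<and> normal_crossings N E \<and> E dvd F"

definition nc_part :: "nat \<Rightarrow> mpoly \<Rightarrow> mpoly \<Rightarrow> bool" where
  "nc_part N F E \<longleftrightarrow> nc_subdivisor N F E \<and>
     (\<forall>E'. nc_subdivisor N F E' \<longrightarrow> divisor_degree E' \<le> divisor_degree E)"

text \<open>Number fields are taken inside the complex numbers.\<close>

abbreviation complex_ring :: "complex ring" where
  "complex_ring \<equiv> ring_of_type_algebra"

definition number_field :: "complex set \<Rightarrow> bool" where
  "number_field K \<longleftrightarrow> subfield K complex_ring \<and> ring.finite_dimension complex_ring \<rat> K"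

definition field_degree :: "complex set \<Rightarrow> nat" where
  "field_degree K = ring.dim complex_ring \<rat> K"

definition absolute_value :: "complex set \<Rightarrow> (complex \<Rightarrow> real) \<Rightarrow> bool" where
  "absolute_value K w \<longleftrightarrow>
     (\<forall>x\<in>K. w x \<ge> 0 \<and> (w x = 0 \<longleftrightarrow> x = 0)) \<and>
     (\<forall>x\<in>K. \<forall>y\<in>K. w (x * y) = w x * w y \<and> w (x + y) \<le> w x + w y)"

definition padic_abs :: "nat \<Rightarrow> rat \<Rightarrow> real" where
  "padic_abs p q = (if q = 0 then 0 else
     real p powi (int (multiplicity (int p) (snd (quotient_of q))) -
                  int (multiplicity (int p) (fst (quotient_of q)))))"

text \<open>A place (an equivalence class of nontrivial absolute values on \<open>K\<close>) is represented by its
  unique member that restricts to a normalized absolute value on the rationals.\<close>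

definition places :: "complex set \<Rightarrow> (complex \<Rightarrow> real) set" where
  "places K = {w \<in> extensional K. absolute_value K w \<and>
     ((\<forall>q :: rat. w (of_rat q) = \<bar>of_rat q\<bar>) \<or>
      (\<exists>p. Factorial_Ring.prime p \<and> (\<forall>q :: rat. w (of_rat q) = padic_abs p q)))}"

text \<open>The completion is the ring of Cauchy sequences modulo the ideal of null sequences; for
  \<open>k \<subseteq> K\<close>, \<open>completion_of_subfield K w k\<close> is the copy of the completion of \<open>k\<close> inside it.\<close>

definition cauchy_seqs :: "complex set \<Rightarrow> (complex \<Rightarrow> real) \<Rightarrow> (nat \<Rightarrow> complex) set" where
  "cauchy_seqs K w = {s. range s \<subseteq> K \<and> (\<forall>e>0. \<exists>M. \<forall>m\<ge>M. \<forall>n\<ge>M. w (s m - s n) < e)}"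

definition null_seqs :: "complex set \<Rightarrow> (complex \<Rightarrow> real) \<Rightarrow> (nat \<Rightarrow> complex) set" where
  "null_seqs K w = {s \<in> cauchy_seqs K w. (\<lambda>n. w (s n)) \<longlonglongrightarrow> 0}"

definition cauchy_ring :: "complex set \<Rightarrow> (complex \<Rightarrow> real) \<Rightarrow> (nat \<Rightarrow> complex) ring" where
  "cauchy_ring K w = \<lparr>carrier = cauchy_seqs K w, mult = (\<lambda>s t n. s n * t n), one = (\<lambda>n. 1),
     zero = (\<lambda>n. 0), add = (\<lambda>s t n. s n + t n)\<rparr>"

definition completion :: "complex set \<Rightarrow> (complex \<Rightarrow> real) \<Rightarrow> (nat \<Rightarrow> complex) set ring" where
  "completion K w = cauchy_ring K w Quot null_seqs K w"

definition completion_of_subfield ::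
  "complex set \<Rightarrow> (complex \<Rightarrow> real) \<Rightarrow> complex set \<Rightarrow> (nat \<Rightarrow> complex) set set" where
  "completion_of_subfield K w k =
     (\<lambda>s. null_seqs K w +>\<^bsub>cauchy_ring K w\<^esub> s) ` cauchy_seqs k w"

definition local_degree :: "complex set \<Rightarrow> (complex \<Rightarrow> real) \<Rightarrow> nat" where
  "local_degree K w =
     ring.dim (completion K w) (completion_of_subfield K w \<rat>) (carrier (completion K w))"

definition place_abs :: "complex set \<Rightarrow> (complex \<Rightarrow> real) \<Rightarrow> complex \<Rightarrow> real" where
  "place_abs K w x = w x powr (real (local_degree K w) / real (field_degree K))"

definition place_val :: "complex set \<Rightarrow> (complex \<Rightarrow> real) \<Rightarrow> complex \<Rightarrow> ereal" where
  "place_val K w x = (if x = 0 then \<infinity> else ereal (- ln (place_abs K w x)))"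

definition weil_height :: "nat \<Rightarrow> complex set \<Rightarrow> (nat \<Rightarrow> complex) \<Rightarrow> real" where
  "weil_height N K x = (\<Sum>\<^sub>\<infinity>w\<in>places K. ln (Max ((\<lambda>i. place_abs K w (x i)) ` {..N})))"

definition local_height ::
  "nat \<Rightarrow> complex set \<Rightarrow> (complex \<Rightarrow> real) \<Rightarrow> mpoly \<Rightarrow> (nat \<Rightarrow> complex) \<Rightarrow> ereal" where
  "local_height N K w F x = place_val K w (peval F x) -
     ereal (real (divisor_degree F)) * Min ((\<lambda>i. place_val K w (x i)) ` {..N})"

text \<open>A divisor defined over \<open>K\<close> is given by a form \<open>F\<close> with coefficients in the ring of
  integers. Two choices of \<open>F\<close> change the local heights only by constants.\<close>

definition vojta_conjecture :: "nat \<Rightarrow> bool" where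
  "vojta_conjecture N \<longleftrightarrow> (\<forall>K F S. \<forall>\<epsilon>>0.
     number_field K \<and> divisor N {z \<in> K. algebraic_int z} F \<and> normal_crossings N F \<and>
     finite S \<and> S \<subseteq> places K \<longrightarrow>
     (\<exists>\<Z> C. finite \<Z> \<and> (\<forall>V\<in>\<Z>. hypersurface N V) \<and>
       (\<forall>x. homog_coords N K x \<and> proj_point N x \<notin> \<Union>\<Z> \<longrightarrow>
          (\<Sum>w\<in>S. local_height N K w F x) < ereal ((real N + 1 + \<epsilon>) * weil_height N K x + C))))"

end

theory Submission
  imports Defs "Jordan_Normal_Form.Determinant"
begin

text \<open>
  Write \<open>Q = \<phi>\<^sup>(\<^sup>m\<^sup>-\<^sup>n\<^sup>)(P)\<close> for a point \<open>\<phi>\<^sup>(\<^sup>m\<^sup>)(P)\<close> of the set, where \<open>n\<close> is fixed such that \<open>deg Dnc n - (N + 1)\<close>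
  exceeds \<open>(c - \<epsilon>) d\<^sup>n\<close>. A small ratio of logarithms says that \<open>\<phi>\<^sup>(\<^sup>m\<^sup>)(P)\<close> is close to the hyperplane at the
  archimedean places, so \<open>Q\<close> is close to the pullback of the hyperplane, and even to \<open>Dnc n\<close>, since the
  other components contribute at most their degree times the height. Together with Vojta's inequality for
  \<open>Dnc n\<close> this bounds the height of \<open>Q\<close> outside a finite union \<open>Z\<close> of hypersurfaces. Hence \<open>\<phi>\<^sup>(\<^sup>m\<^sup>)(P)\<close> lies
  in a finite set or in the image of \<open>Z\<close>, which is contained in a hypersurface because \<open>N + 2\<close> polynomials
  in \<open>N + 1\<close> variables are algebraically dependent.

  The comparison of the heights of \<open>Q\<close> and \<open>\<phi>\<^sup>(\<^sup>n\<^sup>)(Q)\<close> rests on the Nullstellensatz. On the arithmetic side it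
  suffices to know the archimedean places of one number field containing \<open>\<i>\<close> and the coefficients of \<open>Dnc n\<close>:
  they all have local degree 2, and a primitive integral point has no contribution to its height at the
  remaining places.
\<close>

section \<open>Polynomials and forms\<close>

text \<open>The ratio condition concerns the ordinary absolute value of one integer, Vojta's
  inequality a divisor over a number field \<open>K\<close>. They meet because the pulled back form
  takes rational values at rational points, so all archimedean places of \<open>K\<close> see the
  same size; with \<i> in \<open>K\<close> they also carry the same weight, which divides out of the
  inequality. The cofactor of \<open>Dnc n\<close> may take small values at single places, which is
  why all archimedean places are used together: a nonzero norm with bounded denominator bounds the
  sum of its logarithms from below.

  Write \<open>t = c - \<epsilon>\<close>, \<open>e = divisor_degree (Dnc n)\<close> and
  \<open>h\<close> for the logarithmic height of the point \<open>n\<close> steps back. The left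
  side of Vojta's inequality is then, after division by the common weight, at least
  \<open>(e - t * d ^ n) * h\<close> up to a constant, and the right side is
  \<open>(N + 1 + \<delta>) * h\<close> up to a constant. So \<open>h\<close> is bounded as soon as
  \<open>e - (N + 1) > t * d ^ n\<close>, with \<delta> half of the excess. The supremum may not be
  attained, but some \<open>n\<close> exceeds \<open>t\<close>; it is chosen once, so a single
  exceptional set serves the whole orbit.\<close>

definition mono_val :: "(nat \<Rightarrow> 'b::comm_semiring_1) \<Rightarrow> (nat \<Rightarrow>\<^sub>0 nat) \<Rightarrow> 'b" where
  "mono_val x m = (\<Prod>i\<in>Poly_Mapping.keys m. x i ^ Poly_Mapping.lookup m i)"

lemma mono_val_superset:
  assumes "finite S" "Poly_Mapping.keys m \<subseteq> S"
  shows "mono_val x m = (\<Prod>i\<in>S. x i ^ Poly_Mapping.lookup m i)"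
  unfolding mono_val_def by (rule prod.mono_neutral_left) (use assms in \<open>auto simp: in_keys_iff\<close>)

lemma keys_add_nat: "Poly_Mapping.keys (m + m' :: nat \<Rightarrow>\<^sub>0 nat) = Poly_Mapping.keys m \<union> Poly_Mapping.keys m'"
  by (auto simp: in_keys_iff lookup_add)

lemma mono_val_add: "mono_val x (m + m') = mono_val x m * mono_val x m'"
proof -
  have "mono_val x (m + m') = (\<Prod>i\<in>Poly_Mapping.keys m \<union> Poly_Mapping.keys m'. x i ^ Poly_Mapping.lookup (m + m') i)"
    by (rule mono_val_superset) (auto simp: keys_add_nat)
  also have "\<dots> = mono_val x m * mono_val x m'"
    using mono_val_superset[where S = "Poly_Mapping.keys m \<union> Poly_Mapping.keys m'" and x = x]
    by (simp add: lookup_add power_add prod.distrib)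
  finally show ?thesis .
qed

lemma mono_val_zero [simp]: "mono_val x 0 = 1"
  by (simp add: mono_val_def)

lemma poly_mapping_sum_single:
  "(F :: 'a \<Rightarrow>\<^sub>0 'b::comm_monoid_add) = (\<Sum>m\<in>Poly_Mapping.keys F. Poly_Mapping.single m (Poly_Mapping.lookup F m))"
proof (rule poly_mapping_eqI)
  fix k
  have "(\<Sum>m\<in>Poly_Mapping.keys F. Poly_Mapping.lookup (Poly_Mapping.single m (Poly_Mapping.lookup F m)) k) =
        (\<Sum>m\<in>Poly_Mapping.keys F. if m = k then Poly_Mapping.lookup F k else 0)"
    by (rule sum.cong) (auto simp: lookup_single when_def)
  thus "Poly_Mapping.lookup F k = Poly_Mapping.lookup (\<Sum>m\<in>Poly_Mapping.keys F. Poly_Mapping.single m (Poly_Mapping.lookup F m)) k"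
    by (auto simp: lookup_sum in_keys_iff)
qed

lemma mpoly_mult_eq:
  "F * G = (\<Sum>m\<in>Poly_Mapping.keys F. \<Sum>m'\<in>Poly_Mapping.keys G.
      Poly_Mapping.single (m + m') (Poly_Mapping.lookup F m * Poly_Mapping.lookup G m'))" for F G :: mpoly
  using arg_cong2[OF poly_mapping_sum_single[of F] poly_mapping_sum_single[of G], of "(*)"]
  by (simp only: sum_product mult_single)

text \<open>Common generalisation of \<^const>\<open>peval\<close> (\<open>h = id\<close>) and \<^const>\<open>psubst\<close>
  (\<open>h = Poly_Mapping.single 0\<close>).\<close>

definition poly_hom :: "(complex \<Rightarrow> 'b::comm_ring_1) \<Rightarrow> (nat \<Rightarrow> 'b) \<Rightarrow> mpoly \<Rightarrow> 'b" where
  "poly_hom h x F = (\<Sum>m\<in>Poly_Mapping.keys F. h (Poly_Mapping.lookup F m) * mono_val x m)"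

locale coeff_hom =
  fixes h :: "complex \<Rightarrow> 'b::comm_ring_1"
  assumes h_add: "h (a + b) = h a + h b" and h_mult: "h (a * b) = h a * h b" and h_one: "h 1 = 1"
begin

lemma h_zero: "h 0 = 0"
  using h_add[of 0 0] by simp

lemma poly_hom_superset:
  assumes "finite S" "Poly_Mapping.keys F \<subseteq> S"
  shows "poly_hom h x F = (\<Sum>m\<in>S. h (Poly_Mapping.lookup F m) * mono_val x m)"
  unfolding poly_hom_def by (rule sum.mono_neutral_left) (use assms in \<open>auto simp: in_keys_iff h_zero\<close>)

lemma poly_hom_add: "poly_hom h x (F + G) = poly_hom h x F + poly_hom h x G"
proof -
  let ?S = "Poly_Mapping.keys F \<union> Poly_Mapping.keys G"
  have "Poly_Mapping.keys (F + G) \<subseteq> ?S" by (rule keys_add)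
  thus ?thesis
    using poly_hom_superset[where S = ?S and x = x]
    by (simp add: lookup_add h_add distrib_right sum.distrib)
qed

lemma poly_hom_zero [simp]: "poly_hom h x 0 = 0"
  by (simp add: poly_hom_def)

lemma poly_hom_single: "poly_hom h x (Poly_Mapping.single m a) = h a * mono_val x m"
  by (subst poly_hom_superset[where S = "{m}"]) (auto simp: h_zero)

lemma poly_hom_sum: "poly_hom h x (sum f I) = (\<Sum>i\<in>I. poly_hom h x (f i))"
  by (induction I rule: infinite_finite_induct) (auto simp: poly_hom_add)

lemma poly_hom_one [simp]: "poly_hom h x 1 = 1"
  using poly_hom_single[of x 0 1] by (simp add: h_one)

lemma poly_hom_mult: "poly_hom h x (F * G) = poly_hom h x F * poly_hom h x G"
proof -
  note mpoly_mult_eq[of F G]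
  hence "poly_hom h x (F * G) = (\<Sum>m\<in>Poly_Mapping.keys F. \<Sum>m'\<in>Poly_Mapping.keys G.
      h (Poly_Mapping.lookup F m) * h (Poly_Mapping.lookup G m') * (mono_val x m * mono_val x m'))"
    by (simp only: poly_hom_sum poly_hom_single h_mult mono_val_add)
  also have "\<dots> = poly_hom h x F * poly_hom h x G"
    by (simp add: poly_hom_def sum_product mult_ac)
  finally show ?thesis .
qed

lemma poly_hom_power: "poly_hom h x (F ^ n) = poly_hom h x F ^ n"
  by (induction n) (auto simp: poly_hom_mult)

lemma poly_hom_prod: "poly_hom h x (prod f I) = (\<Prod>i\<in>I. poly_hom h x (f i))"
  by (induction I rule: infinite_finite_induct) (auto simp: poly_hom_mult)

end

interpretation pe: coeff_hom "\<lambda>c::complex. c"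
  by standard auto

interpretation ps: coeff_hom "\<lambda>c::complex. Poly_Mapping.single 0 c :: mpoly"
  by standard (auto simp: single_add mult_single)

lemma peval_poly_hom: "peval F x = poly_hom (\<lambda>c. c) x F"
  by (simp add: peval_def poly_hom_def mono_val_def)

lemma psubst_poly_hom: "psubst F G = poly_hom (\<lambda>c. Poly_Mapping.single 0 c) G F"
  by (simp add: psubst_def poly_hom_def mono_val_def)

lemmas peval_add = pe.poly_hom_add[folded peval_poly_hom]
  and peval_zero [simp] = pe.poly_hom_zero[folded peval_poly_hom]
  and peval_one [simp] = pe.poly_hom_one[folded peval_poly_hom]
  and peval_mult = pe.poly_hom_mult[folded peval_poly_hom]
  and peval_power = pe.poly_hom_power[folded peval_poly_hom]
  and peval_sum = pe.poly_hom_sum[folded peval_poly_hom]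
  and peval_prod = pe.poly_hom_prod[folded peval_poly_hom]
  and peval_single = pe.poly_hom_single[folded peval_poly_hom]

lemma peval_mono_val: "peval F x = (\<Sum>m\<in>Poly_Mapping.keys F. Poly_Mapping.lookup F m * mono_val x m)"
  by (simp add: peval_def mono_val_def)

lemma peval_const [simp]: "peval (Poly_Mapping.single 0 c) x = c"
  by (simp add: peval_single)

lemma peval_uminus: "peval (- F) x = - peval F x"
proof -
  have "peval F x + peval (- F) x = 0"
    using peval_add[of F "- F" x] by simp
  thus ?thesis by (simp add: add_eq_0_iff)
qed

lemma peval_diff: "peval (F - G) x = peval F x - peval G x"
  using peval_add[of F "- G" x] by (simp add: peval_uminus)

lemma peval_pvar [simp]: "peval (pvar i) x = x i"
  by (simp add: pvar_def peval_single mono_val_def)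

lemma psubst_pvar [simp]: "psubst (pvar i) G = G i"
  by (simp add: psubst_poly_hom pvar_def ps.poly_hom_single mono_val_def)

lemma peval_psubst: "peval (psubst F G) x = peval F (\<lambda>i. peval (G i) x)"
  by (simp add: psubst_def peval_sum peval_mult peval_prod peval_power peval_def[of F])

lemma peval_cong:
  assumes "\<And>m i. m \<in> Poly_Mapping.keys F \<Longrightarrow> i \<in> Poly_Mapping.keys m \<Longrightarrow> x i = y i"
  shows "peval F x = peval F y"
  unfolding peval_def using assms by (intro sum.cong prod.cong arg_cong2[where f = "(*)"]) auto

section \<open>Degrees of monomials and forms\<close>

lemma mon_degree_superset:
  assumes "finite S" "Poly_Mapping.keys m \<subseteq> S"
  shows "mon_degree m = (\<Sum>i\<in>S. Poly_Mapping.lookup m i)"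
  unfolding mon_degree_def by (rule sum.mono_neutral_left) (use assms in \<open>auto simp: in_keys_iff\<close>)

lemma mon_degree_add: "mon_degree (m + m') = mon_degree m + mon_degree m'"
  using mon_degree_superset[where S = "Poly_Mapping.keys m \<union> Poly_Mapping.keys m'"]
  by (simp add: keys_add_nat lookup_add sum.distrib)

lemma mon_degree_zero [simp]: "mon_degree 0 = 0"
  by (simp add: mon_degree_def)

lemma mon_degree_single [simp]: "mon_degree (Poly_Mapping.single i k) = k"
  by (simp add: mon_degree_def)

lemma lookup_le_mon_degree: "Poly_Mapping.lookup m i \<le> mon_degree m"
  by (cases "i \<in> Poly_Mapping.keys m") (auto simp: mon_degree_def in_keys_iff intro: member_le_sum)

lemma lookup_const_mult:
  "Poly_Mapping.lookup (Poly_Mapping.single 0 c * F) m = c * Poly_Mapping.lookup F m" for F :: mpoly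
  by (simp add: Poly_Mapping.mult_map_scale_conv_mult[symmetric] Poly_Mapping.map.rep_eq when_def in_keys_iff)

lemma mono_val_scale: "mono_val (\<lambda>i. t * x i) m = t ^ mon_degree m * mono_val x m"
  for t :: "'a::comm_semiring_1"
  by (simp add: mono_val_def mon_degree_def power_mult_distrib prod.distrib power_sum)

text \<open>Coefficient domains: only the closure properties needed for composing forms.\<close>

definition semiring_set :: "complex set \<Rightarrow> bool" where
  "semiring_set A \<longleftrightarrow> 0 \<in> A \<and> 1 \<in> A \<and> (\<forall>a\<in>A. \<forall>b\<in>A. a + b \<in> A \<and> a * b \<in> A)"

lemma semiring_set_UNIV [simp]: "semiring_set UNIV" by (simp add: semiring_set_def)
lemma semiring_set_Rats [simp]: "semiring_set \<rat>" by (simp add: semiring_set_def)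

lemma form_mono: "form N A e F \<Longrightarrow> A \<subseteq> B \<Longrightarrow> form N B e F"
  by (auto simp: form_def)

lemma form_zero [simp]: "form N A e 0"
  by (simp add: form_def)

lemma form_lookup: "form N A e F \<Longrightarrow> semiring_set A \<Longrightarrow> Poly_Mapping.lookup F m \<in> A"
  by (cases "m \<in> Poly_Mapping.keys F") (auto simp: form_def in_keys_iff semiring_set_def)

lemma form_add:
  assumes "semiring_set A" "form N A e F" "form N A e G"
  shows "form N A e (F + G)"
proof -
  have "Poly_Mapping.lookup (F + G) m \<in> A" for m
    using form_lookup[OF assms(2,1)] form_lookup[OF assms(3,1)] assms(1) by (simp add: lookup_add semiring_set_def)
  thus ?thesis using assms(2,3) keys_add[of F G] unfolding form_def by blast
qed

lemma form_sum:
  assumes "semiring_set A" "\<And>i. i \<in> I \<Longrightarrow> form N A e (f i)"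
  shows "form N A e (sum f I)"
  using assms(2) by (induction I rule: infinite_finite_induct) (auto intro: form_add assms(1))

lemma form_single:
  assumes "Poly_Mapping.keys m \<subseteq> {..N}" "mon_degree m = e" "a \<in> A"
  shows "form N A e (Poly_Mapping.single m a)"
  using assms by (auto simp: form_def split: if_splits)

lemma form_mult:
  assumes "semiring_set A" "form N A e F" "form N A f G"
  shows "form N A (e + f) (F * G)"
  unfolding mpoly_mult_eq[of F G]
proof (intro form_sum assms(1) form_single)
  fix m m' assume m: "m \<in> Poly_Mapping.keys F" "m' \<in> Poly_Mapping.keys G"
  show "Poly_Mapping.keys (m + m') \<subseteq> {..N}"
    using assms(2,3) m unfolding form_def keys_add_nat by blast
  show "mon_degree (m + m') = e + f"
    using assms(2,3) m unfolding form_def mon_degree_add by simp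
  show "Poly_Mapping.lookup F m * Poly_Mapping.lookup G m' \<in> A"
    using assms m unfolding form_def semiring_set_def by blast
qed

lemma form_one: "semiring_set A \<Longrightarrow> form N A 0 1"
  using form_single[of 0 N 0 1 A] by (simp add: semiring_set_def)

lemma form_const: "c \<in> A \<Longrightarrow> form N A 0 (Poly_Mapping.single 0 c)"
  by (rule form_single) auto

lemma form_pvar: "i \<le> N \<Longrightarrow> semiring_set A \<Longrightarrow> form N A 1 (pvar i)"
  unfolding pvar_def by (rule form_single) (auto simp: semiring_set_def)

lemma form_power: "semiring_set A \<Longrightarrow> form N A e F \<Longrightarrow> form N A (n * e) (F ^ n)"
  by (induction n) (auto intro: form_one form_mult)

lemma form_prod:
  assumes "semiring_set A" "\<And>i. i \<in> I \<Longrightarrow> form N A (e i) (f i)"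
  shows "form N A (sum e I) (prod f I)"
  using assms(2) by (induction I rule: infinite_finite_induct) (auto intro: form_one form_mult assms(1))

lemma form_psubst:
  assumes A: "semiring_set A" and F: "form N A e F" and G: "\<And>i. i \<le> N \<Longrightarrow> form N A f (G i)"
  shows "form N A (e * f) (psubst F G)"
  unfolding psubst_def
proof (rule form_sum[OF A])
  fix m assume m: "m \<in> Poly_Mapping.keys F"
  hence m': "Poly_Mapping.lookup F m \<in> A" "Poly_Mapping.keys m \<subseteq> {..N}" "mon_degree m = e"
    using F by (auto simp: form_def)
  have "form N A (\<Sum>i\<in>Poly_Mapping.keys m. Poly_Mapping.lookup m i * f) (\<Prod>i\<in>Poly_Mapping.keys m. G i ^ Poly_Mapping.lookup m i)"
  proof (intro form_prod A)
    fix i assume "i \<in> Poly_Mapping.keys m"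
    hence "i \<le> N" using m' by blast
    thus "form N A (Poly_Mapping.lookup m i * f) (G i ^ Poly_Mapping.lookup m i)"
      by (rule form_power[OF A G])
  qed
  moreover have "(\<Sum>i\<in>Poly_Mapping.keys m. Poly_Mapping.lookup m i * f) = e * f"
    using m'(3) by (simp add: mon_degree_def flip: sum_distrib_right)
  ultimately have "form N A (e * f) (\<Prod>i\<in>Poly_Mapping.keys m. G i ^ Poly_Mapping.lookup m i)" by simp
  from form_mult[OF A form_const[OF m'(1), of N] this]
  show "form N A (e * f) (Poly_Mapping.single 0 (Poly_Mapping.lookup F m) * (\<Prod>i\<in>Poly_Mapping.keys m. G i ^ Poly_Mapping.lookup m i))"
    by simp
qed

lemma form_cong:
  assumes "form N A e F" "\<And>i. i \<le> N \<Longrightarrow> x i = y i"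
  shows "peval F x = peval F y"
  by (rule peval_cong) (use assms in \<open>auto simp: form_def\<close>)

lemma form_scale: "form N A e F \<Longrightarrow> peval F (\<lambda>i. t * x i) = t ^ e * peval F x"
  by (simp add: peval_mono_val mono_val_scale form_def sum_distrib_left mult_ac)

lemma divisor_degree_form: "form N A e F \<Longrightarrow> F \<noteq> 0 \<Longrightarrow> divisor_degree F = e"
  unfolding divisor_degree_def
  by (subst image_cong[OF refl, of _ _ "\<lambda>_. e"]) (auto simp: form_def image_constant_conv)

section \<open>Nonvanishing and homogeneous components\<close>

text \<open>Gaussian elimination by induction on the equations \<open>B\<close>: an unknown
  \<open>a0\<close> with nonzero coefficient in the new equation is solved for and substituted into
  the others. This is the dimension count behind algebraic dependence, the Nullstellensatz and the
  sums of algebraic numbers.\<close>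

lemma lin_dep:
  fixes f :: "'a \<Rightarrow> 'b \<Rightarrow> 'c::field"
  assumes "finite B" "finite A" "card B < card A"
  shows "\<exists>c. (\<exists>a\<in>A. c a \<noteq> 0) \<and> (\<forall>b\<in>B. (\<Sum>a\<in>A. c a * f a b) = 0)"
  using assms
proof (induction B arbitrary: A f rule: finite_induct)
  case empty
  then obtain a where "a \<in> A" by fastforce
  thus ?case by (intro exI[of _ "\<lambda>_. 1"]) auto
next
  case (insert b B)
  show ?case
  proof (cases "\<forall>a\<in>A. f a b = 0")
    case True
    have "card B < card A" using insert by simp
    with insert.IH[OF insert.prems(1)] obtain c where "\<exists>a\<in>A. c a \<noteq> 0" "\<forall>b\<in>B. (\<Sum>a\<in>A. c a * f a b) = 0"
      by meson
    thus ?thesis using True by (intro exI[of _ c]) auto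
  next
    case False
    then obtain a0 where a0: "a0 \<in> A" "f a0 b \<noteq> 0" by blast
    define A' where "A' = A - {a0}"
    have "card B < card A'" "finite A'" using insert a0 by (auto simp: A'_def)
    from insert.IH[OF this(2,1), of "\<lambda>a b'. f a b' - f a b / f a0 b * f a0 b'"]
    obtain c where c: "\<exists>a\<in>A'. c a \<noteq> 0"
      "\<And>b'. b' \<in> B \<Longrightarrow> (\<Sum>a\<in>A'. c a * (f a b' - f a b / f a0 b * f a0 b')) = 0" by blast
    define s where "s = (\<Sum>a\<in>A'. c a * f a b)"
    define c' where "c' a = (if a = a0 then - s / f a0 b else c a)" for a
    have sum: "(\<Sum>a\<in>A. c' a * g a) = - s / f a0 b * g a0 + (\<Sum>a\<in>A'. c a * g a)" for g
    proof -
      have "(\<Sum>a\<in>A. c' a * g a) = c' a0 * g a0 + (\<Sum>a\<in>A'. c' a * g a)"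
        unfolding A'_def using insert.prems a0 by (intro sum.remove) auto
      also have "(\<Sum>a\<in>A'. c' a * g a) = (\<Sum>a\<in>A'. c a * g a)"
        by (rule sum.cong) (auto simp: c'_def A'_def)
      finally show ?thesis by (simp add: c'_def)
    qed
    have 1: "\<exists>a\<in>A. c' a \<noteq> 0" using c(1) by (auto simp: c'_def A'_def)
    have 2: "(\<Sum>a\<in>A. c' a * f a b') = 0" if "b' \<in> B" for b'
    proof -
      have "(\<Sum>a\<in>A'. c a * (f a b' - f a b / f a0 b * f a0 b')) =
            (\<Sum>a\<in>A'. c a * f a b') - s / f a0 b * f a0 b'"
        by (simp add: right_diff_distrib sum_subtractf s_def sum_distrib_left sum_divide_distrib mult_ac)
      thus ?thesis using c(2)[OF that] sum[of "\<lambda>a. f a b'"] by simp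
    qed
    have 3: "(\<Sum>a\<in>A. c' a * f a b) = 0"
      using sum[of "\<lambda>a. f a b"] a0 by (simp add: s_def)
    show ?thesis using 1 2 3 by (intro exI[of _ c']) auto
  qed
qed

lemma digit_sum_less:
  fixes B :: nat
  assumes "\<And>i. i < n \<Longrightarrow> f i < B"
  shows "(\<Sum>i<n. f i * B ^ i) < B ^ n"
  using assms
proof (induction n)
  case (Suc n)
  have "(\<Sum>i<n. f i * B ^ i) < B ^ n" using Suc by simp
  moreover have "f n * B ^ n \<le> (B - 1) * B ^ n" using Suc.prems[of n] by (intro mult_le_mono1) simp
  moreover have "B > 0" using Suc.prems[of n] by auto
  hence "(B - 1) * B ^ n + B ^ n = B ^ Suc n" by (cases B) (auto simp: algebra_simps)
  ultimately show ?case unfolding sum.lessThan_Suc by linarith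
qed simp

text \<open>Uniqueness of digits in base \<open>B\<close>, by division by the highest power. It
  makes the Kronecker substitution below injective on monomials.\<close>

lemma digit_sum_inj:
  fixes B :: nat
  assumes "\<And>i. i < n \<Longrightarrow> f i < B" "\<And>i. i < n \<Longrightarrow> g i < B"
    and "(\<Sum>i<n. f i * B ^ i) = (\<Sum>i<n. g i * B ^ i)" "i < n"
  shows "f i = g i"
  using assms
proof (induction n arbitrary: i)
  case (Suc n)
  let ?F = "\<Sum>i<n. f i * B ^ i" and ?G = "\<Sum>i<n. g i * B ^ i"
  have F: "?F < B ^ n" and G: "?G < B ^ n" using Suc.prems by (auto intro!: digit_sum_less)
  have "(?F + f n * B ^ n) div B ^ n = (?G + g n * B ^ n) div B ^ n" using Suc.prems(3) by simp
  moreover have "B ^ n > 0" by (rule le_less_trans[OF le0 F])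
  ultimately have n: "f n = g n" using F G by simp
  hence "?F = ?G" using Suc.prems(3) by simp
  hence "i < n \<Longrightarrow> f i = g i" by (intro Suc.IH Suc.prems(1,2)) simp_all
  thus ?case using Suc.prems(4) n by (cases "i = n") simp_all
qed simp

text \<open>Kronecker substitution \<open>x\<^sub>i = t ^ (B ^ i)\<close> reduces this to univariate polynomials.\<close>

lemma peval_nonzero:
  assumes "F \<noteq> 0"
  shows "\<exists>x. peval F x \<noteq> 0"
proof -
  define I where "I = (\<Union>m\<in>Poly_Mapping.keys F. Poly_Mapping.keys m)"
  obtain n where n: "I \<subseteq> {..<n}"
    using finite_nat_bounded[of I] by (auto simp: I_def)
  \<comment> \<open>Larger than every exponent in \<open>F\<close>, so that the exponents of a
    monomial are the base \<open>B\<close> digits of its weight \<open>wt\<close>.\<close>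
  define B where "B = Suc (\<Sum>m\<in>Poly_Mapping.keys F. mon_degree m)"
  define wt where "wt m = (\<Sum>i<n. Poly_Mapping.lookup m i * B ^ i)" for m :: "nat \<Rightarrow>\<^sub>0 nat"
  have keys_n: "Poly_Mapping.keys m \<subseteq> {..<n}" if "m \<in> Poly_Mapping.keys F" for m
    using n that by (auto simp: I_def)
  have lookup_B: "Poly_Mapping.lookup m i < B" if "m \<in> Poly_Mapping.keys F" for m i
  proof -
    have "mon_degree m \<le> (\<Sum>m\<in>Poly_Mapping.keys F. mon_degree m)"
      using that by (intro member_le_sum) auto
    thus ?thesis using lookup_le_mon_degree[of m i] by (simp add: B_def)
  qed
  have inj: "m = m'" if m: "m \<in> Poly_Mapping.keys F" "m' \<in> Poly_Mapping.keys F" "wt m = wt m'" for m m'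
  proof (rule poly_mapping_eqI)
    fix i show "Poly_Mapping.lookup m i = Poly_Mapping.lookup m' i"
    proof (cases "i < n")
      case True
      show ?thesis
        by (rule digit_sum_inj[of n _ B, OF lookup_B lookup_B _ True]) (use m in \<open>auto simp: wt_def\<close>)
    next
      case False
      hence "i \<notin> Poly_Mapping.keys m" "i \<notin> Poly_Mapping.keys m'" using keys_n m by blast+
      thus ?thesis by (simp add: in_keys_iff)
    qed
  qed
  define p where "p = (\<Sum>m\<in>Poly_Mapping.keys F. Polynomial.monom (Poly_Mapping.lookup F m) (wt m))"
  have ev: "peval F (\<lambda>i. t ^ (B ^ i)) = poly p t" for t
  proof -
    have "mono_val (\<lambda>i. t ^ (B ^ i)) m = t ^ wt m" if "m \<in> Poly_Mapping.keys F" for m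
      using mono_val_superset[of "{..<n}" m "\<lambda>i. t ^ (B ^ i)"] keys_n[OF that]
      by (simp add: wt_def power_sum power_mult[symmetric] mult.commute)
    thus ?thesis by (simp add: peval_mono_val p_def poly_sum poly_monom)
  qed
  obtain m0 where m0: "m0 \<in> Poly_Mapping.keys F" using assms by fastforce
  have "Polynomial.coeff p (wt m0) = (\<Sum>m\<in>Poly_Mapping.keys F. if m = m0 then Poly_Mapping.lookup F m else 0)"
    unfolding p_def coeff_sum by (rule sum.cong) (use inj m0 in auto)
  also have "\<dots> = Poly_Mapping.lookup F m0" using m0 by simp
  finally have "p \<noteq> 0" using m0 by (auto simp: in_keys_iff)
  hence "finite {t. poly p t = 0}" by (rule poly_roots_finite)
  hence "{t. poly p t = 0} \<noteq> UNIV" using infinite_UNIV_char_0 by metis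
  thus ?thesis using ev by auto
qed

lemma peval_ext: "(\<And>x. peval F x = peval G x) \<Longrightarrow> F = G"
  using peval_nonzero[of "F - G"] by (auto simp: peval_diff)

section \<open>Homogeneous components\<close>

definition hom_comp :: "nat \<Rightarrow> mpoly \<Rightarrow> mpoly" where
  "hom_comp e F = (\<Sum>m\<in>{m\<in>Poly_Mapping.keys F. mon_degree m = e}. Poly_Mapping.single m (Poly_Mapping.lookup F m))"

lemma lookup_hom_comp: "Poly_Mapping.lookup (hom_comp e F) m = (if mon_degree m = e then Poly_Mapping.lookup F m else 0)"
proof -
  have "Poly_Mapping.lookup (hom_comp e F) m = (\<Sum>m'\<in>{m'\<in>Poly_Mapping.keys F. mon_degree m' = e}. if m' = m then Poly_Mapping.lookup F m else 0)"
    unfolding hom_comp_def lookup_sum by (rule sum.cong) (auto simp: lookup_single when_def)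
  thus ?thesis by (auto simp: in_keys_iff)
qed

lemma form_hom_comp:
  assumes "\<And>m. m \<in> Poly_Mapping.keys F \<Longrightarrow> Poly_Mapping.keys m \<subseteq> {..N}"
  shows "form N UNIV e (hom_comp e F)"
  unfolding form_def
proof (intro ballI conjI)
  fix m assume "m \<in> Poly_Mapping.keys (hom_comp e F)"
  hence "m \<in> Poly_Mapping.keys F" "mon_degree m = e"
    by (auto simp: in_keys_iff[of m] lookup_hom_comp split: if_splits)
  thus "Poly_Mapping.keys m \<subseteq> {..N}" "mon_degree m = e" using assms by auto
qed auto

text \<open>Along the line through \<open>x\<close>, \<open>F\<close> becomes a polynomial in
  \<open>t\<close> whose coefficients are the values at \<open>x\<close> of the homogeneous
  components. With infinitely many zeros it has only zero coefficients.\<close>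

lemma peval_hom_comp_zero:
  assumes "\<And>t. t \<noteq> 0 \<Longrightarrow> peval F (\<lambda>i. t * x i) = 0"
  shows "peval (hom_comp e F) x = 0"
proof -
  define p where "p = (\<Sum>m\<in>Poly_Mapping.keys F. Polynomial.monom (Poly_Mapping.lookup F m * mono_val x m) (mon_degree m))"
  have "poly p t = peval F (\<lambda>i. t * x i)" for t
    by (simp add: p_def poly_sum poly_monom peval_mono_val mono_val_scale mult_ac)
  hence "-{0} \<subseteq> {t. poly p t = 0}" using assms by auto
  moreover have "infinite (-{0::complex})" by (simp add: infinite_UNIV_char_0)
  ultimately have "p = 0" using poly_roots_finite[of p] finite_subset by blast
  have "Polynomial.coeff p e = (\<Sum>m\<in>Poly_Mapping.keys F. if mon_degree m = e then Poly_Mapping.lookup F m * mono_val x m else 0)"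
    unfolding p_def coeff_sum by (rule sum.cong) auto
  also have "\<dots> = (\<Sum>m\<in>{m \<in> Poly_Mapping.keys F. mon_degree m = e}. Poly_Mapping.lookup F m * mono_val x m)"
    by (rule sum.inter_filter[symmetric]) simp
  also have "\<dots> = peval (hom_comp e F) x"
    by (simp only: hom_comp_def peval_sum peval_single)
  finally have "peval (hom_comp e F) x = Polynomial.coeff p e" ..
  thus ?thesis using \<open>p = 0\<close> by simp
qed

section \<open>Algebraic dependence\<close>

text \<open>\<open>N + 2\<close> polynomials in \<open>N + 1\<close> variables are algebraically dependent: for large \<open>M\<close> there are
  more products of their powers with exponents at most \<open>M\<close> than monomials available.\<close>

lemma bounded_prod_power:
  assumes "\<And>i m. i \<in> I \<Longrightarrow> m \<in> Poly_Mapping.keys (P i) \<Longrightarrow> Poly_Mapping.keys m \<subseteq> {..N} \<and> mon_degree m \<le> K"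
    and "finite I" "m \<in> Poly_Mapping.keys (\<Prod>i\<in>I. P i ^ a i :: mpoly)"
  shows "Poly_Mapping.keys m \<subseteq> {..N} \<and> mon_degree m \<le> K * sum a I"
proof -
  have pow: "Poly_Mapping.keys m \<subseteq> {..N} \<and> mon_degree m \<le> K * k"
    if "\<forall>m\<in>Poly_Mapping.keys Q. Poly_Mapping.keys m \<subseteq> {..N} \<and> mon_degree m \<le> K" "m \<in> Poly_Mapping.keys (Q ^ k)"
    for Q :: mpoly and k m
    using that(2)
  proof (induction k arbitrary: m)
    case (Suc k)
    then obtain m1 m2 where "m = m1 + m2" "m1 \<in> Poly_Mapping.keys Q" "m2 \<in> Poly_Mapping.keys (Q ^ k)"
      using keys_mult[of Q "Q ^ k"] by auto
    moreover from this(2) have "Poly_Mapping.keys m1 \<subseteq> {..N} \<and> mon_degree m1 \<le> K" using that(1) by blast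
    ultimately show ?case using Suc.IH[of m2] by (simp add: keys_add_nat mon_degree_add)
  qed simp
  show ?thesis using assms(2,1,3)
  proof (induction I arbitrary: m rule: finite_induct)
    case (insert i I)
    then obtain m1 m2 where m: "m = m1 + m2" "m1 \<in> Poly_Mapping.keys (P i ^ a i)" "m2 \<in> Poly_Mapping.keys (\<Prod>i\<in>I. P i ^ a i)"
      using keys_mult[of "P i ^ a i" "\<Prod>i\<in>I. P i ^ a i"] by auto
    have "Poly_Mapping.keys m2 \<subseteq> {..N} \<and> mon_degree m2 \<le> K * sum a I"
      by (rule insert.IH[OF _ m(3)]) (use insert.prems(1) in blast)
    moreover have "Poly_Mapping.keys m1 \<subseteq> {..N} \<and> mon_degree m1 \<le> K * a i"
      by (rule pow[OF _ m(2)]) (use insert.prems(1)[of i] in auto)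
    ultimately show ?case using insert.hyps m(1) by (simp add: keys_add_nat mon_degree_add distrib_left)
  qed simp
qed

text \<open>A crude count: each of the \<open>N + 1\<close> exponents lies between \<open>0\<close>
  and \<open>L\<close>. The bound grows like the power \<open>N + 1\<close> of \<open>L\<close>,
  which loses against \<open>N + 2\<close> free exponents.\<close>

lemma card_bounded_monomials:
  "finite {m :: nat \<Rightarrow>\<^sub>0 nat. Poly_Mapping.keys m \<subseteq> {..N} \<and> mon_degree m \<le> L}"
  "card {m :: nat \<Rightarrow>\<^sub>0 nat. Poly_Mapping.keys m \<subseteq> {..N} \<and> mon_degree m \<le> L} \<le> Suc L ^ Suc N"
proof -
  let ?B = "{m :: nat \<Rightarrow>\<^sub>0 nat. Poly_Mapping.keys m \<subseteq> {..N} \<and> mon_degree m \<le> L}"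
  let ?r = "\<lambda>m :: nat \<Rightarrow>\<^sub>0 nat. restrict (Poly_Mapping.lookup m) {..N}"
  have inj: "inj_on ?r ?B"
  proof (rule inj_onI)
    fix m m' assume m: "m \<in> ?B" "m' \<in> ?B" and eq: "?r m = ?r m'"
    show "m = m'"
    proof (rule poly_mapping_eqI)
      fix i show "Poly_Mapping.lookup m i = Poly_Mapping.lookup m' i"
      proof (cases "i \<le> N")
        case True thus ?thesis using fun_cong[OF eq, of i] by simp
      next
        case False
        hence "i \<notin> Poly_Mapping.keys m" "i \<notin> Poly_Mapping.keys m'" using m by auto
        thus ?thesis by (simp add: in_keys_iff)
      qed
    qed
  qed
  have sub: "?r ` ?B \<subseteq> (\<Pi>\<^sub>E i\<in>{..N}. {..L})"
    by (auto intro: order_trans[OF lookup_le_mon_degree] split: if_splits)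
  have fin: "finite (\<Pi>\<^sub>E i\<in>{..N}. {..L})" by (intro finite_PiE) auto
  show "finite ?B" using finite_imageD[OF finite_subset[OF sub fin] inj] .
  have "card ?B = card (?r ` ?B)" using inj by (simp add: card_image)
  also have "\<dots> \<le> card (\<Pi>\<^sub>E i\<in>{..N}. {..L})" by (rule card_mono[OF fin sub])
  finally show "card ?B \<le> Suc L ^ Suc N" by (simp add: card_PiE)
qed

lemma algebraic_dependence:
  fixes P :: "nat \<Rightarrow> mpoly"
  assumes P: "\<And>i m. i \<le> Suc N \<Longrightarrow> m \<in> Poly_Mapping.keys (P i) \<Longrightarrow> Poly_Mapping.keys m \<subseteq> {..N} \<and> mon_degree m \<le> K"
  shows "\<exists>A c. finite A \<and> A \<subseteq> extensional {..Suc N} \<and> (\<exists>a\<in>A. c a \<noteq> 0) \<and>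
           (\<Sum>a\<in>A. Poly_Mapping.single 0 (c a) * (\<Prod>i\<le>Suc N. P i ^ a i)) = 0"
proof -
  \<comment> \<open>The constants are made for \<open>Suc L \<le> K' * Suc M\<close> and
    \<open>K' ^ Suc N = M\<close>: then there are at most
    \<open>(K' * Suc M) ^ Suc N = M * Suc M ^ Suc N\<close> monomials, fewer than the
    \<open>Suc M ^ Suc (Suc N)\<close> products.\<close>
  define K' where "K' = (N + 2) * K + 1"
  define M where "M = K' ^ Suc N"
  define A where "A = (\<Pi>\<^sub>E i\<in>{..Suc N}. {..M})"
  define L where "L = K * ((N + 2) * M)"
  define B where "B = {m :: nat \<Rightarrow>\<^sub>0 nat. Poly_Mapping.keys m \<subseteq> {..N} \<and> mon_degree m \<le> L}"
  have B: "finite B" "card B \<le> Suc L ^ Suc N" using card_bounded_monomials[of N L] by (simp_all add: B_def)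
  have A: "finite A" "card A = Suc M ^ Suc (Suc N)" by (auto simp: A_def card_PiE intro!: finite_PiE)
  have "Suc L \<le> K' * Suc M" by (simp add: L_def K'_def algebra_simps)
  hence "Suc L ^ Suc N \<le> (K' * Suc M) ^ Suc N" by (rule power_mono) simp
  also have "\<dots> = M * Suc M ^ Suc N" by (simp only: power_mult_distrib M_def)
  also have "\<dots> < Suc M * Suc M ^ Suc N" by (intro mult_strict_right_mono) auto
  finally have "card B < card A" using A B by simp
  from lin_dep[OF B(1) A(1) this, of "\<lambda>a. Poly_Mapping.lookup (\<Prod>i\<le>Suc N. P i ^ a i)"]
  obtain c where c: "\<exists>a\<in>A. c a \<noteq> 0"
    "\<And>m. m \<in> B \<Longrightarrow> (\<Sum>a\<in>A. c a * Poly_Mapping.lookup (\<Prod>i\<le>Suc N. P i ^ a i) m) = 0" by blast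
  have supp: "m \<in> B" if "a \<in> A" "m \<in> Poly_Mapping.keys (\<Prod>i\<le>Suc N. P i ^ a i)" for a m
  proof -
    have "Poly_Mapping.keys m \<subseteq> {..N} \<and> mon_degree m \<le> K * sum a {..Suc N}"
      by (rule bounded_prod_power[OF _ _ that(2)]) (use P in auto)
    moreover have "sum a {..Suc N} \<le> (N + 2) * M"
      using sum_bounded_above[of "{..Suc N}" a M] that(1) by (auto simp: A_def PiE_def Pi_def)
    hence "K * sum a {..Suc N} \<le> L" by (simp add: L_def)
    ultimately show ?thesis unfolding B_def using order_trans by blast
  qed
  have "(\<Sum>a\<in>A. Poly_Mapping.single 0 (c a) * (\<Prod>i\<le>Suc N. P i ^ a i)) = 0"
  proof (rule poly_mapping_eqI)
    fix m
    have "(\<Sum>a\<in>A. c a * Poly_Mapping.lookup (\<Prod>i\<le>Suc N. P i ^ a i) m) = 0"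
    proof (cases "m \<in> B")
      case False
      hence "Poly_Mapping.lookup (\<Prod>i\<le>Suc N. P i ^ a i) m = 0" if "a \<in> A" for a
        using supp[OF that, of m] by (auto simp only: in_keys_iff)
      thus ?thesis by simp
    qed (rule c(2))
    thus "Poly_Mapping.lookup (\<Sum>a\<in>A. Poly_Mapping.single 0 (c a) * (\<Prod>i\<le>Suc N. P i ^ a i)) m = Poly_Mapping.lookup 0 m"
      by (simp only: lookup_sum lookup_const_mult lookup_zero)
  qed
  moreover have "A \<subseteq> extensional {..Suc N}" by (auto simp: A_def PiE_def)
  ultimately show ?thesis using A(1) c(1) by blast
qed

section \<open>Sets that are not Zariski dense\<close>

lemma lookup_mk_mono:
  fixes N :: nat
  shows "Poly_Mapping.lookup (\<Sum>i\<le>N. Poly_Mapping.single i (a i :: nat)) j = (if j \<le> N then a j else 0)"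
proof -
  have "Poly_Mapping.lookup (\<Sum>i\<le>N. Poly_Mapping.single i (a i)) j = (\<Sum>i\<le>N. if i = j then a j else 0)"
    unfolding lookup_sum by (rule sum.cong) (auto simp: lookup_single when_def)
  thus ?thesis by simp
qed

text \<open>A relation between \<open>H\<close> and the \<open>\<psi> i\<close>, divided by the largest possible power of \<open>H\<close>, restricts
  on \<open>H = 0\<close> to a nontrivial relation between the \<open>\<psi> i\<close>.\<close>

lemma image_hypersurface:
  assumes H: "form N UNIV e H" "H \<noteq> 0" and \<psi>: "\<And>i. i \<le> N \<Longrightarrow> form N UNIV f (\<psi> i)" and f: "f > 0"
  shows "\<exists>G e'. G \<noteq> 0 \<and> form N UNIV e' G \<and> (\<forall>x. peval H x = 0 \<longrightarrow> peval G (\<lambda>i. peval (\<psi> i) x) = 0)"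
proof -
  define P where "P i = (if i \<le> N then \<psi> i else H)" for i
  have P_bound: "Poly_Mapping.keys m \<subseteq> {..N} \<and> mon_degree m \<le> max e f" if "i \<le> Suc N" "m \<in> Poly_Mapping.keys (P i)" for i m
    using that H(1) \<psi>[of i] by (auto simp: P_def form_def split: if_splits)
  have "\<exists>A c. finite A \<and> A \<subseteq> extensional {..Suc N} \<and> (\<exists>a\<in>A. c a \<noteq> 0) \<and>
           (\<Sum>a\<in>A. Poly_Mapping.single 0 (c a) * (\<Prod>i\<le>Suc N. P i ^ a i)) = 0"
    by (rule algebraic_dependence[of N P "max e f"]) (rule P_bound)
  then obtain A c where A: "finite A" "A \<subseteq> extensional {..Suc N}"
    and c: "\<exists>a\<in>A. c a \<noteq> 0"
    and rel: "(\<Sum>a\<in>A. Poly_Mapping.single 0 (c a) * (\<Prod>i\<le>Suc N. P i ^ a i)) = 0"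
    by (elim exE conjE) (rule that)
  \<comment> \<open>Only terms that really occur may determine the power of \<open>H\<close> to be
    divided out; otherwise the relation left on \<open>H = 0\<close> could be trivial.\<close>
  define A0 where "A0 = {a \<in> A. c a \<noteq> 0}"
  define j0 where "j0 = Min ((\<lambda>a. a (Suc N)) ` A0)"
  have A0: "finite A0" "A0 \<noteq> {}" using A(1) c by (auto simp: A0_def)
  have "j0 \<in> (\<lambda>a. a (Suc N)) ` A0" unfolding j0_def using A0 by (intro Min_in) auto
  then obtain a1 where a1: "a1 \<in> A0" "a1 (Suc N) = j0" by blast
  have j0_le: "j0 \<le> a (Suc N)" if "a \<in> A0" for a using that A0 by (auto simp: j0_def)
  have prodP: "(\<Prod>i\<le>Suc N. P i ^ a i) = (\<Prod>i\<le>N. \<psi> i ^ a i) * H ^ a (Suc N)" for a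
  proof -
    have "(\<Prod>i\<le>N. P i ^ a i) = (\<Prod>i\<le>N. \<psi> i ^ a i)" by (rule prod.cong) (auto simp: P_def)
    thus ?thesis by (simp add: P_def)
  qed
  define R where "R = (\<Sum>a\<in>A0. Poly_Mapping.single 0 (c a) * ((\<Prod>i\<le>N. \<psi> i ^ a i) * H ^ (a (Suc N) - j0)))"
  have "(\<Sum>a\<in>A0. Poly_Mapping.single 0 (c a) * ((\<Prod>i\<le>N. \<psi> i ^ a i) * H ^ a (Suc N))) =
        (\<Sum>a\<in>A. Poly_Mapping.single 0 (c a) * ((\<Prod>i\<le>N. \<psi> i ^ a i) * H ^ a (Suc N)))"
    by (rule sum.mono_neutral_left) (use A(1) in \<open>auto simp: A0_def\<close>)
  hence "0 = (\<Sum>a\<in>A0. Poly_Mapping.single 0 (c a) * ((\<Prod>i\<le>N. \<psi> i ^ a i) * H ^ a (Suc N)))"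
    using rel by (simp only: prodP)
  also have "\<dots> = (\<Sum>a\<in>A0. H ^ j0 * (Poly_Mapping.single 0 (c a) * ((\<Prod>i\<le>N. \<psi> i ^ a i) * H ^ (a (Suc N) - j0))))"
  proof (rule sum.cong[OF refl])
    fix a assume "a \<in> A0"
    hence "H ^ a (Suc N) = H ^ j0 * H ^ (a (Suc N) - j0)"
      using j0_le by (simp flip: power_add)
    thus "Poly_Mapping.single 0 (c a) * ((\<Prod>i\<le>N. \<psi> i ^ a i) * H ^ a (Suc N)) =
          H ^ j0 * (Poly_Mapping.single 0 (c a) * ((\<Prod>i\<le>N. \<psi> i ^ a i) * H ^ (a (Suc N) - j0)))"
      by (simp only: mult_ac)
  qed
  also have "\<dots> = H ^ j0 * R" by (simp only: R_def sum_distrib_left)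
  \<comment> \<open>Polynomials have no zero divisors, so \<open>H ^ j0\<close> cancels.\<close>
  finally have R: "R = 0" using H(2) by simp
  define mk where "mk a = (\<Sum>i\<le>N. Poly_Mapping.single i (a i :: nat))" for a
  \<comment> \<open>The terms of \<open>R\<close> that survive on \<open>H = 0\<close>. Their last
    exponent is fixed, hence the first \<open>N + 1\<close> exponents, that is the monomial
    \<open>mk a\<close>, determine \<open>a\<close>.\<close>
  define A1 where "A1 = {a \<in> A0. a (Suc N) = j0}"
  have A1: "finite A1" "a1 \<in> A1" using A0 a1 by (auto simp: A1_def)
  define G where "G = (\<Sum>a\<in>A1. Poly_Mapping.single (mk a) (c a))"
  have mk_inj: "a = a1" if "a \<in> A1" "mk a = mk a1" for a
  proof (rule extensionalityI)
    show "a \<in> extensional {..Suc N}" "a1 \<in> extensional {..Suc N}" using that A1 A by (auto simp: A1_def A0_def)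
    fix i assume "i \<in> {..Suc N}"
    thus "a i = a1 i"
      using that(1) A1(2) arg_cong[OF that(2), of "\<lambda>m. Poly_Mapping.lookup m i"]
      by (cases "i = Suc N") (auto simp: mk_def lookup_mk_mono A1_def)
  qed
  have "Poly_Mapping.lookup G (mk a1) = (\<Sum>a\<in>A1. if a = a1 then c a1 else 0)"
    unfolding G_def lookup_sum by (rule sum.cong) (use mk_inj in \<open>auto simp: lookup_single when_def\<close>)
  hence "Poly_Mapping.lookup G (mk a1) \<noteq> 0" using A1 by (simp add: A1_def A0_def)
  \<comment> \<open>The relation \<open>G\<close> may mix degrees; the component containing the
    monomial of \<open>a1\<close> is nonzero and will be the required form.\<close>
  moreover define e' where "e' = mon_degree (mk a1)"
  ultimately have "Poly_Mapping.lookup (hom_comp e' G) (mk a1) \<noteq> 0" by (simp add: lookup_hom_comp)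
  hence nz: "hom_comp e' G \<noteq> 0" by auto
  have keys_mk: "Poly_Mapping.keys (mk a) \<subseteq> {..N}" for a
    by (auto simp: in_keys_iff mk_def lookup_mk_mono split: if_splits)
  have keys_G: "m \<in> mk ` A1" if "m \<in> Poly_Mapping.keys G" for m
    using that keys_sum[of "\<lambda>a. Poly_Mapping.single (mk a) (c a)" A1]
    unfolding G_def by (auto split: if_splits)
  have form: "form N UNIV e' (hom_comp e' G)"
  proof (rule form_hom_comp)
    fix m assume "m \<in> Poly_Mapping.keys G"
    hence "m \<in> mk ` A1" by (rule keys_G)
    thus "Poly_Mapping.keys m \<subseteq> {..N}" using keys_mk by blast
  qed
  have mono_mk: "mono_val y (mk a) = (\<Prod>i\<le>N. y i ^ a i)" for y :: "nat \<Rightarrow> complex" and a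
    using mono_val_superset[OF _ keys_mk[of a], of y] by (simp add: mk_def lookup_mk_mono)
  have van: "peval G (\<lambda>i. peval (\<psi> i) x) = 0" if "peval H x = 0" for x
  proof -
    have "peval R x = 0" using R by simp
    hence "0 = (\<Sum>a\<in>A0. c a * ((\<Prod>i\<le>N. peval (\<psi> i) x ^ a i) * 0 ^ (a (Suc N) - j0)))"
      by (simp add: R_def peval_sum peval_mult peval_prod peval_power that)
    also have "\<dots> = (\<Sum>a\<in>A1. c a * ((\<Prod>i\<le>N. peval (\<psi> i) x ^ a i) * 0 ^ (a (Suc N) - j0)))"
    proof (rule sum.mono_neutral_right[OF A0(1)])
      show "\<forall>a\<in>A0 - A1. c a * ((\<Prod>i\<le>N. peval (\<psi> i) x ^ a i) * 0 ^ (a (Suc N) - j0)) = 0"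
      proof
        fix a assume "a \<in> A0 - A1"
        hence "a (Suc N) - j0 > 0" using j0_le[of a] by (auto simp: A1_def)
        thus "c a * ((\<Prod>i\<le>N. peval (\<psi> i) x ^ a i) * 0 ^ (a (Suc N) - j0)) = 0" by (simp add: power_0_left)
      qed
    qed (auto simp: A1_def)
    \<comment> \<open>On \<open>A1\<close> the exponent of \<open>0\<close> is \<open>0\<close>, and
      \<open>0 ^ 0 = 1\<close>.\<close>
    also have "\<dots> = (\<Sum>a\<in>A1. c a * (\<Prod>i\<le>N. peval (\<psi> i) x ^ a i))"
      by (rule sum.cong) (auto simp: A1_def)
    also have "\<dots> = peval G (\<lambda>i. peval (\<psi> i) x)"
      by (simp add: G_def peval_sum peval_single mono_mk)
    finally show ?thesis by simp
  qed
  have "peval (hom_comp e' G) (\<lambda>i. peval (\<psi> i) x) = 0" if x: "peval H x = 0" for x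
  proof (rule peval_hom_comp_zero)
    fix t :: complex assume "t \<noteq> 0"
    \<comment> \<open>An \<open>f\<close>-th root of \<open>t\<close>, which exists since
      \<open>f > 0\<close>: scaling \<open>x\<close> by \<open>s\<close> stays on
      \<open>H = 0\<close> and scales every \<open>\<psi> i\<close> by \<open>t\<close>. So
      \<open>G\<close> vanishes on the whole line through the image point, and therefore so does
      each of its components.\<close>
    define s where "s = exp (Ln t / of_nat f)"
    have s: "s ^ f = t" using f \<open>t \<noteq> 0\<close> by (simp add: s_def flip: exp_of_nat_mult)
    have "peval H (\<lambda>i. s * x i) = 0" using x form_scale[OF H(1)] by simp
    hence "peval G (\<lambda>i. peval (\<psi> i) (\<lambda>i. s * x i)) = 0" by (rule van)
    also have "peval G (\<lambda>i. peval (\<psi> i) (\<lambda>i. s * x i)) = peval G (\<lambda>i. t * peval (\<psi> i) x)"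
    proof (rule peval_cong)
      fix m i assume "m \<in> Poly_Mapping.keys G" "i \<in> Poly_Mapping.keys m"
      moreover from this have "m \<in> mk ` A1" by (intro keys_G)
      ultimately have "i \<le> N" using keys_mk by blast
      thus "peval (\<psi> i) (\<lambda>i. s * x i) = t * peval (\<psi> i) x" using form_scale[OF \<psi>] s by simp
    qed
    finally show "peval G (\<lambda>i. t * peval (\<psi> i) x) = 0" .
  qed
  thus ?thesis using nz form by blast
qed

text \<open>A working form of non-density that is visibly stable under finite unions and, by
  \<open>image_hypersurface\<close>, under images of morphisms. Degree \<open>0\<close> is allowed,
  which makes the empty set thin.\<close>

definition thin :: "nat \<Rightarrow> (nat \<Rightarrow> complex) set set \<Rightarrow> bool" where
  "thin N A \<longleftrightarrow> (\<exists>G e. G \<noteq> 0 \<and> form N UNIV e G \<and> A \<subseteq> zero_locus N {G})"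

lemma thin_subset: "thin N B \<Longrightarrow> A \<subseteq> B \<Longrightarrow> thin N A"
  unfolding thin_def by blast

lemma peval_proj_point:
  assumes "form N A e F" "y \<in> proj_point N x"
  obtains c where "c \<noteq> 0" "peval F y = c ^ e * peval F x"
proof -
  obtain c where c: "c \<noteq> 0" "y = (\<lambda>i. if i \<le> N then c * x i else 0)" using assms(2) by (auto simp: proj_point_def)
  have "peval F y = peval F (\<lambda>i. c * x i)" by (rule form_cong[OF assms(1)]) (simp add: c)
  thus ?thesis using that[OF c(1)] form_scale[OF assms(1)] by simp
qed

lemma proj_point_self: "(\<lambda>i. if i \<le> N then x i else 0) \<in> proj_point N x"
  unfolding proj_point_def by (rule CollectI, rule exI[of _ 1]) auto

lemma proj_point_in_zero_locus:
  assumes "form N UNIV e F" "homog_coords N UNIV x"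
  shows "proj_point N x \<in> zero_locus N {F} \<longleftrightarrow> peval F x = 0"
proof
  assume "proj_point N x \<in> zero_locus N {F}"
  hence "peval F (\<lambda>i. if i \<le> N then x i else 0) = 0" using proj_point_self[of N x] by (auto simp: zero_locus_def)
  moreover have "peval F (\<lambda>i. if i \<le> N then x i else 0) = peval F x" by (rule form_cong[OF assms(1)]) simp
  ultimately show "peval F x = 0" by simp
next
  assume "peval F x = 0"
  thus "proj_point N x \<in> zero_locus N {F}"
    using assms(2) peval_proj_point[OF assms(1), of _ x]
    unfolding zero_locus_def proj_space_def by (auto elim!: peval_proj_point[OF assms(1)])
qed

lemma thin_not_dense:
  assumes "thin N A"
  shows "\<not> zariski_dense N A"
proof -
  obtain G e where G: "G \<noteq> 0" "form N UNIV e G" "A \<subseteq> zero_locus N {G}" using assms unfolding thin_def by blast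
  obtain x where x: "peval G x \<noteq> 0" using peval_nonzero[OF G(1)] by blast
  obtain y where y: "peval G y \<noteq> 0" "homog_coords N UNIV y"
  proof (cases "homog_coords N UNIV x")
    \<comment> \<open>If \<open>G\<close> is nonzero at a vector whose homogeneous coordinates all
      vanish, its degree is \<open>0\<close>. Then \<open>G\<close> is constant and any point
      serves.\<close>
    case False
    hence x0: "x i = 0" if "i \<le> N" for i using that by (auto simp: homog_coords_def)
    have "peval G (\<lambda>i. 0 * x i) = peval G x" by (rule form_cong[OF G(2)]) (simp add: x0)
    hence "e = 0" using form_scale[OF G(2), of 0 x] x by (cases "e = 0") (simp_all add: power_0_left)
    hence "peval G (\<lambda>_. 1) = peval G x"
      using form_scale[OF G(2), of 0 x] form_scale[OF G(2), of 0 "\<lambda>_. 1"] by simp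
    thus ?thesis using that[of "\<lambda>_. 1"] x by (auto simp: homog_coords_def)
  qed (use x that in blast)
  have "proj_point N y \<notin> zero_locus N {G}" using proj_point_in_zero_locus[OF G(2) y(2)] y(1) by blast
  moreover have "proj_point N y \<in> proj_space N UNIV" using y(2) by (auto simp: proj_space_def)
  moreover have "zariski_closed N (zero_locus N {G})" unfolding zariski_closed_def using G(2) by blast
  ultimately show ?thesis using G(3) unfolding zariski_dense_def by blast
qed

lemma thin_empty: "thin N {}"
  unfolding thin_def using form_one[of UNIV N] by (intro exI[of _ 1] exI[of _ 0]) auto

lemma thin_Un:
  assumes "thin N A" "thin N B"
  shows "thin N (A \<union> B)"
proof -
  obtain G e where G: "G \<noteq> 0" "form N UNIV e G" "A \<subseteq> zero_locus N {G}" using assms unfolding thin_def by blast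
  obtain H f where H: "H \<noteq> 0" "form N UNIV f H" "B \<subseteq> zero_locus N {H}" using assms unfolding thin_def by blast
  have "A \<union> B \<subseteq> zero_locus N {G * H}" using G(3) H(3) by (auto simp: zero_locus_def peval_mult)
  thus ?thesis unfolding thin_def using form_mult[OF semiring_set_UNIV G(2) H(2)] G(1) H(1)
    by (intro exI[of _ "G * H"] exI[of _ "e + f"]) auto
qed

lemma thin_Union: "finite \<A> \<Longrightarrow> (\<And>A. A \<in> \<A> \<Longrightarrow> thin N A) \<Longrightarrow> thin N (\<Union>\<A>)"
  by (induction \<A> rule: finite_induct) (auto intro: thin_empty thin_Un)

text \<open>With homogeneous coordinates \<open>x\<close> and \<open>x i \<noteq> 0\<close>, the
  linear form \<open>x i * X_j - x j * X_i\<close> vanishes at the point; \<open>N \<ge> 1\<close>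
  provides an index \<open>j\<close> different from \<open>i\<close>.\<close>

lemma thin_point:
  assumes "N \<ge> 1" "Q \<in> proj_space N UNIV"
  shows "thin N {Q}"
proof -
  obtain x where x: "homog_coords N UNIV x" "Q = proj_point N x" using assms(2) by (auto simp: proj_space_def)
  then obtain i where i: "i \<le> N" "x i \<noteq> 0" by (auto simp: homog_coords_def)
  define j where "j = (if i = 0 then 1 else 0 :: nat)"
  have j: "j \<le> N" "j \<noteq> i" using assms(1) by (auto simp: j_def)
  define G where "G = Poly_Mapping.single 0 (x i) * pvar j + Poly_Mapping.single 0 (- x j) * pvar i"
  have G: "form N UNIV (0 + 1) G" unfolding G_def
    by (intro form_add form_mult form_const form_pvar) (use i j in auto)
  have "peval G ((\<lambda>_. 0)(j := 1)) = x i" using j by (simp add: G_def peval_add peval_mult)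
  hence "G \<noteq> 0" using i by auto
  moreover have "peval G x = 0" by (simp add: G_def peval_add peval_mult)
  hence "{Q} \<subseteq> zero_locus N {G}" using proj_point_in_zero_locus[OF G x(1)] x(2) by simp
  ultimately show ?thesis unfolding thin_def using G by blast
qed

lemma thin_finite:
  assumes "N \<ge> 1" "finite A" "A \<subseteq> proj_space N UNIV"
  shows "thin N A"
  using thin_Union[of "(\<lambda>Q. {Q}) ` A" N] thin_point[OF assms(1)] assms(2,3) by auto

lemma hypersurface_thin: "hypersurface N V \<Longrightarrow> thin N V"
  unfolding hypersurface_def thin_def by blast

text \<open>\<open>proj_map\<close> evaluates at a chosen representative; these facts allow any
  point to be replaced by that representative.\<close>

lemma proj_space_SOME:
  assumes "Q \<in> proj_space N UNIV"
  shows "(SOME x. x \<in> Q) \<in> Q" "homog_coords N UNIV (SOME x. x \<in> Q)" "Q = proj_point N (SOME x. x \<in> Q)"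
proof -
  obtain x where x: "homog_coords N UNIV x" "Q = proj_point N x" using assms by (auto simp: proj_space_def)
  show 1: "(SOME x. x \<in> Q) \<in> Q" using proj_point_self[of N x] x(2) someI by metis
  then obtain c where c: "c \<noteq> 0" "(SOME x. x \<in> Q) = (\<lambda>i. if i \<le> N then c * x i else 0)"
    unfolding x(2) by (auto simp: proj_point_def)
  show "homog_coords N UNIV (SOME x. x \<in> Q)" unfolding c(2) using x(1) c(1) by (auto simp: homog_coords_def)
  show "Q = proj_point N (SOME x. x \<in> Q)" unfolding c(2) unfolding x(2) proj_point_def
  proof (intro equalityI subsetI; clarsimp)
    fix b :: complex assume "b \<noteq> 0"
    thus "\<exists>c'. (\<lambda>i. if i \<le> N then b * x i else 0) = (\<lambda>i. if i \<le> N then c' * (if i \<le> N then c * x i else 0) else 0) \<and> c' \<noteq> 0"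
      using c(1) by (intro exI[of _ "b / c"]) auto
  next
    fix b :: complex assume "b \<noteq> 0"
    thus "\<exists>c'. (\<lambda>i. if i \<le> N then b * (if i \<le> N then c * x i else 0) else 0) = (\<lambda>i. if i \<le> N then c' * x i else 0) \<and> c' \<noteq> 0"
      using c(1) by (intro exI[of _ "b * c"]) auto
  qed
qed

lemma proj_point_scale:
  assumes "c \<noteq> 0" "\<And>i. i \<le> N \<Longrightarrow> y i = c * x i"
  shows "proj_point N y = proj_point N x"
  unfolding proj_point_def
proof (intro equalityI subsetI; clarsimp)
  fix b :: complex assume "b \<noteq> 0"
  thus "\<exists>c'. (\<lambda>i. if i \<le> N then b * y i else 0) = (\<lambda>i. if i \<le> N then c' * x i else 0) \<and> c' \<noteq> 0"
    using assms by (intro exI[of _ "b * c"]) auto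
next
  fix b :: complex assume "b \<noteq> 0"
  thus "\<exists>c'. (\<lambda>i. if i \<le> N then b * x i else 0) = (\<lambda>i. if i \<le> N then c' * y i else 0) \<and> c' \<noteq> 0"
    using assms by (intro exI[of _ "b / c"]) auto
qed

lemma proj_pointD: "y \<in> proj_point N x \<Longrightarrow> \<exists>c. c \<noteq> 0 \<and> y = (\<lambda>i. if i \<le> N then c * x i else 0)"
  unfolding proj_point_def by blast

lemma proj_map_point:
  assumes "\<And>i. i \<le> N \<Longrightarrow> form N UNIV f (\<psi> i)" "homog_coords N UNIV x"
  shows "proj_map N \<psi> (proj_point N x) = proj_point N (\<lambda>i. peval (\<psi> i) x)"
proof -
  have "proj_point N x \<in> proj_space N UNIV" using assms(2) by (auto simp: proj_space_def)
  from proj_pointD[OF proj_space_SOME(1)[OF this]] obtain c where c: "c \<noteq> 0"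
    "(SOME y. y \<in> proj_point N x) = (\<lambda>i. if i \<le> N then c * x i else 0)" by blast
  show ?thesis unfolding proj_map_def c(2)
  proof (rule proj_point_scale[of "c ^ f"])
    fix i assume i: "i \<le> N"
    have "peval (\<psi> i) (\<lambda>i. if i \<le> N then c * x i else 0) = peval (\<psi> i) (\<lambda>i. c * x i)"
      by (rule form_cong[OF assms(1)[OF i]]) simp
    thus "peval (\<psi> i) (\<lambda>i. if i \<le> N then c * x i else 0) = c ^ f * peval (\<psi> i) x"
      using form_scale[OF assms(1)[OF i]] by simp
  qed (use c(1) in simp)
qed

lemma thin_image:
  assumes \<psi>: "proj_morphism N UNIV f \<psi>" and f: "f > 0" and A: "thin N A"
  shows "thin N (proj_map N \<psi> ` A)"
proof -
  have form: "form N UNIV f (\<psi> i)" if "i \<le> N" for i using \<psi> that by (simp add: proj_morphism_def)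
  obtain H e where H: "H \<noteq> 0" "form N UNIV e H" "A \<subseteq> zero_locus N {H}" using A unfolding thin_def by blast
  have "\<exists>G e'. G \<noteq> 0 \<and> form N UNIV e' G \<and> (\<forall>x. peval H x = 0 \<longrightarrow> peval G (\<lambda>i. peval (\<psi> i) x) = 0)"
    by (rule image_hypersurface[OF H(2,1) _ f]) (rule form)
  then obtain G e' where G: "G \<noteq> 0" "form N UNIV e' G"
    "\<forall>x. peval H x = 0 \<longrightarrow> peval G (\<lambda>i. peval (\<psi> i) x) = 0" by (elim exE conjE) (rule that)
  have "proj_map N \<psi> Q \<in> zero_locus N {G}" if "Q \<in> A" for Q
  proof -
    have Q: "Q \<in> proj_space N UNIV" "Q \<in> zero_locus N {H}" using that H(3) by (auto simp: zero_locus_def)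
    define x where "x = (SOME x. x \<in> Q)"
    have x: "homog_coords N UNIV x" "Q = proj_point N x" using proj_space_SOME[OF Q(1)] by (simp_all add: x_def)
    have "homog_coords N UNIV (\<lambda>i. peval (\<psi> i) x)" using \<psi> x(1) unfolding proj_morphism_def homog_coords_def[of N UNIV "\<lambda>i. peval (\<psi> i) x"] by blast
    moreover have "peval H x = 0" using Q(2) proj_point_in_zero_locus[OF H(2) x(1)] x(2) by simp
    ultimately show ?thesis
      unfolding proj_map_def x_def[symmetric] using proj_point_in_zero_locus[OF G(2)] G(3) by simp
  qed
  thus ?thesis unfolding thin_def using G(1,2) by blast
qed

section \<open>The Nullstellensatz\<close>

text \<open>The polynomial ring as a module over itself: its submodules are the ideals,
  \<open>pm.span T\<close> is the ideal generated by \<open>T\<close>, and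
  \<open>unit_mod T F\<close> below means that \<open>F\<close> is invertible in the quotient
  ring.\<close>

interpretation pm: Modules.module "(*) :: mpoly \<Rightarrow> mpoly \<Rightarrow> mpoly"
  by standard (simp_all only: distrib_left distrib_right mult.assoc mult_1_left)

abbreviation pconst :: "complex \<Rightarrow> mpoly" where "pconst c \<equiv> Poly_Mapping.single 0 c"

lemma pconst_mult: "pconst (a * b) = pconst a * pconst b"
  by (simp add: mult_single)

definition unit_mod :: "mpoly set \<Rightarrow> mpoly \<Rightarrow> bool" where
  "unit_mod T F \<longleftrightarrow> (\<exists>G. 1 - G * F \<in> pm.span T)"

lemma unit_mod_mult:
  assumes "unit_mod T F" "unit_mod T F'"
  shows "unit_mod T (F * F')"
proof -
  obtain G G' where G: "1 - G * F \<in> pm.span T" "1 - G' * F' \<in> pm.span T" using assms unfolding unit_mod_def by auto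
  have "1 - (G * G') * (F * F') = (1 - G * F) + (G * F) * (1 - G' * F')"
    by (simp only: right_diff_distrib mult_ac mult_1_right mult_1_left diff_add_cancel add_diff_eq)
  also have "\<dots> \<in> pm.span T" by (intro pm.span_add pm.span_scale G)
  finally show ?thesis unfolding unit_mod_def by auto
qed

lemma unit_mod_one: "unit_mod T 1"
  unfolding unit_mod_def by (rule exI[of _ 1]) (simp add: pm.span_zero)

lemma unit_mod_power: "unit_mod T F \<Longrightarrow> unit_mod T (F ^ n)"
  by (induction n) (simp_all add: unit_mod_one unit_mod_mult)

lemma unit_mod_prod: "(\<And>i. i \<in> I \<Longrightarrow> unit_mod T (f i)) \<Longrightarrow> unit_mod T (prod f I)"
  by (induction I rule: infinite_finite_induct) (simp_all add: unit_mod_one unit_mod_mult)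

lemma unit_mod_const:
  assumes "c \<noteq> 0"
  shows "unit_mod T (pconst c)"
  unfolding unit_mod_def
  by (rule exI[of _ "pconst (1 / c)"]) (simp add: assms pm.span_zero flip: pconst_mult)

lemma unit_mod_span:
  assumes "unit_mod T F" "F \<in> pm.span T"
  shows "1 \<in> pm.span T"
proof -
  obtain G where "1 - G * F \<in> pm.span T" using assms unfolding unit_mod_def by auto
  from pm.span_add[OF this pm.span_scale[OF assms(2), of G]] show ?thesis by simp
qed

text \<open>Otherwise every \<open>X\<^sub>i - l\<close> would be a unit modulo the ideal. The inverses of uncountably many of
  them are linearly dependent, since the polynomials have countable dimension; clearing denominators
  puts a nonzero polynomial in \<open>X\<^sub>i\<close> alone, hence a product of units, into the ideal.\<close>

lemma proper_ideal_step:
  assumes T: "1 \<notin> pm.span T"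
  shows "\<exists>l. 1 \<notin> pm.span (insert (pvar i - pconst l) T)"
proof (rule ccontr)
  assume "\<nexists>l. 1 \<notin> pm.span (insert (pvar i - pconst l) T)"
  hence ex: "\<exists>G. 1 - G * (pvar i - pconst l) \<in> pm.span T" for l
    unfolding pm.span_insert by auto
  hence unit: "unit_mod T (pvar i - pconst l)" for l unfolding unit_mod_def by auto
  define g where "g l = (SOME G. 1 - G * (pvar i - pconst l) \<in> pm.span T)" for l
  have g: "1 - g l * (pvar i - pconst l) \<in> pm.span T" for l
    unfolding g_def by (rule someI_ex[OF ex])
  define W where "W k = {m :: nat \<Rightarrow>\<^sub>0 nat. Poly_Mapping.keys m \<subseteq> {..k} \<and> mon_degree m \<le> k}" for k
  have W: "finite (W k)" for k unfolding W_def by (rule card_bounded_monomials)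
  have exW: "\<exists>k. Poly_Mapping.keys F \<subseteq> W k" for F :: mpoly
  proof -
    define S where "S = (\<Union>m\<in>Poly_Mapping.keys F. Poly_Mapping.keys m) \<union> mon_degree ` Poly_Mapping.keys F"
    have "finite S" by (simp add: S_def)
    then obtain k where k: "S \<subseteq> {..k}" using finite_nat_iff_bounded_le by auto
    have "m \<in> W k" if "m \<in> Poly_Mapping.keys F" for m
      unfolding W_def using that k by (auto simp: S_def)
    thus ?thesis by auto
  qed
  \<comment> \<open>Real values of \<open>l\<close> already form an uncountable set. It is the union
    of the countably many \<open>L k\<close>, so some \<open>L k\<close> is infinite, and the
    corresponding inverses all lie in one finite-dimensional space.\<close>
  define L where "L k = {r :: real. Poly_Mapping.keys (g (of_real r)) \<subseteq> W k}" for k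
  have "(\<Union>k. L k) = UNIV" using exW by (auto simp: L_def)
  hence "\<not> (\<forall>k. countable (L k))"
    using uncountable_UNIV_real countable_UN[of UNIV L] by auto
  hence "\<exists>k. infinite (L k)" using countable_finite by blast
  then obtain k where k: "infinite (L k)" ..
  obtain A where A: "A \<subseteq> L k" "finite A" "card A = Suc (card (W k))"
    using infinite_arbitrarily_large[OF k] by auto
  have "card (W k) < card A" using A by simp
  from lin_dep[OF W A(2) this, of "\<lambda>r. Poly_Mapping.lookup (g (of_real r))"]
  obtain c where c: "\<exists>r\<in>A. c r \<noteq> 0" "\<forall>m\<in>W k. (\<Sum>r\<in>A. c r * Poly_Mapping.lookup (g (of_real r)) m) = 0"
    by (elim exE conjE) (rule that)
  have zero: "(\<Sum>r\<in>A. pconst (c r) * g (of_real r)) = 0"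
  proof (rule poly_mapping_eqI)
    fix m
    have "(\<Sum>r\<in>A. c r * Poly_Mapping.lookup (g (of_real r)) m) = 0"
    proof (cases "m \<in> W k")
      case False
      have "Poly_Mapping.lookup (g (of_real r)) m = 0" if "r \<in> A" for r
      proof -
        have "Poly_Mapping.keys (g (of_real r)) \<subseteq> W k" using A(1) that by (auto simp: L_def)
        thus ?thesis using False by (auto simp only: in_keys_iff)
      qed
      thus ?thesis by simp
    qed (use c in auto)
    thus "Poly_Mapping.lookup (\<Sum>r\<in>A. pconst (c r) * g (of_real r)) m = Poly_Mapping.lookup 0 m"
      by (simp only: lookup_sum lookup_const_mult lookup_zero)
  qed
  define lin where "lin r = pvar i - pconst (of_real r)" for r
  \<comment> \<open>The numerator of the sum of the fractions \<open>c r / (X_i - r)\<close>. Modulo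
    the ideal, \<open>g r\<close> is the inverse of \<open>lin r\<close>, so \<open>q\<close> is
    congruent to the relation \<open>zero\<close> times \<open>prod lin A\<close>.\<close>
  define q where "q = (\<Sum>r\<in>A. pconst (c r) * prod lin (A - {r}))"
  have "(\<Sum>r\<in>A. pconst (c r) * prod lin (A - {r}) * (1 - g (of_real r) * lin r)) =
        q - (\<Sum>r\<in>A. pconst (c r) * g (of_real r) * (lin r * prod lin (A - {r})))"
    by (simp only: q_def right_diff_distrib sum_subtractf mult_ac mult_1_right mult_1_left)
  also have "(\<Sum>r\<in>A. pconst (c r) * g (of_real r) * (lin r * prod lin (A - {r}))) =
             (\<Sum>r\<in>A. pconst (c r) * g (of_real r) * prod lin A)"
    using prod.remove[OF A(2), of _ lin] by (intro sum.cong) simp_all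
  also have "\<dots> = 0" by (simp only: sum_distrib_right[symmetric] zero mult_zero_left)
  finally have "q = (\<Sum>r\<in>A. pconst (c r) * prod lin (A - {r}) * (1 - g (of_real r) * lin r))" by simp
  also have "\<dots> \<in> pm.span T"
    by (intro pm.span_sum pm.span_scale) (simp add: lin_def g)
  finally have q: "q \<in> pm.span T" .
  \<comment> \<open>\<open>q\<close> as a polynomial in the single variable \<open>X_i\<close>. At
    \<open>r0\<close> only the summand of \<open>r0\<close> survives, so \<open>p\<close> is
    nonzero; its factorisation over the complex numbers writes \<open>q\<close> as a product of
    units modulo the ideal.\<close>
  define p where "p = (\<Sum>r\<in>A. Polynomial.smult (c r) (\<Prod>s\<in>A - {r}. [:- of_real s, 1:]))"
  obtain r0 where r0: "r0 \<in> A" "c r0 \<noteq> 0" using c(1) by auto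
  have "poly p (of_real r0) = (\<Sum>r\<in>A. c r * (\<Prod>s\<in>A - {r}. of_real r0 - of_real s))"
    by (simp add: p_def poly_sum poly_prod)
  also have "\<dots> = (\<Sum>r\<in>A. if r = r0 then c r0 * (\<Prod>s\<in>A - {r0}. of_real r0 - of_real s) else 0)"
  proof (rule sum.cong[OF refl])
    fix r assume "r \<in> A"
    show "c r * (\<Prod>s\<in>A - {r}. of_real r0 - of_real s) =
          (if r = r0 then c r0 * (\<Prod>s\<in>A - {r0}. of_real r0 - of_real s) else 0)"
      using r0(1) A(2) by (auto intro!: prod_zero)
  qed
  also have "\<dots> = c r0 * (\<Prod>s\<in>A - {r0}. of_real r0 - of_real s)" using A(2) r0(1) by simp
  also have "\<dots> \<noteq> 0" using A(2) r0(2) by auto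
  finally have "p \<noteq> 0" by auto
  have "q = pconst (Polynomial.lead_coeff p) * (\<Prod>z | poly p z = 0. (pvar i - pconst z) ^ Polynomial.order z p)"
  proof (rule peval_ext)
    fix x :: "nat \<Rightarrow> complex"
    have "peval q x = poly p (x i)"
      by (simp add: q_def p_def lin_def peval_sum peval_mult peval_prod peval_diff poly_sum poly_prod)
    also have "\<dots> = poly (Polynomial.smult (Polynomial.lead_coeff p) (\<Prod>z | poly p z = 0. [:- z, 1:] ^ Polynomial.order z p)) (x i)"
      by (simp only: complex_poly_decompose)
    also have "\<dots> = peval (pconst (Polynomial.lead_coeff p) * (\<Prod>z | poly p z = 0. (pvar i - pconst z) ^ Polynomial.order z p)) x"
      by (simp add: poly_prod peval_mult peval_prod peval_power peval_diff)
    finally show "peval q x = \<dots>" .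
  qed
  moreover have "unit_mod T (pconst (Polynomial.lead_coeff p) * (\<Prod>z | poly p z = 0. (pvar i - pconst z) ^ Polynomial.order z p))"
    by (intro unit_mod_mult unit_mod_prod unit_mod_power unit unit_mod_const) (simp add: \<open>p \<noteq> 0\<close>)
  ultimately have "unit_mod T q" by simp
  from unit_mod_span[OF this q] T show False by simp
qed

lemma proper_ideal_point:
  assumes "1 \<notin> pm.span T"
  shows "\<exists>l. 1 \<notin> pm.span (T \<union> (\<lambda>i. pvar i - pconst (l i)) ` {..<n})"
proof (induction n)
  case 0
  thus ?case using assms by simp
next
  case (Suc n)
  then obtain l where l: "1 \<notin> pm.span (T \<union> (\<lambda>i. pvar i - pconst (l i)) ` {..<n})" ..
  from proper_ideal_step[OF this, of n] obtain c where
    c: "1 \<notin> pm.span (insert (pvar n - pconst c) (T \<union> (\<lambda>i. pvar i - pconst (l i)) ` {..<n}))" ..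
  have "T \<union> (\<lambda>i. pvar i - pconst ((l(n := c)) i)) ` {..<Suc n} =
        insert (pvar n - pconst c) (T \<union> (\<lambda>i. pvar i - pconst (l i)) ` {..<n})"
    by (auto simp: lessThan_Suc)
  thus ?case using c by (intro exI[of _ "l(n := c)"]) simp
qed

lemma psubst_pvar_id: "psubst F pvar = F"
  by (rule peval_ext) (simp add: peval_psubst)

text \<open>The polynomials congruent to their value at \<open>l\<close> contain the constants and
  the first \<open>n\<close> variables and are closed under sums and products. Writing
  \<open>F\<close> as \<open>psubst F pvar\<close> shows that it is built from these.\<close>

lemma residue_mod_point:
  assumes S: "\<And>i. i < n \<Longrightarrow> pvar i - pconst (l i) \<in> pm.span S"
    and F: "\<And>m. m \<in> Poly_Mapping.keys F \<Longrightarrow> Poly_Mapping.keys m \<subseteq> {..<n}"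
  shows "F - pconst (peval F l) \<in> pm.span S"
proof -
  define C where "C G \<longleftrightarrow> G - pconst (peval G l) \<in> pm.span S" for G
  have add: "C (G + H)" if "C G" "C H" for G H
  proof -
    have "G + H - pconst (peval (G + H) l) = (G - pconst (peval G l)) + (H - pconst (peval H l))"
      by (simp add: peval_add single_add)
    also have "\<dots> \<in> pm.span S" using that unfolding C_def by (intro pm.span_add)
    finally show ?thesis unfolding C_def .
  qed
  have mult: "C (G * H)" if "C G" "C H" for G H
  proof -
    have "G * H - pconst (peval (G * H) l) = H * (G - pconst (peval G l)) + pconst (peval G l) * (H - pconst (peval H l))"
      by (simp only: peval_mult pconst_mult right_diff_distrib mult_ac diff_add_cancel add_diff_eq)
    also have "\<dots> \<in> pm.span S" using that unfolding C_def by (intro pm.span_add pm.span_scale)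
    finally show ?thesis unfolding C_def .
  qed
  have const: "C (pconst c)" for c by (simp add: C_def pm.span_zero)
  have var: "C (pvar i)" if "i < n" for i using S[OF that] by (simp add: C_def)
  have pow: "C (G ^ k)" if "C G" for G k
  proof (induction k)
    case 0
    show ?case using const[of 1] by simp
  next
    case (Suc k)
    show ?case unfolding power_Suc by (rule mult[OF that Suc.IH])
  qed
  have prod: "C (prod f I)" if "\<And>i. i \<in> I \<Longrightarrow> C (f i)" for f and I :: "nat set"
    using that
  proof (induction I rule: infinite_finite_induct)
    case (insert i I)
    have "C (f i * prod f I)" by (rule mult) (use insert in auto)
    thus ?case using insert.hyps by simp
  qed (use const[of 1] in simp_all)
  have sum: "C (sum f I)" if "\<And>i. i \<in> I \<Longrightarrow> C (f i)" for f and I :: "(nat \<Rightarrow>\<^sub>0 nat) set"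
    using that
  proof (induction I rule: infinite_finite_induct)
    case (insert i I)
    have "C (f i + sum f I)" by (rule add) (use insert in auto)
    thus ?case using insert.hyps by simp
  qed (use const[of 0] in simp_all)
  have "C (psubst F pvar)" unfolding psubst_def
  proof (intro sum mult const prod pow var)
    fix m i assume "m \<in> Poly_Mapping.keys F" "i \<in> Poly_Mapping.keys m"
    thus "i < n" using F[of m] by auto
  qed
  thus ?thesis unfolding psubst_pvar_id C_def .
qed

text \<open>If the ideal were proper, \<open>proper_ideal_point\<close> would enlarge it to a proper
  ideal modulo which all variables are constants \<open>l i\<close>. A generator not vanishing at
  \<open>l\<close> is there congruent to a nonzero constant, so the enlarged ideal would contain a
  unit.\<close>

lemma nullstellensatz_unit:
  assumes "\<And>F m. F \<in> T \<Longrightarrow> m \<in> Poly_Mapping.keys F \<Longrightarrow> Poly_Mapping.keys m \<subseteq> {..<n}"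
    and "\<And>x. \<exists>F\<in>T. peval F x \<noteq> 0"
  shows "1 \<in> pm.span T"
proof (rule ccontr)
  assume "1 \<notin> pm.span T"
  from proper_ideal_point[OF this, of n] obtain l where
    l: "1 \<notin> pm.span (T \<union> (\<lambda>i. pvar i - pconst (l i)) ` {..<n})" (is "_ \<notin> pm.span ?S") ..
  obtain F where F: "F \<in> T" "peval F l \<noteq> 0" using assms(2) by auto
  have "F - pconst (peval F l) \<in> pm.span ?S"
    by (rule residue_mod_point[of n]) (use assms(1)[OF F(1)] in \<open>auto intro: pm.span_base\<close>)
  moreover have "F \<in> pm.span ?S" using F(1) by (auto intro: pm.span_base)
  ultimately have "F - (F - pconst (peval F l)) \<in> pm.span ?S" by (rule pm.span_diff[rotated])
  hence "pconst (peval F l) \<in> pm.span ?S" by simp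
  from unit_mod_span[OF unit_mod_const[OF F(2)] this] l show False by simp
qed

text \<open>The forms may all vanish at the origin, so \<open>X_i - 1\<close> joins the generators:
  a common zero would then be a point of projective space. On \<open>x i = 1\<close> the added
  generator disappears from the identity.\<close>

lemma nullstellensatz_forms:
  assumes \<psi>: "proj_morphism N UNIV f \<psi>" and i: "i \<le> N"
  shows "\<exists>A. \<forall>x. x i = 1 \<longrightarrow> (\<Sum>j\<le>N. peval (A j) x * peval (\<psi> j) x) = 1"
proof -
  let ?h = "pvar i - pconst 1"
  define T where "T = insert ?h (\<psi> ` {..N})"
  have "1 \<in> pm.span T"
  proof (rule nullstellensatz_unit[of _ "Suc N"])
    fix F m assume F: "F \<in> T" "m \<in> Poly_Mapping.keys F"
    show "Poly_Mapping.keys m \<subseteq> {..<Suc N}"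
    proof (cases "F = ?h")
      case True
      hence "m \<in> Poly_Mapping.keys (pvar i) \<union> Poly_Mapping.keys (pconst 1)"
        using F(2) keys_diff[of "pvar i" "pconst 1"] by blast
      thus ?thesis using i by (auto simp: pvar_def split: if_splits)
    next
      case False
      hence "form N UNIV f F" using F(1) \<psi> by (auto simp: T_def proj_morphism_def)
      thus ?thesis using F(2) by (auto simp: form_def lessThan_Suc_atMost)
    qed
  next
    fix x
    show "\<exists>F\<in>T. peval F x \<noteq> 0"
    proof (cases "x i = 1")
      case True
      hence "homog_coords N UNIV x" using i by (auto simp: homog_coords_def intro!: exI[of _ i])
      thus ?thesis using \<psi> by (auto simp: T_def proj_morphism_def)
    qed (simp add: T_def peval_diff)
  qed
  moreover define V where "V = {F. \<exists>A B. F = (\<Sum>j\<le>N. A j * \<psi> j) + B * ?h}"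
  have "pm.span T \<subseteq> V"
  proof (rule pm.span_minimal)
    show "T \<subseteq> V"
    proof
      fix F assume "F \<in> T"
      then consider "F = ?h" | j where "j \<le> N" "F = \<psi> j" by (auto simp: T_def)
      thus "F \<in> V"
      proof cases
        case 1
        hence "F = (\<Sum>j\<le>N. 0 * \<psi> j) + 1 * ?h" by simp
        thus ?thesis unfolding V_def by (intro CollectI exI)
      next
        case 2
        have "(\<Sum>k\<le>N. (if k = j then 1 else 0) * \<psi> k) = (\<Sum>k\<le>N. if k = j then \<psi> j else 0)"
          by (rule sum.cong) auto
        hence "F = (\<Sum>k\<le>N. (if k = j then 1 else 0) * \<psi> k) + 0 * ?h" using 2 by simp
        thus ?thesis unfolding V_def by (intro CollectI exI)
      qed
    qed
    show "pm.subspace V"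
    proof (rule pm.subspaceI)
      have "0 = (\<Sum>j\<le>N. 0 * \<psi> j) + 0 * ?h" by simp
      thus "0 \<in> V" unfolding V_def by (intro CollectI exI)
    next
      fix F G assume "F \<in> V" "G \<in> V"
      then obtain A B A' B' where "F = (\<Sum>j\<le>N. A j * \<psi> j) + B * ?h" "G = (\<Sum>j\<le>N. A' j * \<psi> j) + B' * ?h"
        unfolding V_def mem_Collect_eq by (elim exE) (rule that)
      hence "F + G = (\<Sum>j\<le>N. (A j + A' j) * \<psi> j) + (B + B') * ?h"
        by (simp only: distrib_right sum.distrib add_ac)
      thus "F + G \<in> V" unfolding V_def by (intro CollectI exI)
    next
      fix F G assume "G \<in> V"
      then obtain A B where "G = (\<Sum>j\<le>N. A j * \<psi> j) + B * ?h" unfolding V_def mem_Collect_eq by (elim exE) (rule that)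
      hence "F * G = (\<Sum>j\<le>N. (F * A j) * \<psi> j) + (F * B) * ?h"
        by (simp only: distrib_left sum_distrib_left mult.assoc)
      thus "F * G \<in> V" unfolding V_def by (intro CollectI exI)
    qed
  qed
  ultimately have "1 \<in> V" by (rule subsetD[rotated])
  then obtain A B where 1: "1 = (\<Sum>j\<le>N. A j * \<psi> j) + B * ?h"
    unfolding V_def mem_Collect_eq by (elim exE) (rule that)
  have "(\<Sum>j\<le>N. peval (A j) x * peval (\<psi> j) x) = 1" if "x i = 1" for x
    using arg_cong[OF 1, of "\<lambda>F. peval F x"] that by (simp add: peval_add peval_sum peval_mult peval_diff)
  thus ?thesis by auto
qed

section \<open>Heights under a morphism\<close>

text \<open>A projection of the rational vector space of complex numbers onto the rationals: it turns the
  complex identity of \<open>nullstellensatz_forms\<close> into a rational one.\<close>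

lemma rational_projection:
  "\<exists>\<pi> :: complex \<Rightarrow> rat. (\<forall>x y. \<pi> (x + y) = \<pi> x + \<pi> y) \<and> (\<forall>q z. \<pi> (of_rat q * z) = q * \<pi> z) \<and> \<pi> 1 = 1"
proof -
  interpret vp: Vector_Spaces.vector_space_pair "\<lambda>(q::rat) (z::complex). of_rat q * z" "\<lambda>(q::rat) (z::rat). q * z"
    by unfold_locales (simp_all add: of_rat_add of_rat_mult distrib_left distrib_right)
  have "vp.vs1.independent {1}" by simp
  from vp.linear_independent_extend[OF this, of "\<lambda>_. 1"] obtain \<pi> where
    \<pi>: "Vector_Spaces.linear (\<lambda>(q::rat) (z::complex). of_rat q * z) (\<lambda>(q::rat) (z::rat). q * z) \<pi>" "\<pi> 1 = 1" by auto
  interpret \<pi>: Vector_Spaces.linear "\<lambda>(q::rat) (z::complex). of_rat q * z" "\<lambda>(q::rat) (z::rat). q * z" \<pi> by (rule \<pi>(1))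
  show ?thesis using \<pi>.add \<pi>.scale \<pi>(2) by auto
qed

section \<open>Common denominators and sizes of integer vectors\<close>

lemma common_denominator:
  assumes "finite S"
  shows "\<exists>D>0::int. \<forall>q\<in>S. \<exists>z. of_int D * q = (of_int z :: rat)"
  using assms
proof (induction S rule: finite_induct)
  case empty
  show ?case by (intro exI[of _ 1]) simp
next
  case (insert q S)
  then obtain D where D: "D > 0" "\<forall>q\<in>S. \<exists>z. of_int D * q = (of_int z :: rat)" by auto
  obtain a b where ab: "quotient_of q = (a, b)" by (cases "quotient_of q")
  have b: "b > 0" "q = of_int a / of_int b" using quotient_of_denom_pos[OF ab] quotient_of_div[OF ab] by auto
  show ?case
  proof (rule exI[of _ "D * b"], intro conjI ballI)
    fix r assume "r \<in> insert q S"
    then consider "r = q" | "r \<in> S" by blast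
    thus "\<exists>z. of_int (D * b) * r = (of_int z :: rat)"
    proof cases
      case 1
      thus ?thesis using b by (intro exI[of _ "D * a"]) simp
    next
      case 2
      then obtain z where "of_int D * r = (of_int z :: rat)" using D(2) by auto
      thus ?thesis by (intro exI[of _ "b * z"]) (simp add: mult_ac)
    qed
  qed (use D(1) b(1) in simp)
qed

abbreviation height_max :: "nat \<Rightarrow> (nat \<Rightarrow> int) \<Rightarrow> int" where
  "height_max N a \<equiv> Max ((\<lambda>i. \<bar>a i\<bar>) ` {..N})"

lemma height_max_ge: "i \<le> N \<Longrightarrow> \<bar>a i\<bar> \<le> height_max N a"
  by (intro Max_ge) auto

lemma height_max_nonneg: "0 \<le> height_max N a"
  using height_max_ge[of 0 N a] abs_ge_zero[of "a 0"] by linarith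

lemma height_max_attained: "\<exists>i\<le>N. \<bar>a i\<bar> = height_max N a"
proof -
  have "height_max N a \<in> (\<lambda>i. \<bar>a i\<bar>) ` {..N}" by (intro Max_in) auto
  then obtain i where "height_max N a = \<bar>a i\<bar>" "i \<in> {..N}" by (rule imageE)
  thus ?thesis by (intro exI[of _ i]) simp
qed

lemma mono_val_of_int: "mono_val (\<lambda>i. of_int (y i)) m = (of_int (mono_val y m) :: 'a::comm_ring_1)"
  by (simp add: mono_val_def)

lemma mono_val_of_rat: "mono_val (\<lambda>i. of_rat (y i)) m = (of_rat (mono_val y m) :: complex)"
  by (simp add: mono_val_def of_rat_prod of_rat_power)

lemma abs_mono_val_le:
  fixes y :: "nat \<Rightarrow> int"
  assumes "\<And>i. \<bar>y i\<bar> \<le> H"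
  shows "\<bar>mono_val y m\<bar> \<le> H ^ mon_degree m"
proof -
  have "\<bar>mono_val y m\<bar> = (\<Prod>i\<in>Poly_Mapping.keys m. \<bar>y i\<bar> ^ Poly_Mapping.lookup m i)"
    by (simp add: mono_val_def abs_prod power_abs)
  also have "\<dots> \<le> (\<Prod>i\<in>Poly_Mapping.keys m. H ^ Poly_Mapping.lookup m i)"
    by (intro prod_mono conjI power_mono assms) simp_all
  also have "\<dots> = H ^ mon_degree m" by (simp add: mon_degree_def power_sum)
  finally show ?thesis .
qed

text \<open>The identity of \<open>nullstellensatz_forms\<close> is evaluated at \<open>a\<close>
  divided by \<open>a i\<close>, made rational by the projection \<pi>, and multiplied by
  \<open>D * a i ^ (k + f)\<close> to clear all denominators. The power \<open>k\<close> of the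
  height bounding \<open>I j\<close> is what the comparison of heights cancels later.\<close>

lemma integral_nullstellensatz:
  assumes \<psi>: "proj_morphism N \<rat> f \<psi>" and i: "i \<le> N"
  shows "\<exists>D k C. D > 0 \<and> (\<forall>a :: nat \<Rightarrow> int. a i \<noteq> 0 \<longrightarrow> (\<exists>I :: nat \<Rightarrow> int.
    (\<forall>j\<le>N. \<bar>I j\<bar> \<le> C * height_max N a ^ k) \<and>
    of_int (D * a i ^ (k + f)) = (\<Sum>j\<le>N. of_int (I j) * peval (\<psi> j) (\<lambda>i. of_int (a i)))))"
proof -
  have \<psi>': "proj_morphism N UNIV f \<psi>" using \<psi> unfolding proj_morphism_def by (auto intro: form_mono)
  have form: "form N \<rat> f (\<psi> j)" if "j \<le> N" for j using \<psi> that by (simp add: proj_morphism_def)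
  from nullstellensatz_forms[OF \<psi>' i] obtain A where
    A: "\<And>x. x i = 1 \<Longrightarrow> (\<Sum>j\<le>N. peval (A j) x * peval (\<psi> j) x) = 1" by auto
  obtain \<pi> :: "complex \<Rightarrow> rat" where \<pi>_add: "\<And>x y. \<pi> (x + y) = \<pi> x + \<pi> y"
    and \<pi>_scale: "\<And>q z. \<pi> (of_rat q * z) = q * \<pi> z" and \<pi>1: "\<pi> 1 = 1"
    using rational_projection by auto
  have \<pi>0: "\<pi> 0 = 0" using \<pi>_add[of 0 0] by simp
  have \<pi>_sum: "\<pi> (sum h S) = (\<Sum>s\<in>S. \<pi> (h s))" for h and S :: "'s set"
    by (induction S rule: infinite_finite_induct) (simp_all add: \<pi>_add \<pi>0)
  have \<pi>_rat: "\<pi> (of_rat q) = q" for q using \<pi>_scale[of q 1] \<pi>1 by simp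
  define S where "S = (\<Union>j\<le>N. (\<lambda>m. \<pi> (Poly_Mapping.lookup (A j) m)) ` Poly_Mapping.keys (A j))"
  have "finite S" by (simp add: S_def)
  from common_denominator[OF this] obtain D where D: "D > 0" "\<forall>q\<in>S. \<exists>z. of_int D * q = (of_int z :: rat)" by auto
  define z where "z j m = (SOME z. of_int D * \<pi> (Poly_Mapping.lookup (A j) m) = of_int z)" for j m
  have z: "of_int D * \<pi> (Poly_Mapping.lookup (A j) m) = of_int (z j m)" if "j \<le> N" "m \<in> Poly_Mapping.keys (A j)" for j m
  proof -
    have "\<pi> (Poly_Mapping.lookup (A j) m) \<in> S" using that by (auto simp: S_def)
    hence "\<exists>z. of_int D * \<pi> (Poly_Mapping.lookup (A j) m) = of_int z" using D(2) by simp
    thus ?thesis unfolding z_def by (rule someI_ex)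
  qed
  \<comment> \<open>Any common bound for the degrees of the monomials in the \<open>A j\<close>
    would do; the sum of all degrees is one.\<close>
  define k where "k = (\<Sum>j\<le>N. \<Sum>m\<in>Poly_Mapping.keys (A j). mon_degree m)"
  have k: "mon_degree m \<le> k" if "j \<le> N" "m \<in> Poly_Mapping.keys (A j)" for j m
  proof -
    have "mon_degree m \<le> (\<Sum>m\<in>Poly_Mapping.keys (A j). mon_degree m)" by (rule member_le_sum) (use that in auto)
    also have "\<dots> \<le> k" unfolding k_def
      by (rule member_le_sum[of j _ "\<lambda>j. \<Sum>m\<in>Poly_Mapping.keys (A j). mon_degree m"]) (use that in auto)
    finally show ?thesis .
  qed
  define C where "C = (\<Sum>j\<le>N. \<Sum>m\<in>Poly_Mapping.keys (A j). \<bar>z j m\<bar>)"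
  have main: "\<exists>I :: nat \<Rightarrow> int. (\<forall>j\<le>N. \<bar>I j\<bar> \<le> C * height_max N a ^ k) \<and>
    of_int (D * a i ^ (k + f)) = (\<Sum>j\<le>N. of_int (I j) * peval (\<psi> j) (\<lambda>i. of_int (a i)))"
    if ai: "a i \<noteq> 0" for a :: "nat \<Rightarrow> int"
  proof -
    \<comment> \<open>The \<open>A j\<close> may involve variables beyond index \<open>N\<close>.
      These are set to \<open>0\<close>, so that \<open>H\<close> bounds every coordinate that
      enters.\<close>
    define y where "y v = (if v \<le> N then a v else 0)" for v
    define H where "H = height_max N a"
    have H0: "H \<ge> 0" using height_max_nonneg by (simp add: H_def)
    have H: "\<bar>y v\<bar> \<le> H" for v
      using height_max_ge[of v N a] H0 by (simp add: y_def H_def)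
    define I where "I j = (\<Sum>m\<in>Poly_Mapping.keys (A j). z j m * mono_val y m * a i ^ (k - mon_degree m))" for j
    have "\<bar>I j\<bar> \<le> C * H ^ k" if j: "j \<le> N" for j
    proof -
      have "\<bar>I j\<bar> \<le> (\<Sum>m\<in>Poly_Mapping.keys (A j). \<bar>z j m * mono_val y m * a i ^ (k - mon_degree m)\<bar>)"
        unfolding I_def by (rule sum_abs)
      also have "\<dots> \<le> (\<Sum>m\<in>Poly_Mapping.keys (A j). \<bar>z j m\<bar> * H ^ k)"
      proof (rule sum_mono)
        fix m assume m: "m \<in> Poly_Mapping.keys (A j)"
        have "\<bar>a i\<bar> ^ (k - mon_degree m) \<le> H ^ (k - mon_degree m)"
          using H[of i] i by (intro power_mono) (auto simp: y_def)
        hence "\<bar>mono_val y m\<bar> * \<bar>a i\<bar> ^ (k - mon_degree m) \<le> H ^ mon_degree m * H ^ (k - mon_degree m)"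
          using abs_mono_val_le[of y H m, OF H] by (intro mult_mono) (use H0 in auto)
        also have "\<dots> = H ^ k" using k[OF j m] by (simp flip: power_add)
        finally have "\<bar>z j m\<bar> * (\<bar>mono_val y m\<bar> * \<bar>a i\<bar> ^ (k - mon_degree m)) \<le> \<bar>z j m\<bar> * H ^ k"
          by (rule mult_left_mono) simp
        thus "\<bar>z j m * mono_val y m * a i ^ (k - mon_degree m)\<bar> \<le> \<bar>z j m\<bar> * H ^ k"
          by (simp add: abs_mult power_abs mult.assoc)
      qed
      also have "\<dots> = (\<Sum>m\<in>Poly_Mapping.keys (A j). \<bar>z j m\<bar>) * H ^ k" by (simp add: sum_distrib_right)
      also have "\<dots> \<le> C * H ^ k" unfolding C_def
        by (intro mult_right_mono member_le_sum[of j _ "\<lambda>j. \<Sum>m\<in>Poly_Mapping.keys (A j). \<bar>z j m\<bar>"])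
           (use j H0 in \<open>auto intro: sum_nonneg\<close>)
      finally show ?thesis .
    qed
    moreover have "of_int (D * a i ^ (k + f)) = (\<Sum>j\<le>N. of_int (I j) * peval (\<psi> j) (\<lambda>i. of_int (a i)))"
    proof -
      define t where "t = 1 / (of_int (a i) :: rat)"
      define x where "x v = t * of_int (y v)" for v
      have xi: "of_rat (x i) = (1 :: complex)" using ai i by (simp add: x_def t_def y_def)
      have "\<exists>r. peval (\<psi> j) (\<lambda>v. of_int (a v)) = of_rat r" if "j \<le> N" for j
      proof -
        have "peval (\<psi> j) (\<lambda>v. of_int (a v)) \<in> \<rat>"
          unfolding peval_mono_val mono_val_of_int using form[OF that]
          by (intro Rats_sum Rats_mult) (auto simp: form_def)
        thus ?thesis by (auto simp: Rats_def)
      qed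
      then obtain r where r: "\<And>j. j \<le> N \<Longrightarrow> peval (\<psi> j) (\<lambda>v. of_int (a v)) = of_rat (r j)" by metis
      have \<psi>x: "peval (\<psi> j) (\<lambda>v. of_rat (x v)) = of_rat (t ^ f * r j)" if "j \<le> N" for j
      proof -
        have "peval (\<psi> j) (\<lambda>v. of_rat (x v)) = peval (\<psi> j) (\<lambda>v. of_rat t * of_int (a v))"
          by (rule form_cong[OF form[OF that]]) (simp add: x_def y_def of_rat_mult)
        also have "\<dots> = of_rat t ^ f * of_rat (r j)" using form_scale[OF form[OF that]] r[OF that] by simp
        finally show ?thesis by (simp add: of_rat_mult of_rat_power)
      qed
      \<comment> \<open>At the rational point \<open>x\<close> the monomials and the values of
        \<open>\<psi> j\<close> are rational, so \<pi> passes through to the coefficients of the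
        \<open>A j\<close>.\<close>
      have "1 = \<pi> (\<Sum>j\<le>N. peval (A j) (\<lambda>v. of_rat (x v)) * peval (\<psi> j) (\<lambda>v. of_rat (x v)))"
        using A[of "\<lambda>v. of_rat (x v)"] xi \<pi>1 by simp
      also have "\<dots> = (\<Sum>j\<le>N. \<pi> (of_rat (t ^ f * r j) * peval (A j) (\<lambda>v. of_rat (x v))))"
        unfolding \<pi>_sum by (rule sum.cong) (simp_all only: atMost_iff \<psi>x mult.commute)
      also have "\<dots> = (\<Sum>j\<le>N. t ^ f * r j * (\<Sum>m\<in>Poly_Mapping.keys (A j). mono_val x m * \<pi> (Poly_Mapping.lookup (A j) m)))"
        unfolding \<pi>_scale peval_mono_val \<pi>_sum mono_val_of_rat
        by (simp only: mult.commute[of "Poly_Mapping.lookup _ _"] \<pi>_scale)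
      finally have 1: "1 = (\<Sum>j\<le>N. t ^ f * r j * (\<Sum>m\<in>Poly_Mapping.keys (A j). mono_val x m * \<pi> (Poly_Mapping.lookup (A j) m)))" .
      have summand: "of_int (D * a i ^ (k + f)) * (t ^ f * r j * (\<Sum>m\<in>Poly_Mapping.keys (A j). mono_val x m * \<pi> (Poly_Mapping.lookup (A j) m))) = of_int (I j) * r j"
        if j: "j \<le> N" for j
      proof -
        have "of_int (D * a i ^ k) * (mono_val x m * \<pi> (Poly_Mapping.lookup (A j) m)) = (of_int (z j m * mono_val y m * a i ^ (k - mon_degree m)) :: rat)"
          if m: "m \<in> Poly_Mapping.keys (A j)" for m
        proof -
          have "of_int (a i) ^ k * t ^ mon_degree m = (of_int (a i) ^ (k - mon_degree m) :: rat)"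
            using ai k[OF j m] by (simp add: t_def power_diff power_divide)
          moreover have "mono_val x m = t ^ mon_degree m * of_int (mono_val y m)"
            unfolding x_def mono_val_scale mono_val_of_int ..
          ultimately show ?thesis using z[OF j m, symmetric] by (simp add: mult_ac)
        qed
        hence 2: "of_int (D * a i ^ k) * (\<Sum>m\<in>Poly_Mapping.keys (A j). mono_val x m * \<pi> (Poly_Mapping.lookup (A j) m)) = (of_int (I j) :: rat)"
          unfolding sum_distrib_left I_def of_int_sum by (rule sum.cong[OF refl])
        have 3: "of_int (a i) ^ f * t ^ f = 1" using ai by (simp add: t_def power_divide)
        have 4: "of_int (D * a i ^ (k + f)) * (t ^ f * r j * s) = (of_int (a i) ^ f * t ^ f) * (r j * (of_int (D * a i ^ k) * s))" for s
          by (simp add: power_add mult_ac)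
        show ?thesis unfolding 4 3 2 by simp
      qed
      have "of_int (D * a i ^ (k + f)) = (\<Sum>j\<le>N. of_int (D * a i ^ (k + f)) * (t ^ f * r j * (\<Sum>m\<in>Poly_Mapping.keys (A j). mono_val x m * \<pi> (Poly_Mapping.lookup (A j) m))))"
        unfolding sum_distrib_left[symmetric] 1[symmetric] by simp
      also have "\<dots> = (\<Sum>j\<le>N. of_int (I j) * r j)" by (rule sum.cong) (simp_all only: atMost_iff summand)
      finally have "of_int (D * a i ^ (k + f)) = (\<Sum>j\<le>N. of_int (I j) * r j)" .
      from arg_cong[OF this, of "of_rat :: rat \<Rightarrow> complex"] show ?thesis
        unfolding of_rat_sum of_rat_mult of_rat_of_int_eq by (simp add: r)
    qed
    ultimately show ?thesis unfolding H_def by (intro exI[of _ I] conjI) simp_all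
  qed
  show ?thesis by (rule exI[of _ D], rule exI[of _ k], rule exI[of _ C]) (use D(1) main in simp)
qed

section \<open>Coprime integer vectors and divisibility\<close>

lemma Gcd_power_eq_1:
  fixes a :: "nat \<Rightarrow> int"
  assumes "Gcd (a ` I) = 1"
  shows "Gcd ((\<lambda>i. a i ^ K) ` I) = 1"
proof (rule ccontr)
  let ?G = "Gcd ((\<lambda>i. a i ^ K) ` I)"
  assume "?G \<noteq> 1"
  hence nu: "\<not> is_unit ?G" by (metis Gcd_1 normalize_Gcd is_unit_normalize)
  have "?G \<noteq> 0"
  proof
    assume 0: "?G = 0"
    have "a i = 0" if "i \<in> I" for i using 0 that by (auto simp: Gcd_0_iff)
    hence "a ` I \<subseteq> {0}" by auto
    hence "Gcd (a ` I) = 0" by (simp add: Gcd_0_iff)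
    thus False using assms by simp
  qed
  from prime_divisor_exists[OF this nu] obtain p where p: "p dvd ?G" "Factorial_Ring.prime p" by auto
  have "p dvd a i" if "i \<in> I" for i
  proof -
    have "p dvd a i ^ K" using p(1) that by (meson Gcd_dvd dvd_trans imageI)
    thus ?thesis by (rule prime_dvd_power[OF p(2)])
  qed
  hence "p dvd Gcd (a ` I)" by (auto intro: Gcd_greatest)
  hence "is_unit p" using assms by simp
  thus False using p(2) by (simp add: not_prime_unit)
qed

lemma dvd_of_dvd_coprime_powers:
  fixes a :: "nat \<Rightarrow> int"
  assumes "Gcd (a ` I) = 1" "\<And>i. i \<in> I \<Longrightarrow> G dvd M * a i ^ K"
  shows "G dvd M"
proof -
  have "G dvd Gcd ((\<lambda>x. M * x) ` ((\<lambda>i. a i ^ K) ` I))"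
    by (rule Gcd_greatest) (use assms(2) in auto)
  also have "Gcd ((\<lambda>x. M * x) ` ((\<lambda>i. a i ^ K) ` I)) = normalize (M * Gcd ((\<lambda>i. a i ^ K) ` I))"
    by (rule Gcd_mult)
  finally show ?thesis using Gcd_power_eq_1[OF assms(1)] by simp
qed

text \<open>\<open>r\<close> is rational as a quotient of two integers, and its denominator in
  lowest terms divides every \<open>b i\<close>, hence their greatest common divisor.\<close>

lemma coprime_multiple_integer:
  fixes b c :: "nat \<Rightarrow> int"
  assumes "Gcd (b ` I) = 1" "\<And>j. j \<in> I \<Longrightarrow> r * of_int (b j) = (of_int (c j) :: complex)"
  shows "\<exists>G :: int. r = of_int G"
proof -
  have "\<exists>j\<in>I. b j \<noteq> 0"
  proof (rule ccontr)
    assume "\<not> ?thesis"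
    hence "b ` I \<subseteq> {0}" by auto
    hence "Gcd (b ` I) = 0" by (simp add: Gcd_0_iff)
    thus False using assms(1) by simp
  qed
  then obtain j where j: "j \<in> I" "b j \<noteq> 0" ..
  have "r = of_rat (of_int (c j) / of_int (b j))" using assms(2)[OF j(1)] j(2)
    by (simp add: of_rat_divide field_simps)
  moreover obtain p q where pq: "quotient_of (of_int (c j) / of_int (b j)) = (p, q)"
    by (cases "quotient_of (of_int (c j) / of_int (b j))")
  moreover have q: "q > 0" "coprime p q" "of_int (c j) / of_int (b j) = (of_int p / of_int q :: rat)"
    using quotient_of_denom_pos[OF pq] quotient_of_coprime[OF pq] quotient_of_div[OF pq] by auto
  ultimately have r: "r = of_int p / of_int q" by (simp add: of_rat_divide)
  have "q dvd b i" if "i \<in> I" for i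
  proof -
    have "of_int (p * b i) = (of_int (c i * q) :: complex)"
      using assms(2)[OF that] q(1) by (simp add: r field_simps)
    hence "p * b i = c i * q" by (simp only: of_int_eq_iff)
    hence "q dvd p * b i" by simp
    thus ?thesis using q(2) by (simp add: coprime_dvd_mult_right_iff coprime_commute)
  qed
  hence "q dvd Gcd (b ` I)" by (auto intro: Gcd_greatest)
  hence "q = 1" using assms(1) q(1) by simp
  thus ?thesis using r by auto
qed

lemma form_integral_multiple:
  assumes "\<And>j. j \<le> N \<Longrightarrow> form N \<rat> f (\<psi> j)"
  shows "\<exists>E>0::int. \<forall>j\<le>N. \<forall>a :: nat \<Rightarrow> int. \<exists>c :: int. of_int E * peval (\<psi> j) (\<lambda>i. of_int (a i)) = of_int c"
proof -
  define S where "S = {q :: rat. of_rat q \<in> (\<Union>j\<le>N. Poly_Mapping.lookup (\<psi> j) ` Poly_Mapping.keys (\<psi> j))}"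
  have "finite S" unfolding S_def
    by (rule finite_inverse_image) (auto intro: injI)
  from common_denominator[OF this] obtain E where E: "E > 0" "\<forall>q\<in>S. \<exists>z. of_int E * q = (of_int z :: rat)" by auto
  have "\<exists>c :: int. of_int E * peval (\<psi> j) (\<lambda>i. of_int (a i)) = of_int c" if j: "j \<le> N" for j and a :: "nat \<Rightarrow> int"
  proof -
    have "of_int E * peval (\<psi> j) (\<lambda>i. of_int (a i)) \<in> \<int>"
      unfolding peval_mono_val mono_val_of_int sum_distrib_left
    proof (rule Ints_sum)
      fix m assume m: "m \<in> Poly_Mapping.keys (\<psi> j)"
      hence "Poly_Mapping.lookup (\<psi> j) m \<in> \<rat>" using assms[OF j] by (auto simp: form_def)
      then obtain q where q: "Poly_Mapping.lookup (\<psi> j) m = of_rat q" by (auto simp: Rats_def)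
      hence "q \<in> S" using m j unfolding S_def by (auto simp flip: q)
      then obtain z where z: "of_int E * q = of_int z" using E(2) by auto
      have "of_int E * (of_rat q :: complex) = of_rat (of_int E * q)" by (simp add: of_rat_mult)
      hence "of_int E * Poly_Mapping.lookup (\<psi> j) m = of_int z" unfolding z q by simp
      thus "of_int E * (Poly_Mapping.lookup (\<psi> j) m * of_int (mono_val a m)) \<in> \<int>"
        unfolding mult.assoc[symmetric] by simp
    qed
    thus ?thesis by (auto elim: Ints_cases)
  qed
  thus ?thesis using E(1) by auto
qed

lemma cmod_form_le:
  fixes a :: "nat \<Rightarrow> int"
  assumes "form N A f F"
  shows "cmod (peval F (\<lambda>i. of_int (a i))) \<le> (\<Sum>m\<in>Poly_Mapping.keys F. cmod (Poly_Mapping.lookup F m)) * of_int (height_max N a) ^ f"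
proof -
  define y where "y v = (if v \<le> N then a v else 0)" for v
  have H: "\<bar>y v\<bar> \<le> height_max N a" for v
    using height_max_ge[of v N a] height_max_nonneg[where N = N and a = a] by (simp add: y_def)
  have "cmod (peval F (\<lambda>i. of_int (a i))) = cmod (peval F (\<lambda>i. of_int (y i)))"
    by (rule arg_cong[OF form_cong[OF assms]]) (simp add: y_def)
  also have "\<dots> \<le> (\<Sum>m\<in>Poly_Mapping.keys F. cmod (Poly_Mapping.lookup F m * of_int (mono_val y m)))"
    unfolding peval_mono_val mono_val_of_int by (rule norm_sum)
  also have "\<dots> \<le> (\<Sum>m\<in>Poly_Mapping.keys F. cmod (Poly_Mapping.lookup F m) * of_int (height_max N a) ^ f)"
  proof (rule sum_mono)
    fix m assume "m \<in> Poly_Mapping.keys F"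
    hence "mon_degree m = f" using assms by (auto simp: form_def)
    hence "\<bar>mono_val y m\<bar> \<le> height_max N a ^ f" using abs_mono_val_le[of y "height_max N a" m, OF H] by simp
    hence "real_of_int \<bar>mono_val y m\<bar> \<le> real_of_int (height_max N a ^ f)" by (simp only: of_int_le_iff)
    thus "cmod (Poly_Mapping.lookup F m * of_int (mono_val y m)) \<le> cmod (Poly_Mapping.lookup F m) * of_int (height_max N a) ^ f"
      by (simp add: norm_mult mult_left_mono)
  qed
  finally show ?thesis by (simp only: sum_distrib_right)
qed

lemma height_max_pos:
  assumes "Gcd (a ` {..N}) = 1"
  shows "height_max N a \<ge> 1"
proof (rule ccontr)
  assume "\<not> ?thesis"
  hence "\<bar>a i\<bar> \<le> 0" if "i \<le> N" for i using height_max_ge[OF that, of a] by linarith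
  hence "a ` {..N} \<subseteq> {0}" by auto
  hence "Gcd (a ` {..N}) = 0" by (simp add: Gcd_0_iff)
  thus False using assms by simp
qed

text \<open>Up to denominators, \<open>g\<close> is the common factor lost when
  \<open>\<psi>\<close> is applied to coprime coordinates. Multiplied by \<open>E\<close> it is an
  integer \<open>G\<close>, and the identities of \<open>integral_nullstellensatz\<close> make
  \<open>G\<close> divide \<open>Dt * E * a i ^ K\<close> for every \<open>i\<close>, so
  \<open>G\<close> divides \<open>Dt * E\<close> and \<open>g\<close> is bounded on both sides. The
  identity at a largest coordinate gives the lower bound for the height of the image; the triangle
  inequality gives the upper one.\<close>

lemma height_bound:
  assumes \<psi>: "proj_morphism N \<rat> f \<psi>"
  shows "\<exists>C. \<forall>(a :: nat \<Rightarrow> int) (b :: nat \<Rightarrow> int) g. Gcd (a ` {..N}) = 1 \<longrightarrow> Gcd (b ` {..N}) = 1 \<longrightarrow>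
    (\<forall>j\<le>N. peval (\<psi> j) (\<lambda>i. of_int (a i)) = g * of_int (b j)) \<longrightarrow>
    \<bar>ln (cmod g)\<bar> \<le> C \<and> \<bar>ln (of_int (height_max N b)) - real f * ln (of_int (height_max N a))\<bar> \<le> C"
proof -
  have form: "form N \<rat> f (\<psi> j)" if "j \<le> N" for j using \<psi> that by (simp add: proj_morphism_def)
  have "\<exists>E>0::int. \<forall>j\<le>N. \<forall>a :: nat \<Rightarrow> int. \<exists>c :: int. of_int E * peval (\<psi> j) (\<lambda>i. of_int (a i)) = of_int c"
    by (rule form_integral_multiple[of N f]) (rule form)
  then obtain E :: int where E: "E > 0"
    and E_int: "\<And>j a. j \<le> N \<Longrightarrow> \<exists>c :: int. of_int E * peval (\<psi> j) (\<lambda>i. of_int (a i :: int)) = of_int c" by auto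
  define P where "P i D k C \<longleftrightarrow> D > 0 \<and> (\<forall>a :: nat \<Rightarrow> int. a i \<noteq> 0 \<longrightarrow> (\<exists>I :: nat \<Rightarrow> int.
    (\<forall>j\<le>N. \<bar>I j\<bar> \<le> C * height_max N a ^ k) \<and>
    of_int (D * a i ^ (k + f)) = (\<Sum>j\<le>N. of_int (I j) * peval (\<psi> j) (\<lambda>i. of_int (a i)))))" for i D k C
  have "\<forall>i\<in>{..N}. \<exists>t. P i (fst t) (fst (snd t)) (snd (snd t))"
  proof
    fix i assume "i \<in> {..N}"
    hence "\<exists>D k C. P i D k C" unfolding P_def by (intro integral_nullstellensatz[OF \<psi>]) simp
    then obtain D k C where "P i D k C" by auto
    thus "\<exists>t. P i (fst t) (fst (snd t)) (snd (snd t))" by (intro exI[of _ "(D, k, C)"]) simp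
  qed
  from bchoice[OF this] obtain t where t: "\<forall>i\<in>{..N}. P i (fst (t i)) (fst (snd (t i))) (snd (snd (t i)))" ..
  define D where "D i = fst (t i)" for i
  define k where "k i = fst (snd (t i))" for i
  define C where "C i = snd (snd (t i))" for i
  have D: "D i > 0" if "i \<le> N" for i using t that by (simp add: P_def D_def)
  have NSS: "\<exists>I :: nat \<Rightarrow> int. (\<forall>j\<le>N. \<bar>I j\<bar> \<le> C i * height_max N a ^ k i) \<and>
    of_int (D i * a i ^ (k i + f)) = (\<Sum>j\<le>N. of_int (I j) * peval (\<psi> j) (\<lambda>i. of_int (a i)))"
    if "i \<le> N" "a i \<noteq> 0" for i a
    using t that by (simp add: P_def D_def C_def k_def)
  define Dt where "Dt = (\<Prod>i\<le>N. D i)"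
  \<comment> \<open>The successor keeps \<open>K\<close> positive, so that
    \<open>a i ^ K = 0\<close> when \<open>a i = 0\<close> and the divisibility by \<open>G\<close>
    holds for those indices as well.\<close>
  define K where "K = Suc ((\<Sum>i\<le>N. k i) + f)"
  define Cs where "Cs = (\<Sum>i\<le>N. \<bar>C i\<bar>) + 1"
  define C1 where "C1 = (\<Sum>j\<le>N. \<Sum>m\<in>Poly_Mapping.keys (\<psi> j). cmod (Poly_Mapping.lookup (\<psi> j) m)) + 1"
  define c1 where "c1 = (real N + 1) * real_of_int Cs"
  have Dt: "Dt > 0" unfolding Dt_def by (intro prod_pos) (use D in simp)
  have Cs: "Cs \<ge> 1" "\<And>i. i \<le> N \<Longrightarrow> C i \<le> Cs"
  proof -
    show "Cs \<ge> 1" unfolding Cs_def by (simp add: sum_nonneg)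
    fix i assume "i \<le> N"
    hence "\<bar>C i\<bar> \<le> (\<Sum>i\<le>N. \<bar>C i\<bar>)" by (intro member_le_sum) auto
    thus "C i \<le> Cs" unfolding Cs_def by simp
  qed
  have c1: "c1 \<ge> 1"
    unfolding c1_def using mult_mono[of 1 "real N + 1" 1 "real_of_int Cs"] Cs(1) by simp
  have C1: "C1 \<ge> 1" unfolding C1_def by (simp add: sum_nonneg)
  have C1_le: "cmod (peval (\<psi> j) (\<lambda>i. of_int (a i))) \<le> C1 * of_int (height_max N a) ^ f" if "j \<le> N" for j and a :: "nat \<Rightarrow> int"
  proof -
    have "(\<Sum>m\<in>Poly_Mapping.keys (\<psi> j). cmod (Poly_Mapping.lookup (\<psi> j) m)) \<le> C1 - 1"
      unfolding C1_def using that
      by (simp, intro member_le_sum[of j _ "\<lambda>j. \<Sum>m\<in>Poly_Mapping.keys (\<psi> j). cmod (Poly_Mapping.lookup (\<psi> j) m)"])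
         (auto intro: sum_nonneg)
    moreover have "height_max N a \<ge> 0" by (rule height_max_nonneg)
    ultimately have "(\<Sum>m\<in>Poly_Mapping.keys (\<psi> j). cmod (Poly_Mapping.lookup (\<psi> j) m)) * of_int (height_max N a) ^ f \<le> C1 * of_int (height_max N a) ^ f"
      by (intro mult_right_mono) simp_all
    thus ?thesis using cmod_form_le[OF form[OF that], of a] by linarith
  qed
  \<comment> \<open>Each of the four estimates at the end needs at most two of these logarithms; all
    four are nonnegative because \<open>Dt\<close>, \<open>E\<close>, \<open>c1\<close> and
    \<open>C1\<close> are at least \<open>1\<close>.\<close>
  define B where "B = ln (real_of_int Dt) + ln (real_of_int E) + ln c1 + ln C1"
  have main: "\<bar>ln (cmod g)\<bar> \<le> B \<and> \<bar>ln (of_int (height_max N b)) - real f * ln (of_int (height_max N a))\<bar> \<le> B"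
    if a: "Gcd (a ` {..N}) = 1" and b: "Gcd (b ` {..N}) = 1"
      and g: "\<forall>j\<le>N. peval (\<psi> j) (\<lambda>i. of_int (a i)) = g * of_int (b j)"
    for a b :: "nat \<Rightarrow> int" and g
  proof -
    define H where "H = height_max N a"
    define H' where "H' = height_max N b"
    have H: "H \<ge> 1" "H' \<ge> 1" using height_max_pos[OF a] height_max_pos[OF b] by (simp_all add: H_def H'_def)
    have "\<exists>c. \<forall>j\<in>{..N}. (of_int E * g) * of_int (b j) = (of_int (c j :: int) :: complex)"
      using E_int[of _ a] g by (intro bchoice) (simp add: mult.assoc)
    then obtain c :: "nat \<Rightarrow> int" where c: "\<forall>j\<in>{..N}. (of_int E * g) * of_int (b j) = (of_int (c j) :: complex)" ..
    have "\<exists>G :: int. of_int E * g = of_int G"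
      by (rule coprime_multiple_integer[OF b, of _ c]) (use c in blast)
    then obtain G :: int where G: "of_int E * g = of_int G" ..
    obtain i0 where i0: "i0 \<le> N" "\<bar>a i0\<bar> = H" using height_max_attained[of N a] by (auto simp: H_def)
    have ai0: "a i0 \<noteq> 0" using i0 H by auto
    have G_dvd: "G dvd Dt * E * a i ^ K" if i: "i \<le> N" for i
    proof (cases "a i = 0")
      case True
      thus ?thesis by (simp add: K_def)
    next
      case False
      from NSS[of i a, OF i False] obtain I :: "nat \<Rightarrow> int" where
        I: "of_int (D i * a i ^ (k i + f)) = (\<Sum>j\<le>N. of_int (I j) * peval (\<psi> j) (\<lambda>i. of_int (a i)))" by auto
      have "of_int (E * (D i * a i ^ (k i + f))) = (of_int (G * (\<Sum>j\<le>N. I j * b j)) :: complex)"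
        using g I by (simp add: sum_distrib_left mult_ac flip: G)
      hence "E * (D i * a i ^ (k i + f)) = G * (\<Sum>j\<le>N. I j * b j)" by (simp only: of_int_eq_iff)
      hence "G dvd E * (D i * a i ^ (k i + f))" by simp
      moreover have "D i dvd Dt" unfolding Dt_def using i by (intro dvd_prodI) auto
      moreover have "k i + f \<le> K" unfolding K_def using i member_le_sum[of i "{..N}" k] by simp
      hence "a i ^ (k i + f) dvd a i ^ K" by (rule le_imp_power_dvd)
      ultimately have "G dvd E * (Dt * a i ^ K)" by (meson dvd_trans mult_dvd_mono dvd_refl)
      thus ?thesis by (simp add: mult_ac)
    qed
    have "G dvd Dt * E" by (rule dvd_of_dvd_coprime_powers[OF a, of _ _ K]) (use G_dvd in simp)
    hence G_le: "\<bar>G\<bar> \<le> Dt * E" using Dt E by (metis abs_of_pos dvd_imp_le_int mult_pos_pos less_irrefl)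
    have gE: "cmod g = \<bar>of_int G\<bar> / of_int E"
    proof -
      have "cmod (of_int E * g) = cmod (of_int G)" using G by simp
      thus ?thesis using E by (simp add: norm_mult field_simps)
    qed
    have \<psi>_le: "cmod (peval (\<psi> j) (\<lambda>i. of_int (a i))) \<le> cmod g * of_int H'" if "j \<le> N" for j
    proof -
      have "real_of_int \<bar>b j\<bar> \<le> of_int H'" using height_max_ge[OF that, of b] by (simp only: of_int_le_iff H'_def)
      thus ?thesis using g that by (simp add: norm_mult mult_left_mono)
    qed
    have low: "of_int H ^ f \<le> c1 * (cmod g * of_int H')"
    proof -
      from NSS[of i0 a, OF i0(1) ai0] obtain I :: "nat \<Rightarrow> int" where
        I: "\<forall>j\<le>N. \<bar>I j\<bar> \<le> C i0 * height_max N a ^ k i0"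
          "of_int (D i0 * a i0 ^ (k i0 + f)) = (\<Sum>j\<le>N. of_int (I j) * peval (\<psi> j) (\<lambda>i. of_int (a i)))" by auto
      have "of_int H ^ (k i0 + f) \<le> real_of_int (D i0) * of_int H ^ (k i0 + f)"
        using D[OF i0(1)] H by (simp add: mult_le_cancel_right1)
      also have "\<dots> = cmod (of_int (D i0 * a i0 ^ (k i0 + f)))"
        using D[OF i0(1)] by (simp add: norm_mult norm_power flip: i0(2))
      also have "\<dots> \<le> (\<Sum>j\<le>N. cmod (of_int (I j) * peval (\<psi> j) (\<lambda>i. of_int (a i))))"
        unfolding I(2) by (rule norm_sum)
      also have "\<dots> \<le> (\<Sum>j\<le>N. (of_int Cs * of_int H ^ k i0) * (cmod g * of_int H'))"
      proof (rule sum_mono)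
        fix j assume "j \<in> {..N}"
        hence j: "j \<le> N" by simp
        have "\<bar>I j\<bar> \<le> C i0 * H ^ k i0" using I(1) j by (simp add: H_def)
        also have "\<dots> \<le> Cs * H ^ k i0" using Cs(2)[OF i0(1)] H by (intro mult_right_mono) auto
        finally have "real_of_int \<bar>I j\<bar> \<le> real_of_int (Cs * H ^ k i0)" by (simp only: of_int_le_iff)
        hence "cmod (of_int (I j)) \<le> of_int Cs * of_int H ^ k i0" by simp
        thus "cmod (of_int (I j) * peval (\<psi> j) (\<lambda>i. of_int (a i))) \<le> (of_int Cs * of_int H ^ k i0) * (cmod g * of_int H')"
          unfolding norm_mult by (intro mult_mono \<psi>_le[OF j]) (use Cs(1) H in auto)
      qed
      also have "\<dots> = of_int H ^ k i0 * (c1 * (cmod g * of_int H'))"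
        by (simp add: c1_def mult_ac)
      finally show ?thesis using H by (simp add: power_add)
    qed
    have up: "cmod g * of_int H' \<le> C1 * of_int H ^ f"
    proof -
      obtain j where j: "j \<le> N" "\<bar>b j\<bar> = H'" using height_max_attained[of N b] by (auto simp: H'_def)
      have "cmod g * of_int H' = cmod (peval (\<psi> j) (\<lambda>i. of_int (a i)))"
        using g j(1) by (simp add: norm_mult flip: j(2))
      thus ?thesis using C1_le[OF j(1), of a] by (simp add: H_def)
    qed
    have "cmod g \<noteq> 0"
    proof
      assume "cmod g = 0"
      moreover have "real_of_int H ^ f > 0" using H by simp
      ultimately show False using low by simp
    qed
    hence g0: "cmod g > 0" by simp
    hence "G \<noteq> 0" using gE by auto
    hence "\<bar>G\<bar> \<ge> 1" by simp
    hence "real_of_int \<bar>G\<bar> \<ge> 1" by linarith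
    hence "cmod g \<ge> 1 / of_int E" using gE E by (simp add: divide_right_mono)
    hence "ln (cmod g) \<ge> ln (1 / of_int E)" using E by (intro ln_mono) auto
    hence g1: "ln (cmod g) \<ge> - ln (of_int E)" using E by (simp add: ln_div)
    have "real_of_int \<bar>G\<bar> \<le> of_int (Dt * E)" using G_le by (simp only: of_int_le_iff)
    hence "cmod g \<le> of_int Dt" unfolding gE using E by (simp add: pos_divide_le_eq)
    hence g2: "ln (cmod g) \<le> ln (of_int Dt)" using g0 by (intro ln_mono) auto
    have "ln (of_int H ^ f) \<le> ln (c1 * (cmod g * of_int H'))" using low H by (intro ln_mono) auto
    hence h1: "real f * ln (of_int H) \<le> ln c1 + ln (cmod g) + ln (of_int H')"
      using c1 g0 H by (simp add: ln_mult ln_realpow)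
    have "ln (cmod g * of_int H') \<le> ln (C1 * of_int H ^ f)" using up g0 H by (intro ln_mono) auto
    hence h2: "ln (cmod g) + ln (of_int H') \<le> ln C1 + real f * ln (of_int H)"
      using C1 g0 H by (simp add: ln_mult ln_realpow)
    have "ln (real_of_int Dt) \<ge> 0" "ln (real_of_int E) \<ge> 0" "ln c1 \<ge> 0" "ln C1 \<ge> 0" using Dt E c1 C1 by simp_all
    thus ?thesis using g1 g2 h1 h2 unfolding B_def H_def H'_def abs_le_iff by linarith
  qed
  show ?thesis by (rule exI[of _ B]) (intro allI impI, rule main)
qed

section \<open>Primitive elements\<close>

text \<open>Equivalent to \<open>subfield L complex_ring\<close>, by
  \<open>subfield_complex_ring\<close> and \<open>csubfield_of_subfield\<close>, but phrased with
  the type class operations. Since \<open>inverse 0 = 0\<close>, closure under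
  \<open>inverse\<close> needs no exception.\<close>

definition csubfield :: "complex set \<Rightarrow> bool" where
  "csubfield L \<longleftrightarrow> 0 \<in> L \<and> 1 \<in> L \<and> (\<forall>a\<in>L. \<forall>b\<in>L. a + b \<in> L \<and> a * b \<in> L) \<and> (\<forall>a\<in>L. - a \<in> L \<and> inverse a \<in> L)"

definition polys :: "complex set \<Rightarrow> complex Polynomial.poly set" where
  "polys L = {p. \<forall>i. Polynomial.coeff p i \<in> L}"

lemma csubfieldD:
  assumes "csubfield L"
  shows "0 \<in> L" "1 \<in> L" "a \<in> L \<Longrightarrow> b \<in> L \<Longrightarrow> a + b \<in> L" "a \<in> L \<Longrightarrow> b \<in> L \<Longrightarrow> a * b \<in> L"
    "a \<in> L \<Longrightarrow> - a \<in> L" "a \<in> L \<Longrightarrow> inverse a \<in> L" "a \<in> L \<Longrightarrow> b \<in> L \<Longrightarrow> a - b \<in> L" "a \<in> L \<Longrightarrow> b \<in> L \<Longrightarrow> a / b \<in> L"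
proof -
  show 1: "0 \<in> L" "1 \<in> L" "a \<in> L \<Longrightarrow> b \<in> L \<Longrightarrow> a + b \<in> L" "a \<in> L \<Longrightarrow> b \<in> L \<Longrightarrow> a * b \<in> L"
    "a \<in> L \<Longrightarrow> - a \<in> L" "a \<in> L \<Longrightarrow> inverse a \<in> L" for a b using assms unfolding csubfield_def by blast+
  show "a \<in> L \<Longrightarrow> b \<in> L \<Longrightarrow> a - b \<in> L" using 1(3)[of a "- b"] 1(5) by simp
  show "a \<in> L \<Longrightarrow> b \<in> L \<Longrightarrow> a / b \<in> L" using 1(4)[of a "inverse b"] 1(6) by (simp add: divide_inverse)
qed

lemma csubfield_sum: "csubfield L \<Longrightarrow> (\<And>i. i \<in> I \<Longrightarrow> f i \<in> L) \<Longrightarrow> sum f I \<in> L"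
  by (induction I rule: infinite_finite_induct) (simp_all add: csubfieldD)

lemma csubfield_power: "csubfield L \<Longrightarrow> a \<in> L \<Longrightarrow> a ^ n \<in> L"
  by (induction n) (simp_all add: csubfieldD)

lemma csubfield_of_nat: "csubfield L \<Longrightarrow> of_nat n \<in> L"
  by (induction n) (simp_all add: csubfieldD)

lemma csubfield_of_int: "csubfield L \<Longrightarrow> of_int n \<in> L"
  by (cases n rule: int_cases2) (simp_all add: csubfieldD csubfield_of_nat)

lemma Rats_subset_csubfield:
  assumes "csubfield L" shows "\<rat> \<subseteq> L"
proof
  fix x :: complex assume "x \<in> \<rat>"
  then obtain a b where "x = of_int a / of_int b" by (auto elim: Rats_cases')
  thus "x \<in> L" by (simp add: csubfieldD csubfield_of_int assms)
qed

lemma csubfield_Rats: "csubfield \<rat>"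
  by (simp add: csubfield_def)

lemma csubfield_semiring: "csubfield L \<Longrightarrow> semiring_set L"
  by (simp add: csubfield_def semiring_set_def)

section \<open>Division, minimal polynomials and simple extensions over a subfield\<close>

context
  fixes L assumes L: "csubfield L"
begin

lemma polys_0: "0 \<in> polys L" by (simp add: polys_def csubfieldD[OF L])
lemma polys_const: "a \<in> L \<Longrightarrow> [:a:] \<in> polys L"
  by (auto simp: polys_def coeff_pCons csubfieldD[OF L] split: nat.split)
lemma polys_1: "1 \<in> polys L" using polys_const[of 1] csubfieldD(2)[OF L] by (simp add: one_pCons)
lemma polys_pCons: "pCons a p \<in> polys L \<longleftrightarrow> a \<in> L \<and> p \<in> polys L"
proof
  assume *: "pCons a p \<in> polys L"
  have "Polynomial.coeff (pCons a p) 0 \<in> L" "\<And>i. Polynomial.coeff (pCons a p) (Suc i) \<in> L"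
    using * unfolding polys_def by blast+
  thus "a \<in> L \<and> p \<in> polys L" by (simp add: polys_def)
qed (auto simp: polys_def coeff_pCons split: nat.split)
lemma polys_add: "p \<in> polys L \<Longrightarrow> q \<in> polys L \<Longrightarrow> p + q \<in> polys L"
  by (simp add: polys_def csubfieldD[OF L])
lemma polys_diff: "p \<in> polys L \<Longrightarrow> q \<in> polys L \<Longrightarrow> p - q \<in> polys L"
  by (simp add: polys_def csubfieldD[OF L])
lemma polys_mult: "p \<in> polys L \<Longrightarrow> q \<in> polys L \<Longrightarrow> p * q \<in> polys L"
  by (simp add: polys_def coeff_mult csubfield_sum[OF L] csubfieldD[OF L])
lemma polys_smult: "a \<in> L \<Longrightarrow> p \<in> polys L \<Longrightarrow> Polynomial.smult a p \<in> polys L"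
  by (simp add: polys_def csubfieldD[OF L])
lemma polys_monom: "a \<in> L \<Longrightarrow> Polynomial.monom a n \<in> polys L"
  by (simp add: polys_def csubfieldD[OF L])
lemma polys_pderiv: "p \<in> polys L \<Longrightarrow> pderiv p \<in> polys L"
  using csubfieldD(4)[OF L csubfield_of_nat[OF L]] by (simp add: polys_def coeff_pderiv del: of_nat_Suc)
lemma polys_pcompose: "p \<in> polys L \<Longrightarrow> q \<in> polys L \<Longrightarrow> pcompose p q \<in> polys L"
  by (induction p) (simp_all add: polys_0 polys_pCons pcompose_pCons polys_add polys_mult polys_const)

lemma polys_div:
  assumes "q \<in> polys L" "q \<noteq> 0"
  shows "p \<in> polys L \<Longrightarrow> \<exists>s\<in>polys L. \<exists>r\<in>polys L. p = q * s + r \<and> (r = 0 \<or> Polynomial.degree r < Polynomial.degree q)"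
proof (induction "Polynomial.degree p" arbitrary: p rule: less_induct)
  case less
  show ?case
  proof (cases "p = 0 \<or> Polynomial.degree p < Polynomial.degree q")
    case True
    thus ?thesis using less.prems polys_0 by (intro bexI[of _ 0] bexI[of _ p]) auto
  next
    case False
    define n where "n = Polynomial.degree p - Polynomial.degree q"
    define c where "c = Polynomial.lead_coeff p / Polynomial.lead_coeff q"
    define t where "t = Polynomial.monom c n"
    have c: "c \<noteq> 0" "c \<in> L" using False assms less.prems csubfieldD(8)[OF L] by (auto simp: c_def polys_def)
    have t: "t \<in> polys L" unfolding t_def by (rule polys_monom) (rule c)
    define p' where "p' = p - q * t"
    have p': "p' \<in> polys L" unfolding p'_def by (intro polys_diff polys_mult less.prems assms t)
    have lead: "Polynomial.coeff p' (Polynomial.degree p) = 0"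
    proof -
      have "Polynomial.coeff (q * t) (Polynomial.degree q + n) = Polynomial.lead_coeff q * c"
        using coeff_mult_degree_sum[of q t] c by (simp add: t_def degree_monom_eq)
      thus ?thesis using False assms(2) by (simp add: p'_def n_def c_def)
    qed
    have "Polynomial.degree (q * t) \<le> Polynomial.degree p"
      using False degree_mult_le[of q t] degree_monom_le[of c n] unfolding t_def n_def by arith
    hence deg: "Polynomial.degree p' \<le> Polynomial.degree p" unfolding p'_def by (simp add: degree_diff_le)
    show ?thesis
    proof (cases "p' = 0")
      case True
      hence "p = q * t + 0" by (simp add: p'_def)
      thus ?thesis using t polys_0 by (intro bexI[of _ t] bexI[of _ 0]) simp_all
    next
      case nz: False
      have "Polynomial.degree p' \<noteq> Polynomial.degree p" using lead nz by (metis leading_coeff_0_iff)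
      hence "Polynomial.degree p' < Polynomial.degree p" using deg by simp
      from less.hyps[OF this p'] obtain s r where sr: "s \<in> polys L" "r \<in> polys L" "p' = q * s + r"
        "r = 0 \<or> Polynomial.degree r < Polynomial.degree q" by auto
      have "p = p' + q * t" by (simp add: p'_def)
      also have "\<dots> = q * (s + t) + r" unfolding sr(3) by (simp add: distrib_left)
      finally have "p = q * (s + t) + r" .
      moreover have "s + t \<in> polys L" by (intro polys_add sr t)
      ultimately show ?thesis using sr(2,4) by (intro bexI[of _ "s + t"] bexI[of _ r] conjI)
    qed
  qed
qed

text \<open>No leading coefficient is prescribed, so \<open>f\<close> is determined only up to a
  nonzero factor in \<open>L\<close>.\<close>

definition is_minpoly :: "complex Polynomial.poly \<Rightarrow> complex \<Rightarrow> bool" where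
  "is_minpoly f x \<longleftrightarrow> f \<in> polys L \<and> f \<noteq> 0 \<and> poly f x = 0 \<and>
     (\<forall>g\<in>polys L. g \<noteq> 0 \<longrightarrow> poly g x = 0 \<longrightarrow> Polynomial.degree f \<le> Polynomial.degree g)"

lemma minpoly_exists:
  assumes "p \<in> polys L" "p \<noteq> 0" "poly p x = 0"
  shows "\<exists>f. is_minpoly f x"
proof -
  let ?P = "\<lambda>p. p \<in> polys L \<and> p \<noteq> 0 \<and> poly p x = 0"
  from ex_has_least_nat[of ?P p Polynomial.degree] assms
  obtain f where "?P f" "\<forall>g. ?P g \<longrightarrow> Polynomial.degree f \<le> Polynomial.degree g" by auto
  thus ?thesis unfolding is_minpoly_def by (intro exI[of _ f]) simp
qed

lemma minpoly_dvd:
  assumes f: "is_minpoly f x" and g: "g \<in> polys L" "poly g x = 0"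
  shows "\<exists>s\<in>polys L. g = f * s"
proof -
  have f': "f \<in> polys L" "f \<noteq> 0" "poly f x = 0" using f by (auto simp: is_minpoly_def)
  from polys_div[OF f'(1,2) g(1)] obtain s r where sr: "s \<in> polys L" "r \<in> polys L" "g = f * s + r"
    "r = 0 \<or> Polynomial.degree r < Polynomial.degree f" by auto
  have "poly r x = 0" using sr(3) g(2) f'(3) by simp
  hence "r = 0" using f sr(2,4) unfolding is_minpoly_def by (meson not_le)
  thus ?thesis using sr by auto
qed

text \<open>Irreducibility in terms of degrees: a minimal polynomial \<open>h\<close> of
  \<open>z\<close> divides \<open>f\<close>, and one of the two factors vanishes at
  \<open>x\<close>. As \<open>f\<close> has least degree for \<open>x\<close>, \<open>h\<close> must
  have the full degree of \<open>f\<close>.\<close>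

lemma minpoly_conjugate:
  assumes f: "is_minpoly f x" and z: "poly f z = 0"
  shows "is_minpoly f z"
proof -
  have f': "f \<in> polys L" "f \<noteq> 0" "poly f x = 0" using f by (auto simp: is_minpoly_def)
  obtain h where h: "is_minpoly h z" using minpoly_exists[OF f'(1,2) z] ..
  have h': "h \<in> polys L" "h \<noteq> 0" "poly h z = 0" using h by (auto simp: is_minpoly_def)
  from minpoly_dvd[OF h f'(1) z] obtain s where s: "s \<in> polys L" "f = h * s" by auto
  have s0: "s \<noteq> 0" using s f' by auto
  have deg: "Polynomial.degree f = Polynomial.degree h + Polynomial.degree s"
    using s(2) s0 h' by (simp add: degree_mult_eq)
  have "poly h x = 0 \<or> poly s x = 0" using f'(3) s(2) by simp
  hence "Polynomial.degree f \<le> Polynomial.degree h"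
  proof
    assume "poly h x = 0"
    thus ?thesis using f h' by (simp add: is_minpoly_def)
  next
    assume "poly s x = 0"
    hence "Polynomial.degree f \<le> Polynomial.degree s" using f s(1) s0 by (simp add: is_minpoly_def)
    hence "Polynomial.degree h = 0" using deg by simp
    then obtain c where "h = [:c:]" by (rule degree_eq_zeroE)
    thus ?thesis using h' by simp
  qed
  thus ?thesis using h f' z unfolding is_minpoly_def by (meson order_trans)
qed

lemma minpoly_degree_pos: "is_minpoly f x \<Longrightarrow> Polynomial.degree f > 0"
proof (rule ccontr)
  assume f: "is_minpoly f x" and "\<not> Polynomial.degree f > 0"
  hence "Polynomial.degree f = 0" by simp
  then obtain c where "f = [:c:]" by (rule degree_eq_zeroE)
  thus False using f by (simp add: is_minpoly_def)
qed

text \<open>At a multiple root the derivative would vanish. It is nonzero and of smaller degree,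
  which contradicts the minimality of \<open>f\<close> at that root.\<close>

lemma minpoly_rsquarefree:
  assumes f: "is_minpoly f x"
  shows "rsquarefree f"
proof -
  have "poly (pderiv f) z \<noteq> 0" if "poly f z = 0" for z
  proof
    assume 0: "poly (pderiv f) z = 0"
    have f': "is_minpoly f z" by (rule minpoly_conjugate[OF f that])
    have "pderiv f \<noteq> 0" using minpoly_degree_pos[OF f] by (simp add: pderiv_eq_0_iff)
    hence "Polynomial.degree f \<le> Polynomial.degree (pderiv f)"
      using f' 0 polys_pderiv[of f] by (simp add: is_minpoly_def)
    thus False using minpoly_degree_pos[OF f] by (simp add: degree_pderiv)
  qed
  thus ?thesis unfolding rsquarefree_roots by blast
qed

text \<open>The ring generated by \<open>L\<close> and \<open>x\<close>; it is the field extension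
  as soon as \<open>x\<close> has a minimal polynomial, by \<open>csubfield_adjoin\<close>.\<close>

definition adjoin :: "complex \<Rightarrow> complex set" where
  "adjoin x = (\<lambda>p. poly p x) ` polys L"

lemma adjoin_base: "L \<subseteq> adjoin x" "x \<in> adjoin x"
proof -
  show "L \<subseteq> adjoin x"
  proof
    fix a assume "a \<in> L"
    hence "[:a:] \<in> polys L" by (rule polys_const)
    thus "a \<in> adjoin x" unfolding adjoin_def by (rule rev_image_eqI) simp
  qed
  have "[:0, 1:] \<in> polys L" by (simp add: polys_pCons polys_0 csubfieldD[OF L])
  thus "x \<in> adjoin x" unfolding adjoin_def by (rule rev_image_eqI) simp
qed

text \<open>Bezout: the nonzero combination \<open>d\<close> of \<open>f\<close> and
  \<open>g\<close> of least degree divides both. A root of \<open>d\<close> would be a conjugate of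
  \<open>x\<close> at which \<open>g\<close> vanishes, so \<open>f\<close> would divide
  \<open>g\<close>; hence \<open>d\<close> is constant, and evaluation at \<open>x\<close> gives the
  inverse.\<close>

lemma adjoin_inverse:
  assumes f: "is_minpoly f x" and g: "g \<in> polys L" "poly g x \<noteq> 0"
  shows "\<exists>b\<in>polys L. poly b x * poly g x = 1"
proof -
  define J where "J d \<longleftrightarrow> d \<in> polys L \<and> d \<noteq> 0 \<and> (\<exists>a\<in>polys L. \<exists>b\<in>polys L. d = a * f + b * g)" for d
  have f': "f \<in> polys L" "f \<noteq> 0" "poly f x = 0" using f by (auto simp: is_minpoly_def)
  have "f = 1 * f + 0 * g" by simp
  hence Jf: "J f" unfolding J_def using f' polys_0 polys_1 by blast
  from ex_has_least_nat[of J, OF this, of Polynomial.degree] obtain d where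
    d: "J d" "\<forall>e. J e \<longrightarrow> Polynomial.degree d \<le> Polynomial.degree e" by auto
  from d(1) have d': "d \<in> polys L" "d \<noteq> 0" "\<exists>a\<in>polys L. \<exists>b\<in>polys L. d = a * f + b * g"
    by (simp_all add: J_def)
  from d'(3) obtain a b where ab: "a \<in> polys L" "b \<in> polys L" "d = a * f + b * g"
    by (elim bexE) (rule that)
  have dvd: "\<exists>s\<in>polys L. h = d * s"
    if h: "h \<in> polys L" "\<exists>a\<in>polys L. \<exists>b\<in>polys L. h = a * f + b * g" for h
  proof -
    from h(2) obtain a' b' where ab': "a' \<in> polys L" "b' \<in> polys L" "h = a' * f + b' * g"
      by (elim bexE) (rule that)
    from polys_div[OF d'(1,2) h(1)] obtain s r where sr: "s \<in> polys L" "r \<in> polys L" "h = d * s + r"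
      "r = 0 \<or> Polynomial.degree r < Polynomial.degree d" by auto
    have "r = h - d * s" using sr(3) by simp
    also have "\<dots> = (a' - s * a) * f + (b' - s * b) * g"
      unfolding ab'(3) ab(3) by (simp add: algebra_simps)
    finally have "r = (a' - s * a) * f + (b' - s * b) * g" .
    moreover have "a' - s * a \<in> polys L" "b' - s * b \<in> polys L"
      by (intro polys_diff polys_mult ab ab' sr)+
    ultimately have "r \<noteq> 0 \<Longrightarrow> J r" unfolding J_def using sr(2) by blast
    hence "r = 0" using d(2) sr(4) by (meson not_le)
    thus ?thesis using sr by auto
  qed
  have "\<exists>s\<in>polys L. f = d * s" using Jf unfolding J_def by (intro dvd) simp_all
  then obtain s where s: "f = d * s" ..
  have "g = 0 * f + 1 * g" by simp
  hence "\<exists>s\<in>polys L. g = d * s" by (intro dvd g) (use polys_0 polys_1 in blast)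
  then obtain s' where s': "g = d * s'" ..
  have "Polynomial.degree d = 0"
  proof (rule ccontr)
    assume "Polynomial.degree d \<noteq> 0"
    hence "\<not> constant (poly d)" by (simp add: constant_degree)
    then obtain z where z: "poly d z = 0" using fundamental_theorem_of_algebra by blast
    have fz: "poly f z = 0" "poly g z = 0" using z s s' by simp_all
    from minpoly_dvd[OF minpoly_conjugate[OF f fz(1)] g(1) fz(2)] obtain u where "g = f * u" by auto
    thus False using f'(3) g(2) by simp
  qed
  then obtain c where c: "d = [:c:]" by (rule degree_eq_zeroE)
  have c0: "c \<noteq> 0" "c \<in> L" using c d'(1,2) by (simp_all add: polys_pCons)
  have cc: "c = poly b x * poly g x" using arg_cong[OF ab(3), of "\<lambda>p. poly p x"] c f'(3) by simp
  have "inverse c * (poly b x * poly g x) = 1" unfolding cc[symmetric] using c0(1) by simp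
  hence "poly (Polynomial.smult (inverse c) b) x * poly g x = 1" by (simp add: mult.assoc)
  moreover have "Polynomial.smult (inverse c) b \<in> polys L" by (intro polys_smult csubfieldD[OF L] c0 ab)
  ultimately show ?thesis by blast
qed

lemma csubfield_adjoin:
  assumes f: "is_minpoly f x"
  shows "csubfield (adjoin x)"
  unfolding csubfield_def
proof (intro conjI ballI)
  show "0 \<in> adjoin x" "1 \<in> adjoin x" using adjoin_base csubfieldD[OF L] by blast+
next
  fix a b assume "a \<in> adjoin x" "b \<in> adjoin x"
  then obtain p q where pq: "p \<in> polys L" "q \<in> polys L" "a = poly p x" "b = poly q x" by (auto simp: adjoin_def)
  show "a + b \<in> adjoin x" "a * b \<in> adjoin x"
    unfolding adjoin_def pq(3,4) poly_add[symmetric] poly_mult[symmetric]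
    by (intro imageI polys_add polys_mult pq)+
next
  fix a assume "a \<in> adjoin x"
  then obtain p where p: "p \<in> polys L" "a = poly p x" by (auto simp: adjoin_def)
  show "- a \<in> adjoin x" unfolding adjoin_def
    using polys_diff[OF polys_0 p(1)] p(2) by (intro rev_image_eqI[of "0 - p"]) simp_all
  show "inverse a \<in> adjoin x"
  proof (cases "a = 0")
    case True
    thus ?thesis using adjoin_base csubfieldD[OF L] by auto
  next
    case False
    with adjoin_inverse[OF f p(1)] p(2) obtain b where "b \<in> polys L" "poly b x * a = 1" by auto
    moreover from this(2) have "inverse a = poly b x" by (simp add: inverse_unique mult.commute)
    ultimately show ?thesis unfolding adjoin_def by blast
  qed
qed

lemma adjoin_minimal:
  assumes M: "csubfield M" "L \<subseteq> M" "x \<in> M"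
  shows "adjoin x \<subseteq> M"
proof
  fix a assume "a \<in> adjoin x"
  then obtain p where p: "p \<in> polys L" "a = poly p x" by (auto simp: adjoin_def)
  show "a \<in> M" unfolding p(2) poly_altdef
    by (intro csubfield_sum csubfieldD csubfield_power M) (use p M(2) in \<open>auto simp: polys_def\<close>)
qed

end

section \<open>Algebraic numbers and the primitive element theorem\<close>

lemma algebraic_polys: "algebraic x \<longleftrightarrow> (\<exists>p\<in>polys \<rat>. p \<noteq> 0 \<and> poly p x = 0)" for x :: complex
  unfolding algebraic_altdef polys_def by blast

lemma algebraic_minpoly: "algebraic x \<Longrightarrow> \<exists>f. is_minpoly \<rat> f x"
  unfolding algebraic_polys using minpoly_exists[OF csubfield_Rats] by blast

lemma power_reduce:
  fixes x :: complex
  assumes "algebraic x"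
  shows "\<exists>(n::nat) R. \<forall>k. x ^ k = (\<Sum>i<n. of_rat (R k i) * x ^ i)"
proof -
  obtain f where f: "is_minpoly \<rat> f x" using algebraic_minpoly[OF assms] ..
  have f': "f \<in> polys \<rat>" "f \<noteq> 0" "poly f x = 0" using f by (auto simp: is_minpoly_def[OF csubfield_Rats])
  have "\<exists>R. x ^ k = (\<Sum>i<Polynomial.degree f. of_rat (R i) * x ^ i)" for k
  proof -
    have "Polynomial.monom 1 k \<in> polys \<rat>" by (rule polys_monom[OF csubfield_Rats]) simp
    from polys_div[OF csubfield_Rats f'(1,2) this] obtain s r where
      sr: "s \<in> polys \<rat>" "r \<in> polys \<rat>" "Polynomial.monom 1 k = f * s + r"
        "r = 0 \<or> Polynomial.degree r < Polynomial.degree f" by auto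
    have "\<forall>i. \<exists>q. Polynomial.coeff r i = of_rat q" using sr(2) by (auto simp: polys_def Rats_def)
    from choice[OF this] obtain R where R: "\<forall>i. Polynomial.coeff r i = of_rat (R i)" ..
    have "x ^ k = poly r x" using arg_cong[OF sr(3), of "\<lambda>p. poly p x"] f'(3) by (simp add: poly_monom)
    also have "\<dots> = (\<Sum>i\<le>Polynomial.degree r. Polynomial.coeff r i * x ^ i)" by (rule poly_altdef)
    also have "\<dots> = (\<Sum>i<Polynomial.degree f. Polynomial.coeff r i * x ^ i)"
    proof (cases "r = 0")
      case False
      hence "Polynomial.degree r < Polynomial.degree f" using sr(4) by simp
      thus ?thesis by (intro sum.mono_neutral_left) (auto simp: coeff_eq_0)
    qed simp
    finally show ?thesis using R by (intro exI[of _ R]) simp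
  qed
  hence "\<exists>R. \<forall>k. x ^ k = (\<Sum>i<Polynomial.degree f. of_rat (R k i) * x ^ i)" by (intro choice allI)
  thus ?thesis by (intro exI[of _ "Polynomial.degree f"])
qed

text \<open>The first \<open>card B + 1\<close> powers have coordinates in \<open>card B\<close>
  generators, so they satisfy a nontrivial rational relation, which is a polynomial equation for
  \<open>x\<close>.\<close>

lemma algebraic_if_powers_in_span:
  fixes v :: "'b \<Rightarrow> complex"
  assumes "finite B" "\<And>k. x ^ k = (\<Sum>b\<in>B. of_rat (q k b) * v b)"
  shows "algebraic x"
proof -
  have "card B < card {..card B}" by simp
  from lin_dep[OF assms(1) finite_atMost this, of q] obtain c :: "nat \<Rightarrow> rat" where
    c: "\<exists>a\<in>{..card B}. c a \<noteq> 0" "\<forall>b\<in>B. (\<Sum>a\<le>card B. c a * q a b) = 0"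
    by (elim exE conjE) (rule that)
  define p where "p = (\<Sum>a\<le>card B. Polynomial.monom (of_rat (c a) :: complex) a)"
  have coeff: "Polynomial.coeff p i = (if i \<le> card B then of_rat (c i) else 0)" for i
  proof -
    have "Polynomial.coeff p i = (\<Sum>a\<le>card B. if a = i then of_rat (c i) else 0)"
      unfolding p_def coeff_sum by (rule sum.cong) simp_all
    thus ?thesis by simp
  qed
  have "p \<noteq> 0"
  proof
    assume "p = 0"
    obtain a where "a \<le> card B" "c a \<noteq> 0" using c(1) by auto
    thus False using coeff[of a] \<open>p = 0\<close> by simp
  qed
  moreover have "p \<in> polys \<rat>" by (simp add: polys_def coeff)
  moreover have "poly p x = 0"
  proof -
    have "poly p x = (\<Sum>a\<le>card B. of_rat (c a) * (\<Sum>b\<in>B. of_rat (q a b) * v b))"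
      unfolding assms(2)[symmetric] by (simp add: p_def poly_sum poly_monom)
    also have "\<dots> = (\<Sum>b\<in>B. \<Sum>a\<le>card B. of_rat (c a * q a b) * v b)"
      unfolding sum_distrib_left by (subst sum.swap) (simp add: of_rat_mult mult.assoc)
    also have "\<dots> = (\<Sum>b\<in>B. of_rat (\<Sum>a\<le>card B. c a * q a b) * v b)"
      by (simp add: of_rat_sum sum_distrib_right)
    also have "\<dots> = 0" using c(2) by (intro sum.neutral) simp
    finally show ?thesis .
  qed
  ultimately show ?thesis unfolding algebraic_polys by blast
qed

text \<open>By the binomial theorem and \<open>power_reduce\<close>, all powers lie in the rational
  span of finitely many products \<open>\<alpha> ^ i * \<beta> ^ l\<close>.\<close>

lemma algebraic_add_nat_mult:
  fixes \<alpha> \<beta> :: complex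
  assumes "algebraic \<alpha>" "algebraic \<beta>"
  shows "algebraic (\<alpha> + of_nat t * \<beta>)"
proof -
  from power_reduce[OF assms(1)] obtain n R where R: "\<And>k. \<alpha> ^ k = (\<Sum>i<n. of_rat (R k i) * \<alpha> ^ i)" by auto
  from power_reduce[OF assms(2)] obtain m S where S: "\<And>k. \<beta> ^ k = (\<Sum>i<m. of_rat (S k i) * \<beta> ^ i)" by auto
  define B where "B = {..<n} \<times> {..<m}"
  define v where "v = (\<lambda>(i, l). \<alpha> ^ i * \<beta> ^ l)"
  define q where "q k = (\<lambda>(i, l). \<Sum>j\<le>k. of_nat (k choose j) * of_nat t ^ (k - j) * R j i * S (k - j) l)" for k
  have "(\<alpha> + of_nat t * \<beta>) ^ k = (\<Sum>b\<in>B. of_rat (q k b) * v b)" for k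
  proof -
    have "(\<alpha> + of_nat t * \<beta>) ^ k = (\<Sum>j\<le>k. of_nat (k choose j) * \<alpha> ^ j * (of_nat t * \<beta>) ^ (k - j))"
      by (rule binomial_ring)
    also have "\<dots> = (\<Sum>j\<le>k. of_nat (k choose j) * of_nat t ^ (k - j) * (\<alpha> ^ j * \<beta> ^ (k - j)))"
      by (simp add: power_mult_distrib mult_ac)
    also have "\<dots> = (\<Sum>j\<le>k. \<Sum>b\<in>B. of_rat (of_nat (k choose j) * of_nat t ^ (k - j) * R j (fst b) * S (k - j) (snd b)) * v b)"
    proof (rule sum.cong[OF refl])
      fix j
      have "\<alpha> ^ j * \<beta> ^ (k - j) = (\<Sum>i<n. of_rat (R j i) * \<alpha> ^ i) * (\<Sum>l<m. of_rat (S (k - j) l) * \<beta> ^ l)"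
        by (simp only: R[of j, symmetric] S[of "k - j", symmetric])
      also have "\<dots> = (\<Sum>b\<in>B. of_rat (R j (fst b) * S (k - j) (snd b)) * v b)"
        unfolding sum_product sum.cartesian_product B_def v_def
        by (rule sum.cong) (auto simp: of_rat_mult)
      finally show "of_nat (k choose j) * of_nat t ^ (k - j) * (\<alpha> ^ j * \<beta> ^ (k - j)) =
        (\<Sum>b\<in>B. of_rat (of_nat (k choose j) * of_nat t ^ (k - j) * R j (fst b) * S (k - j) (snd b)) * v b)"
        by (simp add: sum_distrib_left of_rat_mult of_rat_power mult.assoc)
    qed
    also have "\<dots> = (\<Sum>b\<in>B. of_rat (q k b) * v b)"
      by (subst sum.swap) (simp add: q_def of_rat_sum sum_distrib_right case_prod_unfold)
    finally show ?thesis .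
  qed
  thus ?thesis by (intro algebraic_if_powers_in_span[of B _ q v]) (auto simp: B_def)
qed

text \<open>For \<gamma> = \<alpha> + t \<beta> with suitable \<open>t\<close>, the polynomial
  \<open>g\<close> and \<open>f\<close> composed with \<gamma> - t X have only \<beta> as a common
  root. The minimal polynomial of \<beta> over the field of \<gamma> divides both and is squarefree,
  hence linear, so \<beta> lies in that field.\<close>

lemma primitive_element_pair:
  fixes \<alpha> \<beta> :: complex
  assumes "algebraic \<alpha>" "algebraic \<beta>"
  shows "\<exists>\<gamma>. algebraic \<gamma> \<and> \<alpha> \<in> adjoin \<rat> \<gamma> \<and> \<beta> \<in> adjoin \<rat> \<gamma>"
proof -
  obtain f where f: "is_minpoly \<rat> f \<alpha>" using algebraic_minpoly[OF assms(1)] ..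
  obtain g where g: "is_minpoly \<rat> g \<beta>" using algebraic_minpoly[OF assms(2)] ..
  have f': "f \<in> polys \<rat>" "f \<noteq> 0" "poly f \<alpha> = 0" using f by (auto simp: is_minpoly_def[OF csubfield_Rats])
  have g': "g \<in> polys \<rat>" "g \<noteq> 0" "poly g \<beta> = 0" using g by (auto simp: is_minpoly_def[OF csubfield_Rats])
  \<comment> \<open>The values of \<open>t\<close> for which another conjugate of \<beta> could be a
    common root. Pairs with \<open>b = \<beta>\<close> only contribute \<open>0\<close>, by the
    convention on division by zero; what matters is that the set is finite.\<close>
  define S where "S = (\<lambda>(a, b). (a - \<alpha>) / (\<beta> - b)) ` ({z. poly f z = 0} \<times> {z. poly g z = 0})"
  have "finite S" unfolding S_def using f'(2) g'(2) by (intro finite_imageI finite_cartesian_product poly_roots_finite)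
  moreover have "infinite (range (of_nat :: nat \<Rightarrow> complex))" by (rule range_inj_infinite) (simp add: inj_of_nat)
  ultimately have "\<not> range (of_nat :: nat \<Rightarrow> complex) \<subseteq> S" using finite_subset by blast
  then obtain t :: nat where t: "of_nat t \<notin> S" by auto
  define \<gamma> where "\<gamma> = \<alpha> + of_nat t * \<beta>"
  have alg: "algebraic \<gamma>" unfolding \<gamma>_def by (rule algebraic_add_nat_mult[OF assms])
  obtain e where e: "is_minpoly \<rat> e \<gamma>" using algebraic_minpoly[OF alg] ..
  define L where "L = adjoin \<rat> \<gamma>"
  have L: "csubfield L" unfolding L_def by (rule csubfield_adjoin[OF csubfield_Rats e])
  have QL: "\<rat> \<subseteq> L" by (rule Rats_subset_csubfield[OF L])
  have \<gamma>L: "\<gamma> \<in> L" unfolding L_def by (rule adjoin_base[OF csubfield_Rats])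
  have polysL: "p \<in> polys L" if "p \<in> polys \<rat>" for p using that QL by (auto simp: polys_def)
  define h where "h = pcompose f [:\<gamma>, - of_nat t:]"
  have "[:\<gamma>, - of_nat t:] \<in> polys L"
    by (simp add: polys_pCons[OF L] polys_0[OF L] \<gamma>L csubfieldD[OF L] csubfield_of_nat[OF L])
  hence h: "h \<in> polys L" unfolding h_def by (rule polys_pcompose[OF L polysL[OF f'(1)]])
  have h\<beta>: "poly h \<beta> = 0" using f'(3) by (simp add: h_def poly_pcompose \<gamma>_def mult.commute)
  obtain p where p: "is_minpoly L p \<beta>" using minpoly_exists[OF L polysL[OF g'(1)] g'(2,3)] ..
  have p': "p \<in> polys L" "p \<noteq> 0" "poly p \<beta> = 0" using p by (auto simp: is_minpoly_def[OF L])
  have roots: "{z. poly p z = 0} = {\<beta>}"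
  proof -
    have "z = \<beta>" if z: "poly p z = 0" for z
    proof (rule ccontr)
      assume "z \<noteq> \<beta>"
      obtain s where "g = p * s" using minpoly_dvd[OF L p polysL[OF g'(1)] g'(3)] by auto
      hence gz: "poly g z = 0" using z by simp
      obtain s' where "h = p * s'" using minpoly_dvd[OF L p h h\<beta>] by auto
      hence hz: "poly h z = 0" using z by simp
      hence fz: "poly f (\<gamma> - of_nat t * z) = 0" by (simp add: h_def poly_pcompose mult.commute)
      have "(\<gamma> - of_nat t * z - \<alpha>) / (\<beta> - z) = of_nat t" using \<open>z \<noteq> \<beta>\<close> by (simp add: \<gamma>_def field_simps)
      moreover have "(\<gamma> - of_nat t * z - \<alpha>) / (\<beta> - z) \<in> S"
        unfolding S_def by (rule rev_image_eqI[of "(\<gamma> - of_nat t * z, z)"]) (use fz gz in auto)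
      ultimately show False using t by simp
    qed
    thus ?thesis using p'(3) by blast
  qed
  have "(\<Prod>z | poly p z = 0. [:- z, 1:]) = [:- \<beta>, 1:]" unfolding roots by simp
  hence "Polynomial.smult (Polynomial.lead_coeff p) [:- \<beta>, 1:] = p"
    using complex_poly_decompose_rsquarefree[OF minpoly_rsquarefree[OF L p]] by (simp only:)
  hence "p = Polynomial.smult (Polynomial.lead_coeff p) [:- \<beta>, 1:]" by (rule sym)
  hence "Polynomial.coeff p 0 = Polynomial.coeff (Polynomial.smult (Polynomial.lead_coeff p) [:- \<beta>, 1:]) 0"
    by (rule arg_cong)
  also have "\<dots> = - Polynomial.lead_coeff p * \<beta>" by simp
  finally have "Polynomial.coeff p 0 = - Polynomial.lead_coeff p * \<beta>" .
  hence "\<beta> = - Polynomial.coeff p 0 / Polynomial.lead_coeff p" using p'(2) by (simp add: field_simps)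
  also have "\<dots> \<in> L" by (intro csubfieldD[OF L]) (use p'(1) in \<open>auto simp: polys_def\<close>)
  finally have \<beta>: "\<beta> \<in> L" .
  have "\<alpha> = \<gamma> - of_nat t * \<beta>" by (simp add: \<gamma>_def)
  also have "\<dots> \<in> L" by (intro csubfieldD[OF L] \<gamma>L \<beta> csubfield_of_nat[OF L])
  finally have "\<alpha> \<in> L" .
  thus ?thesis using \<beta> alg unfolding L_def by (intro exI[of _ \<gamma>] conjI)
qed

theorem primitive_element:
  fixes A :: "complex set"
  assumes "finite A" "\<And>a. a \<in> A \<Longrightarrow> algebraic a"
  shows "\<exists>\<theta>. algebraic \<theta> \<and> A \<subseteq> adjoin \<rat> \<theta>"
  using assms
proof (induction A rule: finite_induct)
  case empty
  have "algebraic (0 :: complex)" by (rule algebraic_int_imp_algebraic) simp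
  thus ?case by blast
next
  case (insert a A)
  then obtain \<theta> where \<theta>: "algebraic \<theta>" "A \<subseteq> adjoin \<rat> \<theta>" by auto
  obtain \<gamma> where \<gamma>: "algebraic \<gamma>" "a \<in> adjoin \<rat> \<gamma>" "\<theta> \<in> adjoin \<rat> \<gamma>"
    using primitive_element_pair[of a \<theta>] insert.prems \<theta>(1) by auto
  obtain e where e: "is_minpoly \<rat> e \<gamma>" using algebraic_minpoly[OF \<gamma>(1)] ..
  have "csubfield (adjoin \<rat> \<gamma>)" by (rule csubfield_adjoin[OF csubfield_Rats e])
  hence "adjoin \<rat> \<theta> \<subseteq> adjoin \<rat> \<gamma>"
    by (intro adjoin_minimal[OF csubfield_Rats] Rats_subset_csubfield \<gamma>(3))
  hence "insert a A \<subseteq> adjoin \<rat> \<gamma>" using \<gamma>(2) \<theta>(2) by auto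
  thus ?case using \<gamma>(1) by (intro exI[of _ \<gamma>] conjI)
qed

section \<open>Embeddings of a number field\<close>

lemma field_complex_ring: "Ring.field complex_ring"
  by (rule field_from_type_algebra)

lemma complex_ring_simps [simp]:
  "carrier complex_ring = UNIV" "x \<otimes>\<^bsub>complex_ring\<^esub> y = x * y" "x \<oplus>\<^bsub>complex_ring\<^esub> y = x + y"
  "\<one>\<^bsub>complex_ring\<^esub> = 1" "\<zero>\<^bsub>complex_ring\<^esub> = 0"
  by (simp_all add: ring_of_type_algebra_def)

lemma subfield_complex_ring:
  assumes "csubfield L"
  shows "subfield L complex_ring"
proof -
  interpret cf: Ring.field complex_ring by (rule field_complex_ring)
  have minus: "\<ominus>\<^bsub>complex_ring\<^esub> x = - x" for x by (rule cf.minus_equality) simp_all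
  have inv: "inv\<^bsub>complex_ring\<^esub> x = inverse x" if "x \<noteq> 0" for x
    by (rule cf.inv_char) (use that in simp_all)
  show ?thesis
    by (rule cf.subfieldI'[OF cf.subringI]) (simp_all add: minus inv csubfieldD[OF assms])
qed

lemma csubfield_of_subfield:
  assumes "subfield L complex_ring"
  shows "csubfield L"
proof -
  interpret cf: Ring.field complex_ring by (rule field_complex_ring)
  have minus: "\<ominus>\<^bsub>complex_ring\<^esub> x = - x" for x by (rule cf.minus_equality) simp_all
  have inv: "inv\<^bsub>complex_ring\<^esub> x = inverse x" if "x \<noteq> 0" for x
    by (rule cf.inv_char) (use that in simp_all)
  have "inverse x \<in> L" if "x \<in> L" for x
    using cf.subfield_m_inv(1)[OF assms, of x] that inv[of x] subringE(2)[OF subfieldE(1)[OF assms]] by (cases "x = 0") auto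
  thus ?thesis
    using subringE(2,3,5,6,7)[OF subfieldE(1)[OF assms]] unfolding csubfield_def minus by auto
qed

lemma adjoin_number_field:
  assumes f: "is_minpoly \<rat> f \<theta>"
  shows "number_field (adjoin \<rat> \<theta>)"
proof -
  interpret cf: Ring.field complex_ring by (rule field_complex_ring)
  let ?K = "adjoin \<rat> \<theta>"
  have K: "csubfield ?K" by (rule csubfield_adjoin[OF csubfield_Rats f])
  have Q: "subfield \<rat> complex_ring" by (rule subfield_complex_ring[OF csubfield_Rats])
  have f': "f \<in> polys \<rat>" "f \<noteq> 0" "poly f \<theta> = 0" using f by (auto simp: is_minpoly_def[OF csubfield_Rats])
  \<comment> \<open>The list is reversed so that \<open>U (Suc m)\<close> has
    \<open>\<theta> ^ m\<close> at its head, which is where \<open>Span\<close> extends.\<close>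
  define U where "U m = map (\<lambda>i. \<theta> ^ i) (rev [0..<m])" for m
  have Span: "cf.Span \<rat> (U m) = {\<Sum>i<m. c i * \<theta> ^ i | c. \<forall>i. c i \<in> \<rat>}" for m
  proof (induction m)
    case 0
    have "\<exists>c :: nat \<Rightarrow> complex. \<forall>i. c i \<in> \<rat>" by (rule exI[of _ "\<lambda>_. 0"]) simp
    thus ?case by (simp add: U_def)
  next
    case (Suc m)
    have *: "cf.Span \<rat> (U (Suc m)) = cf.line_extension \<rat> (\<theta> ^ m) (cf.Span \<rat> (U m))" by (simp add: U_def)
    show ?case unfolding * Suc.IH
    proof (intro equalityI subsetI)
      fix x assume "x \<in> cf.line_extension \<rat> (\<theta> ^ m) {\<Sum>i<m. c i * \<theta> ^ i | c. \<forall>i. c i \<in> \<rat>}"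
      then obtain k c where kc: "k \<in> \<rat>" "\<forall>i. c i \<in> \<rat>" "x = k * \<theta> ^ m + (\<Sum>i<m. c i * \<theta> ^ i)"
        unfolding cf.line_extension_mem_iff by auto
      have "(\<Sum>i<m. (c(m := k)) i * \<theta> ^ i) = (\<Sum>i<m. c i * \<theta> ^ i)" by (rule sum.cong) auto
      hence "x = (\<Sum>i<Suc m. (c(m := k)) i * \<theta> ^ i)" using kc(3) by simp
      moreover have "\<forall>i. (c(m := k)) i \<in> \<rat>" using kc by simp
      ultimately show "x \<in> {\<Sum>i<Suc m. c i * \<theta> ^ i | c. \<forall>i. c i \<in> \<rat>}" by (intro CollectI exI conjI)
    next
      fix x assume "x \<in> {\<Sum>i<Suc m. c i * \<theta> ^ i | c. \<forall>i. c i \<in> \<rat>}"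
      then obtain c where c: "\<forall>i. c i \<in> \<rat>" "x = (\<Sum>i<Suc m. c i * \<theta> ^ i)" by auto
      show "x \<in> cf.line_extension \<rat> (\<theta> ^ m) {\<Sum>i<m. c i * \<theta> ^ i | c. \<forall>i. c i \<in> \<rat>}"
        unfolding cf.line_extension_mem_iff
      proof (intro bexI)
        show "x = c m \<otimes>\<^bsub>complex_ring\<^esub> \<theta> ^ m \<oplus>\<^bsub>complex_ring\<^esub> (\<Sum>i<m. c i * \<theta> ^ i)" using c(2) by simp
        show "(\<Sum>i<m. c i * \<theta> ^ i) \<in> {\<Sum>i<m. c i * \<theta> ^ i | c. \<forall>i. c i \<in> \<rat>}" using c(1) by auto
      qed (use c(1) in simp)
    qed
  qed
  have "?K = cf.Span \<rat> (U (Polynomial.degree f))"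
    unfolding Span
  proof (intro equalityI subsetI)
    fix x assume "x \<in> ?K"
    then obtain g where g: "g \<in> polys \<rat>" "x = poly g \<theta>" by (auto simp: adjoin_def[OF csubfield_Rats])
    from polys_div[OF csubfield_Rats f'(1,2) g(1)] obtain s r where sr: "s \<in> polys \<rat>" "r \<in> polys \<rat>" "g = f * s + r"
      "r = 0 \<or> Polynomial.degree r < Polynomial.degree f" by auto
    have "x = poly r \<theta>" using sr(3) g(2) f'(3) by simp
    also have "\<dots> = (\<Sum>i\<le>Polynomial.degree r. Polynomial.coeff r i * \<theta> ^ i)" by (rule poly_altdef)
    also have "\<dots> = (\<Sum>i<Polynomial.degree f. Polynomial.coeff r i * \<theta> ^ i)"
    proof (cases "r = 0")
      case False
      hence "Polynomial.degree r < Polynomial.degree f" using sr(4) by simp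
      thus ?thesis by (intro sum.mono_neutral_left) (auto simp: coeff_eq_0)
    qed simp
    finally have "x = (\<Sum>i<Polynomial.degree f. Polynomial.coeff r i * \<theta> ^ i)" .
    moreover have "\<forall>i. Polynomial.coeff r i \<in> \<rat>" using sr(2) by (simp add: polys_def)
    ultimately show "x \<in> {\<Sum>i<Polynomial.degree f. c i * \<theta> ^ i | c. \<forall>i. c i \<in> \<rat>}" by (intro CollectI exI conjI)
  next
    fix x assume "x \<in> {\<Sum>i<Polynomial.degree f. c i * \<theta> ^ i | c. \<forall>i. c i \<in> \<rat>}"
    then obtain c where c: "\<forall>i. c i \<in> \<rat>" "x = (\<Sum>i<Polynomial.degree f. c i * \<theta> ^ i)" by auto
    show "x \<in> ?K" unfolding c(2)
    proof (rule csubfield_sum[OF K])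
      fix i
      have "c i \<in> ?K" using c(1) adjoin_base(1)[OF csubfield_Rats] by auto
      thus "c i * \<theta> ^ i \<in> ?K"
        by (intro csubfieldD(4)[OF K] csubfield_power[OF K] adjoin_base(2)[OF csubfield_Rats])
    qed
  qed
  hence "cf.finite_dimension \<rat> ?K" using cf.Span_finite_dimension[OF Q, of "U (Polynomial.degree f)"] by simp
  thus ?thesis unfolding number_field_def using subfield_complex_ring[OF K] by simp
qed

lemma field_degree_pos:
  assumes "number_field K"
  shows "field_degree K > 0"
proof (rule ccontr)
  interpret cf: Ring.field complex_ring by (rule field_complex_ring)
  assume "\<not> field_degree K > 0"
  hence 0: "cf.dim \<rat> K = 0" by (simp add: field_degree_def)
  have Q: "subfield \<rat> complex_ring" by (rule subfield_complex_ring[OF csubfield_Rats])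
  have "cf.dimension ((cf.dim over \<rat>) K) \<rat> K"
    by (rule cf.finite_dimensionE[OF Q]) (use assms in \<open>simp add: number_field_def\<close>)
  hence "cf.dimension 0 \<rat> K" using 0 by (simp add: over_def)
  hence "K = {0}" using cf.dimension_zero[OF Q] by auto
  moreover have "1 \<in> K" using csubfield_of_subfield[of K] assms csubfieldD(2) by (simp add: number_field_def)
  ultimately show False by simp
qed

section \<open>Embeddings indexed by the roots of the minimal polynomial\<close>

locale number_field_generator =
  fixes \<theta> :: complex and f :: "complex Polynomial.poly"
  assumes f: "is_minpoly \<rat> f \<theta>"
begin

abbreviation "K \<equiv> adjoin \<rat> \<theta>"

definition roots :: "complex set" where "roots = {z. poly f z = 0}"

text \<open>For a root \<open>z\<close> of \<open>f\<close>, the field embedding that sends \<theta>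
  to \<open>z\<close>; \<open>emb_poly\<close> shows that the polynomial chosen for \<open>x\<close>
  does not matter.\<close>

definition emb :: "complex \<Rightarrow> complex \<Rightarrow> complex" where
  "emb z x = poly (SOME g. g \<in> polys \<rat> \<and> poly g \<theta> = x) z"

lemma csubfield_K: "csubfield K"
  by (rule csubfield_adjoin[OF csubfield_Rats f])

lemma K_cases:
  assumes "x \<in> K"
  obtains g where "g \<in> polys \<rat>" "x = poly g \<theta>"
  using assms by (auto simp: adjoin_def[OF csubfield_Rats])

lemma f_props: "f \<in> polys \<rat>" "f \<noteq> 0" "poly f \<theta> = 0"
  using f by (auto simp: is_minpoly_def[OF csubfield_Rats])

lemma finite_roots: "finite roots"
  unfolding roots_def by (rule poly_roots_finite[OF f_props(2)])

lemma theta_root: "\<theta> \<in> roots"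
  using f_props by (simp add: roots_def)

lemma card_roots: "card roots = Polynomial.degree f"
proof -
  have "Polynomial.degree (\<Prod>z\<in>roots. [:- z, 1:]) = (\<Sum>z\<in>roots. Polynomial.degree [:- z, 1:])"
    by (rule degree_prod_sum_eq) simp
  hence "Polynomial.degree (Polynomial.smult (Polynomial.lead_coeff f) (\<Prod>z\<in>roots. [:- z, 1:])) = card roots"
    using f_props(2) by simp
  thus ?thesis
    using complex_poly_decompose_rsquarefree[OF minpoly_rsquarefree[OF csubfield_Rats f]]
    unfolding roots_def by (simp only:)
qed

text \<open>All roots of \<open>f\<close> have \<open>f\<close> as minimal polynomial, so
  \<open>f\<close> divides \<open>g\<close> as soon as \<open>g\<close> vanishes at one of them.
  This makes \<open>emb z\<close> well defined and injective.\<close>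

lemma vanish_iff:
  assumes "z \<in> roots" "g \<in> polys \<rat>"
  shows "poly g z = 0 \<longleftrightarrow> poly g \<theta> = 0"
proof
  assume "poly g z = 0"
  moreover have "is_minpoly \<rat> f z"
    using minpoly_conjugate[OF csubfield_Rats f] assms(1) by (simp add: roots_def)
  ultimately obtain s where "g = f * s" using minpoly_dvd[OF csubfield_Rats _ assms(2)] by auto
  thus "poly g \<theta> = 0" using f_props(3) by simp
next
  assume "poly g \<theta> = 0"
  then obtain s where "g = f * s" using minpoly_dvd[OF csubfield_Rats f assms(2)] by auto
  thus "poly g z = 0" using assms(1) by (simp add: roots_def)
qed

lemma emb_poly:
  assumes "z \<in> roots" "g \<in> polys \<rat>"
  shows "emb z (poly g \<theta>) = poly g z"
proof -
  define h where "h = (SOME h. h \<in> polys \<rat> \<and> poly h \<theta> = poly g \<theta>)"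
  have h: "h \<in> polys \<rat> \<and> poly h \<theta> = poly g \<theta>"
    unfolding h_def by (rule someI[of _ g]) (use assms in simp)
  have "poly (h - g) \<theta> = 0" using h by simp
  moreover have "h - g \<in> polys \<rat>" using h assms(2) by (intro polys_diff csubfield_Rats) simp_all
  ultimately have "poly (h - g) z = 0" using vanish_iff[OF assms(1)] by blast
  thus ?thesis by (simp add: emb_def h_def)
qed

lemma emb_add: "z \<in> roots \<Longrightarrow> x \<in> K \<Longrightarrow> y \<in> K \<Longrightarrow> emb z (x + y) = emb z x + emb z y"
  by (elim K_cases) (simp add: emb_poly polys_add[OF csubfield_Rats] flip: poly_add)

lemma emb_mult: "z \<in> roots \<Longrightarrow> x \<in> K \<Longrightarrow> y \<in> K \<Longrightarrow> emb z (x * y) = emb z x * emb z y"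
  by (elim K_cases) (simp add: emb_poly polys_mult[OF csubfield_Rats] flip: poly_mult)

lemma emb_rat: "z \<in> roots \<Longrightarrow> q \<in> \<rat> \<Longrightarrow> emb z q = q"
  using emb_poly[of z "[:q:]"] polys_const[OF csubfield_Rats] by simp

lemma emb_0: "z \<in> roots \<Longrightarrow> emb z 0 = 0" by (simp add: emb_rat)
lemma emb_1: "z \<in> roots \<Longrightarrow> emb z 1 = 1" by (simp add: emb_rat)

lemma emb_theta: "z \<in> roots \<Longrightarrow> emb z \<theta> = z"
  using emb_poly[of z "[:0, 1:]"] polys_pCons[OF csubfield_Rats] polys_0[OF csubfield_Rats] by simp

lemma emb_eq_0_iff: "z \<in> roots \<Longrightarrow> x \<in> K \<Longrightarrow> emb z x = 0 \<longleftrightarrow> x = 0"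
  by (elim K_cases) (simp add: emb_poly vanish_iff)

lemma K_closed:
  "0 \<in> K" "1 \<in> K" "x \<in> K \<Longrightarrow> y \<in> K \<Longrightarrow> x + y \<in> K" "x \<in> K \<Longrightarrow> y \<in> K \<Longrightarrow> x * y \<in> K"
  "x \<in> K \<Longrightarrow> - x \<in> K" "x \<in> K \<Longrightarrow> inverse x \<in> K" "x \<in> K \<Longrightarrow> y \<in> K \<Longrightarrow> x - y \<in> K" "x \<in> K \<Longrightarrow> y \<in> K \<Longrightarrow> x / y \<in> K"
  by (rule csubfieldD[OF csubfield_K]; assumption)+

lemma Rats_K: "q \<in> \<rat> \<Longrightarrow> q \<in> K"
  using Rats_subset_csubfield[OF csubfield_K] by blast

lemma emb_minus: "z \<in> roots \<Longrightarrow> x \<in> K \<Longrightarrow> emb z (- x) = - emb z x"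
  using emb_mult[of z "-1" x] emb_rat[of z "-1"] Rats_K[of "-1"] by simp

lemma emb_diff: "z \<in> roots \<Longrightarrow> x \<in> K \<Longrightarrow> y \<in> K \<Longrightarrow> emb z (x - y) = emb z x - emb z y"
  using emb_add[of z x "- y"] emb_minus[of z y] K_closed(5)[of y] by simp

lemma emb_power: "z \<in> roots \<Longrightarrow> x \<in> K \<Longrightarrow> emb z (x ^ n) = emb z x ^ n"
  by (induction n) (simp_all add: emb_1 emb_mult csubfield_power[OF csubfield_K])

lemma emb_sum: "z \<in> roots \<Longrightarrow> (\<And>i. i \<in> I \<Longrightarrow> h i \<in> K) \<Longrightarrow> emb z (sum h I) = (\<Sum>i\<in>I. emb z (h i))"
  by (induction I rule: infinite_finite_induct) (simp_all add: emb_0 emb_add csubfield_sum[OF csubfield_K])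

text \<open>Lagrange interpolation bounds the rational coordinates of \<open>x\<close> with respect to the powers of
  \<open>\<theta>\<close> by its conjugates.\<close>

lemma coordinates_bound:
  "\<exists>C. \<forall>x\<in>K. \<forall>B. (\<forall>z\<in>roots. cmod (emb z x) \<le> B) \<longrightarrow>
     (\<exists>c. (\<forall>i. c i \<in> \<rat> \<and> cmod (c i) \<le> C * B) \<and> x = (\<Sum>i<Polynomial.degree f. c i * \<theta> ^ i))"
proof -
  define n where "n = Polynomial.degree f"
  \<comment> \<open>The Lagrange basis polynomials for the nodes \<open>roots\<close>. Their
    coefficients depend on \<open>f\<close> only and supply the constant \<open>C\<close>.\<close>
  define lag where "lag z = Polynomial.smult (inverse (\<Prod>s\<in>roots - {z}. z - s)) (\<Prod>s\<in>roots - {z}. [:- s, 1:])" for z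
  have lag_eval: "poly (lag z) s = (if s = z then 1 else 0)" if "z \<in> roots" "s \<in> roots" for z s
    using that finite_roots by (auto simp: lag_def poly_prod)
  have lag_deg: "Polynomial.degree (lag z) < n" if "z \<in> roots" for z
  proof -
    have "Polynomial.degree (\<Prod>s\<in>roots - {z}. [:- s, 1:]) = (\<Sum>s\<in>roots - {z}. Polynomial.degree [:- s, 1:])"
      by (rule degree_prod_sum_eq) simp
    hence "Polynomial.degree (lag z) \<le> card (roots - {z})"
      unfolding lag_def using degree_smult_le order_trans by force
    also have "\<dots> < card roots" using that finite_roots by (intro psubset_card_mono) auto
    finally show ?thesis by (simp add: card_roots n_def)
  qed
  define C where "C = (\<Sum>i<n. \<Sum>z\<in>roots. cmod (Polynomial.coeff (lag z) i))"
  have C0: "C \<ge> 0" unfolding C_def by (intro sum_nonneg) simp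
  have "\<exists>c. (\<forall>i. c i \<in> \<rat> \<and> cmod (c i) \<le> C * B) \<and> x = (\<Sum>i<n. c i * \<theta> ^ i)"
    if x: "x \<in> K" and B: "\<forall>z\<in>roots. cmod (emb z x) \<le> B" for x B
  proof -
    have B0: "B \<ge> 0" using B theta_root norm_ge_zero order_trans by blast
    obtain g where g: "g \<in> polys \<rat>" "x = poly g \<theta>" using x by (rule K_cases)
    from polys_div[OF csubfield_Rats f_props(1,2) g(1)] obtain s r where sr: "s \<in> polys \<rat>" "r \<in> polys \<rat>" "g = f * s + r"
      "r = 0 \<or> Polynomial.degree r < Polynomial.degree f" by auto
    have xr: "x = poly r \<theta>" using sr(3) g(2) f_props(3) by simp
    have n0: "n > 0" unfolding n_def by (rule minpoly_degree_pos[OF csubfield_Rats f])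
    have rdeg: "Polynomial.degree r < n" using sr(4) n0 by (auto simp: n_def)
    define L where "L = (\<Sum>z\<in>roots. Polynomial.smult (emb z x) (lag z))"
    have Ldeg: "Polynomial.degree L < n"
      unfolding L_def using n0 lag_deg by (intro degree_sum_less) (auto intro: le_less_trans[OF degree_smult_le])
    have eval: "poly L s = poly r s" if "s \<in> roots" for s
    proof -
      have "poly L s = (\<Sum>z\<in>roots. if z = s then emb s x else 0)"
        unfolding L_def poly_sum by (rule sum.cong) (use lag_eval that in auto)
      also have "\<dots> = emb s x" using finite_roots that by simp
      also have "\<dots> = poly r s" unfolding xr by (rule emb_poly[OF that sr(2)])
      finally show ?thesis .
    qed
    \<comment> \<open>Both have degree less than \<open>n\<close> and agree at the \<open>n\<close>
      roots.\<close>
    have "L = r"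
    proof (rule ccontr)
      assume "L \<noteq> r"
      hence nz: "L - r \<noteq> 0" by simp
      have "roots \<subseteq> {z. poly (L - r) z = 0}" using eval by auto
      hence "card roots \<le> card {z. poly (L - r) z = 0}" by (intro card_mono poly_roots_finite nz)
      also have "\<dots> \<le> Polynomial.degree (L - r)" by (rule card_poly_roots_bound[OF nz])
      also have "\<dots> < n" by (rule degree_diff_less[OF Ldeg rdeg])
      finally show False by (simp add: card_roots n_def)
    qed
    have bound: "cmod (Polynomial.coeff r i) \<le> C * B" for i
    proof (cases "i < n")
      case True
      have "cmod (Polynomial.coeff r i) \<le> (\<Sum>z\<in>roots. cmod (emb z x * Polynomial.coeff (lag z) i))"
        unfolding \<open>L = r\<close>[symmetric] L_def coeff_sum coeff_smult by (rule norm_sum)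
      also have "\<dots> \<le> (\<Sum>z\<in>roots. B * cmod (Polynomial.coeff (lag z) i))"
        unfolding norm_mult by (intro sum_mono mult_right_mono) (use B in auto)
      also have "\<dots> = (\<Sum>z\<in>roots. cmod (Polynomial.coeff (lag z) i)) * B" by (simp add: sum_distrib_left mult.commute)
      also have "\<dots> \<le> C * B" unfolding C_def
        by (intro mult_right_mono member_le_sum[of i _ "\<lambda>i. \<Sum>z\<in>roots. cmod (Polynomial.coeff (lag z) i)"])
           (use True B0 in \<open>auto intro: sum_nonneg\<close>)
      finally show ?thesis .
    next
      case False
      hence "Polynomial.coeff r i = 0" using rdeg by (intro coeff_eq_0) simp
      thus ?thesis using C0 B0 by simp
    qed
    have "x = (\<Sum>i\<le>Polynomial.degree r. Polynomial.coeff r i * \<theta> ^ i)" unfolding xr by (rule poly_altdef)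
    also have "\<dots> = (\<Sum>i<n. Polynomial.coeff r i * \<theta> ^ i)"
      by (rule sum.mono_neutral_left) (use rdeg in \<open>auto simp: coeff_eq_0\<close>)
    finally have "x = (\<Sum>i<n. Polynomial.coeff r i * \<theta> ^ i)" .
    thus ?thesis using bound sr(2) by (intro exI[of _ "Polynomial.coeff r"]) (simp add: polys_def)
  qed
  thus ?thesis unfolding n_def by (intro exI[of _ C]) simp
qed

end

section \<open>Archimedean places\<close>

lemma absolute_valueD:
  assumes "absolute_value K w"
  shows "x \<in> K \<Longrightarrow> w x \<ge> 0" "x \<in> K \<Longrightarrow> w x = 0 \<longleftrightarrow> x = 0"
    "x \<in> K \<Longrightarrow> y \<in> K \<Longrightarrow> w (x * y) = w x * w y" "x \<in> K \<Longrightarrow> y \<in> K \<Longrightarrow> w (x + y) \<le> w x + w y"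
  using assms unfolding absolute_value_def by blast+

context
  fixes K w assumes K: "csubfield K" and w: "absolute_value K w"
begin

lemma absval_0: "w 0 = 0"
  using absolute_valueD(2)[OF w csubfieldD(1)[OF K]] by simp

lemma absval_1: "w 1 = 1"
proof -
  have "w 1 * w 1 = w 1" using absolute_valueD(3)[OF w csubfieldD(2,2)[OF K]] by simp
  moreover have "w 1 \<noteq> 0" using absolute_valueD(2)[OF w csubfieldD(2)[OF K]] by simp
  ultimately show ?thesis by simp
qed

lemma absval_power: "x \<in> K \<Longrightarrow> w (x ^ n) = w x ^ n"
  by (induction n) (simp_all add: absval_1 absolute_valueD(3)[OF w] csubfield_power[OF K])

lemma absval_inverse:
  assumes "x \<in> K"
  shows "w (inverse x) = inverse (w x)"
proof (cases "x = 0")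
  case False
  have "w x * w (inverse x) = 1"
    using absolute_valueD(3)[OF w assms csubfieldD(6)[OF K assms]] absval_1 False by simp
  thus ?thesis by (simp add: inverse_unique)
qed (simp add: absval_0)

lemma absval_divide: "x \<in> K \<Longrightarrow> y \<in> K \<Longrightarrow> w (x / y) = w x / w y"
  using absolute_valueD(3)[OF w, of x "inverse y"] csubfieldD(6)[OF K] by (simp add: absval_inverse divide_inverse)

lemma absval_minus:
  assumes "x \<in> K"
  shows "w (- x) = w x"
proof -
  have m1: "-1 \<in> K" using csubfieldD(2,5)[OF K] by blast
  have "w (-1) * w (-1) = 1" using absolute_valueD(3)[OF w m1 m1] absval_1 by simp
  moreover have "w (-1) \<ge> 0" using absolute_valueD(1)[OF w m1] .
  ultimately have "w (-1) = 1" using power2_eq_1_iff[of "w (-1)"] by (simp add: power2_eq_square)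
  thus ?thesis using absolute_valueD(3)[OF w m1 assms] by simp
qed

lemma absval_sum: "(\<And>i. i \<in> I \<Longrightarrow> h i \<in> K) \<Longrightarrow> w (sum h I) \<le> (\<Sum>i\<in>I. w (h i))"
proof (induction I rule: infinite_finite_induct)
  case (insert i I)
  have "w (h i + sum h I) \<le> w (h i) + w (sum h I)"
    by (intro absolute_valueD[OF w] csubfield_sum[OF K]) (use insert.prems in simp_all)
  also have "w (sum h I) \<le> (\<Sum>i\<in>I. w (h i))" by (rule insert.IH) (use insert.prems in simp)
  finally show ?case using insert.hyps by simp
qed (simp_all add: absval_0)

lemma absval_triangle_lower:
  assumes "x \<in> K" "y \<in> K"
  shows "w (x + y) \<ge> w x - w y"
proof -
  have "w ((x + y) + (- y)) \<le> w (x + y) + w (- y)"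
    by (intro absolute_valueD[OF w] csubfieldD[OF K] assms)
  thus ?thesis using absval_minus[OF assms(2)] by simp
qed

end

lemma cmod_of_rat: "cmod (of_rat q) = \<bar>of_rat q\<bar>"
  by (cases q) (simp add: of_rat_rat norm_divide)

text \<open>Since both absolute values are normalised on the rationals, an element on which they differ
  can be scaled to separate them.\<close>

lemma separate_absvals:
  assumes K: "csubfield K" and w: "absolute_value K w" and v: "absolute_value K v"
    and wq: "\<And>q::rat. w (of_rat q) = \<bar>of_rat q\<bar>" and vq: "\<And>q::rat. v (of_rat q) = \<bar>of_rat q\<bar>"
    and ne: "\<exists>x\<in>K. w x \<noteq> v x"
  shows "\<exists>y\<in>K. w y > 1 \<and> v y < 1"
proof -
  have sep: "\<exists>y\<in>K. w y > 1 \<and> v y < 1" if x: "x \<in> K" "v x < w x" for x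
  proof -
    obtain q where q: "v x < of_rat q" "of_rat q < w x" using of_rat_dense[OF x(2)] by blast
    have q0: "(of_rat q :: real) > 0" using q(1) absolute_valueD(1)[OF v x(1)] by linarith
    have qK: "of_rat q \<in> K" using Rats_subset_csubfield[OF K] by auto
    have "w (x / of_rat q) > 1" "v (x / of_rat q) < 1"
      using q q0 by (simp_all add: absval_divide[OF K w x(1) qK] absval_divide[OF K v x(1) qK] wq vq)
    thus ?thesis using csubfieldD(8)[OF K x(1) qK] by blast
  qed
  from ne obtain x where x: "x \<in> K" "w x \<noteq> v x" by blast
  show ?thesis
  proof (cases "v x < w x")
    case True
    thus ?thesis using sep x by blast
  next
    case False
    hence lt: "w x < v x" using x by simp
    hence "v x > 0" using absolute_valueD(1)[OF w x(1)] by linarith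
    hence "x \<noteq> 0" using absval_0[OF K v] by auto
    hence "w x > 0" using absolute_valueD(1,2)[OF w x(1)] by (simp add: order_less_le)
    hence "v (inverse x) < w (inverse x)" using lt by (simp add: absval_inverse[OF K] w v x(1))
    thus ?thesis using sep csubfieldD(6)[OF K x(1)] by blast
  qed
qed

text \<open>Let \<open>y\<close> separate \<open>w\<close> from \<open>V\<close>, and let
  \<open>x\<close> separate \<open>w\<close> from the new \<open>v\<close>. If
  \<open>v y \<le> 1\<close>, then \<open>y ^ k * x\<close> works for large \<open>k\<close>,
  because powers of \<open>y\<close> become small on \<open>V\<close> and do no harm at
  \<open>w\<close> and \<open>v\<close>. If \<open>v y > 1\<close>, the powers are replaced by a
  quotient that stays bounded there.\<close>

lemma artin_whaples_separation:
  assumes K: "csubfield K" and w: "absolute_value K w" and fin: "finite V"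
    and V: "\<And>v. v \<in> V \<Longrightarrow> absolute_value K v"
    and w2: "w 2 = 2"
    and sep: "\<And>v. v \<in> V \<Longrightarrow> \<exists>y\<in>K. w y > 1 \<and> v y < 1"
  shows "\<exists>y\<in>K. w y > 1 \<and> (\<forall>v\<in>V. v y < 1)"
  using fin V sep
proof (induction V rule: finite_induct)
  case empty
  have "2 \<in> K" using csubfield_of_nat[OF K, of 2] by simp
  thus ?case using w2 by (intro bexI[of _ 2]) simp_all
next
  case (insert v V)
  have av: "absolute_value K u" if "u \<in> insert v V" for u using insert.prems(1) that by blast
  have v: "absolute_value K v" using av by blast
  have "\<exists>y\<in>K. w y > 1 \<and> (\<forall>v\<in>V. v y < 1)"
    by (rule insert.IH) (use insert.prems in blast)+
  then obtain y where y: "y \<in> K" "w y > 1" "\<forall>u\<in>V. u y < 1" by blast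
  have "\<exists>y\<in>K. w y > 1 \<and> v y < 1" using insert.prems(2) by blast
  then obtain x where x: "x \<in> K" "w x > 1" "v x < 1" by blast
  have yk: "y ^ k \<in> K" for k by (rule csubfield_power[OF K y(1)])
  show ?case
  proof (cases "v y \<le> 1")
    case True
    have "\<forall>\<^sub>F k in sequentially. \<forall>u\<in>V. u y ^ k * u x < 1"
    proof (rule eventually_ball_finite[OF insert.hyps(1)], rule ballI)
      fix u assume u: "u \<in> V"
      have "0 \<le> u y" using absolute_valueD(1)[OF av y(1), of u] u by simp
      hence "(\<lambda>k. u y ^ k) \<longlonglongrightarrow> 0" using y(3) u by (intro LIMSEQ_realpow_zero) auto
      from tendsto_mult_left_zero[OF this, of "u x"] have "(\<lambda>k. u y ^ k * u x) \<longlonglongrightarrow> 0" .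
      thus "\<forall>\<^sub>F k in sequentially. u y ^ k * u x < 1" by (rule order_tendstoD) simp
    qed
    then obtain k where k: "\<forall>u\<in>V. u y ^ k * u x < 1" by (auto simp: eventually_sequentially)
    have val: "u (y ^ k * x) = u y ^ k * u x" if "absolute_value K u" for u
      by (simp add: absolute_valueD(3)[OF that yk x(1)] absval_power[OF K that y(1)])
    have "w y ^ k \<ge> 1" using y(2) by (simp add: one_le_power)
    hence "1 * w x \<le> w y ^ k * w x" by (rule mult_right_mono) (use x(2) in simp)
    hence "w (y ^ k * x) > 1" using x(2) unfolding val[OF w] by linarith
    moreover have "v y ^ k \<le> 1" using True absolute_valueD(1)[OF v y(1)] by (simp add: power_le_one)
    hence "v y ^ k * v x \<le> v x" using absolute_valueD(1)[OF v x(1)] by (simp add: mult_left_le_one_le absolute_valueD(1)[OF v y(1)])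
    hence "v (y ^ k * x) < 1" using x(3) by (simp add: val[OF v])
    moreover have "\<forall>u\<in>V. u (y ^ k * x) < 1" using k val av by simp
    ultimately show ?thesis using csubfieldD(4)[OF K yk x(1)] by (intro bexI[of _ "y ^ k * x"]) simp_all
  next
    case False
    \<comment> \<open>As \<open>k\<close> grows, \<open>t k\<close> behaves like \<open>1\<close> at
      \<open>w\<close> and \<open>v\<close>, where \<open>y\<close> is large, and like
      \<open>0\<close> on \<open>V\<close>, where \<open>y\<close> is small. So
      \<open>t k * x\<close> inherits the sizes of \<open>x\<close> at \<open>w\<close> and
      \<open>v\<close>.\<close>
    define t where "t k = y ^ k / (1 + y ^ k)" for k
    have t: "t k \<in> K" for k unfolding t_def by (intro csubfieldD[OF K] yk)
    have val: "u (t k * x) = u y ^ k / u (1 + y ^ k) * u x" if "absolute_value K u" for u k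
    proof -
      have "u (t k) = u y ^ k / u (1 + y ^ k)" unfolding t_def
        using absval_divide[OF K that yk csubfieldD(3)[OF K csubfieldD(2)[OF K] yk], of k k]
        by (simp add: absval_power[OF K that y(1)])
      thus ?thesis by (simp only: absolute_valueD(3)[OF that t x(1)])
    qed
    have ub: "u (1 + y ^ k) \<le> 1 + u y ^ k" if "absolute_value K u" for u k
      using absolute_valueD(4)[OF that csubfieldD(2)[OF K] yk[of k]] by (simp add: absval_1[OF K that] absval_power[OF K that y(1)])
    have lb1: "u (1 + y ^ k) \<ge> 1 - u y ^ k" if "absolute_value K u" for u k
      using absval_triangle_lower[OF K that csubfieldD(2)[OF K] yk[of k]] by (simp add: absval_1[OF K that] absval_power[OF K that y(1)])
    have lb2: "u (1 + y ^ k) \<ge> u y ^ k - 1" if "absolute_value K u" for u k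
      using absval_triangle_lower[OF K that yk[of k] csubfieldD(2)[OF K]] by (simp add: absval_1[OF K that] absval_power[OF K that y(1)] add.commute)
    have e1: "\<forall>\<^sub>F k in sequentially. w (t k * x) > 1"
    proof -
      have "(\<lambda>k. inverse (w y ^ k)) \<longlonglongrightarrow> 0" using y(2) by (intro LIMSEQ_inverse_realpow_zero)
      hence "(\<lambda>k. 1 / (inverse (w y ^ k) + 1) * w x) \<longlonglongrightarrow> 1 / (0 + 1) * w x" by (intro tendsto_intros) auto
      hence "\<forall>\<^sub>F k in sequentially. 1 / (inverse (w y ^ k) + 1) * w x > 1" using x(2) by (intro order_tendstoD) auto
      thus ?thesis
      proof eventually_elim
        case (elim k)
        have p: "w y ^ k > 0" using y(2) by simp
        have "1 / (inverse r + 1) = r / (1 + r)" if "r > 0" for r :: real using that by (simp add: field_simps)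
        from this[OF p] have "1 / (inverse (w y ^ k) + 1) = w y ^ k / (1 + w y ^ k)" .
        moreover have "w y ^ k / (1 + w y ^ k) \<le> w y ^ k / w (1 + y ^ k)" if "w (1 + y ^ k) > 0"
          using ub[OF w, of k] p that by (intro divide_left_mono) auto
        moreover have "w (1 + y ^ k) > 0"
        proof (cases k)
          case 0
          thus ?thesis using w2 by simp
        next
          case (Suc j)
          hence "w y ^ k > 1" using y(2) by (simp add: one_less_power del: power_Suc)
          thus ?thesis using lb2[OF w, of k] by linarith
        qed
        ultimately have "1 / (inverse (w y ^ k) + 1) * w x \<le> w y ^ k / w (1 + y ^ k) * w x"
          using x(2) by (intro mult_right_mono) simp_all
        thus ?case using elim by (simp add: val[OF w])
      qed
    qed
    have e2: "\<forall>\<^sub>F k in sequentially. v (t k * x) < 1"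
    proof -
      have vy: "v y > 1" using False by simp
      have "(\<lambda>k. inverse (v y ^ k)) \<longlonglongrightarrow> 0" using vy by (intro LIMSEQ_inverse_realpow_zero)
      hence "(\<lambda>k. 1 / (1 - inverse (v y ^ k)) * v x) \<longlonglongrightarrow> 1 / (1 - 0) * v x" by (intro tendsto_intros) auto
      hence "\<forall>\<^sub>F k in sequentially. 1 / (1 - inverse (v y ^ k)) * v x < 1" using x(3) by (intro order_tendstoD) auto
      thus ?thesis using eventually_gt_at_top[of 0]
      proof eventually_elim
        case (elim k)
        have p: "v y ^ k > 1" using vy elim(2) by (simp add: one_less_power)
        have "1 / (1 - inverse r) = r / (r - 1)" if "r > 1" for r :: real using that by (simp add: field_simps)
        from this[OF p] have "1 / (1 - inverse (v y ^ k)) = v y ^ k / (v y ^ k - 1)" .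
        moreover have "v y ^ k / v (1 + y ^ k) \<le> v y ^ k / (v y ^ k - 1)"
          using lb2[OF v, of k] p by (intro divide_left_mono) auto
        ultimately have "v y ^ k / v (1 + y ^ k) * v x \<le> 1 / (1 - inverse (v y ^ k)) * v x"
          using absolute_valueD(1)[OF v x(1)] by (intro mult_right_mono) simp_all
        thus ?case using elim by (simp add: val[OF v])
      qed
    qed
    have e3: "\<forall>\<^sub>F k in sequentially. \<forall>u\<in>V. u (t k * x) < 1"
    proof (rule eventually_ball_finite[OF insert.hyps(1)], rule ballI)
      fix u assume uV: "u \<in> V"
      have u: "absolute_value K u" using av uV by blast
      have u0: "0 \<le> u y" "u y < 1" using absolute_valueD(1)[OF u y(1)] y(3) uV by auto
      hence lim: "(\<lambda>k. u y ^ k) \<longlonglongrightarrow> 0" by (intro LIMSEQ_realpow_zero) auto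
      hence "(\<lambda>k. u y ^ k / (1 - u y ^ k) * u x) \<longlonglongrightarrow> 0 / (1 - 0) * u x"
        by (intro tendsto_mult tendsto_divide tendsto_diff tendsto_const) simp_all
      hence "\<forall>\<^sub>F k in sequentially. u y ^ k / (1 - u y ^ k) * u x < 1" by (intro order_tendstoD) auto
      thus "\<forall>\<^sub>F k in sequentially. u (t k * x) < 1" using eventually_gt_at_top[of 0]
      proof eventually_elim
        case (elim k)
        have p: "u y ^ k < 1" using u0 elim(2) by (simp add: power_less_one_iff)
        have "u y ^ k / u (1 + y ^ k) \<le> u y ^ k / (1 - u y ^ k)"
          using lb1[OF u, of k] p u0 by (intro divide_left_mono) auto
        hence "u y ^ k / u (1 + y ^ k) * u x \<le> u y ^ k / (1 - u y ^ k) * u x"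
          using absolute_valueD(1)[OF u x(1)] by (intro mult_right_mono) simp_all
        thus ?case using elim by (simp add: val[OF u])
      qed
    qed
    from eventually_conj[OF e1 eventually_conj[OF e2 e3]] obtain k where
      k: "w (t k * x) > 1" "v (t k * x) < 1" "\<forall>u\<in>V. u (t k * x) < 1" by (auto simp: eventually_sequentially)
    thus ?thesis using csubfieldD(4)[OF K t x(1)] by (intro bexI[of _ "t k * x"]) simp_all
  qed
qed

context number_field_generator begin

definition emb_abs :: "complex \<Rightarrow> complex \<Rightarrow> real" where
  "emb_abs z = restrict (\<lambda>x. cmod (emb z x)) K"

text \<open>Being a set of functions, it counts two complex conjugate embeddings once.\<close>

definition arch_places :: "(complex \<Rightarrow> real) set" where "arch_places = emb_abs ` roots"

lemma emb_abs_eq: "x \<in> K \<Longrightarrow> emb_abs z x = cmod (emb z x)"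
  by (simp add: emb_abs_def)

lemma emb_abs_absolute_value: "z \<in> roots \<Longrightarrow> absolute_value K (emb_abs z)"
  unfolding absolute_value_def
  by (auto simp: emb_abs_eq emb_eq_0_iff emb_mult emb_add K_closed norm_mult intro: norm_triangle_ineq)

lemma emb_abs_rat: "z \<in> roots \<Longrightarrow> emb_abs z (of_rat q) = \<bar>of_rat q\<bar>"
proof -
  assume z: "z \<in> roots"
  thus ?thesis by (simp add: emb_abs_eq Rats_K emb_rat cmod_of_rat)
qed

lemma finite_arch_places: "finite arch_places"
  unfolding arch_places_def by (rule finite_imageI[OF finite_roots])

lemma arch_places_subset: "arch_places \<subseteq> places K"
proof
  fix w assume "w \<in> arch_places"
  then obtain z where z: "z \<in> roots" "w = emb_abs z" by (auto simp: arch_places_def)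
  have "w \<in> extensional K" unfolding z(2) emb_abs_def by (rule restrict_extensional)
  thus "w \<in> places K" unfolding places_def z(2)
    using emb_abs_absolute_value[OF z(1)] emb_abs_rat[OF z(1)] by simp
qed

lemma arch_placeD:
  assumes "w \<in> arch_places"
  shows "absolute_value K w" "w (of_rat q) = \<bar>of_rat q\<bar>"
proof -
  obtain z where z: "z \<in> roots" "w = emb_abs z" using assms by (auto simp: arch_places_def)
  show "absolute_value K w" "w (of_rat q) = \<bar>of_rat q\<bar>"
    using emb_abs_absolute_value[OF z(1)] emb_abs_rat[OF z(1)] z(2) by simp_all
qed

text \<open>A further place \<open>w\<close> could be separated: some \<open>y\<close> has
  \<open>w y > 1\<close> while all its conjugates are smaller than \<open>1\<close> in absolute
  value. By \<open>coordinates_bound\<close> the powers of \<open>y\<close> then have bounded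
  rational coordinates, so \<open>w (y ^ m)\<close> is bounded, although it grows
  geometrically.\<close>

lemma archimedean_place_classification:
  assumes "w \<in> places K" and wq: "\<And>q::rat. w (of_rat q) = \<bar>of_rat q\<bar>"
  shows "w \<in> arch_places"
proof (rule ccontr)
  assume not: "w \<notin> arch_places"
  have w: "absolute_value K w" "w \<in> extensional K" using assms(1) by (auto simp: places_def)
  have "\<exists>y\<in>K. w y > 1 \<and> v y < 1" if v: "v \<in> arch_places" for v
  proof (rule separate_absvals[OF csubfield_K w(1) arch_placeD(1)[OF v] wq arch_placeD(2)[OF v]])
    show "\<exists>x\<in>K. w x \<noteq> v x"
    proof (rule ccontr)
      assume "\<not> ?thesis"
      hence "w x = v x" if "x \<in> K" for x using that by blast
      moreover have "v \<in> extensional K" using v arch_places_subset by (auto simp: places_def)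
      ultimately have "w = v" using w(2) by (intro extensionalityI)
      thus False using v not by blast
    qed
  qed
  moreover have "w 2 = 2" using wq[of 2] by simp
  ultimately obtain y where y: "y \<in> K" "w y > 1" "\<forall>v\<in>arch_places. v y < 1"
    using artin_whaples_separation[OF csubfield_K w(1) finite_arch_places arch_placeD(1)] by blast
  from coordinates_bound obtain C where C: "\<forall>x\<in>K. \<forall>B. (\<forall>z\<in>roots. cmod (emb z x) \<le> B) \<longrightarrow>
     (\<exists>c. (\<forall>i. c i \<in> \<rat> \<and> cmod (c i) \<le> C * B) \<and> x = (\<Sum>i<Polynomial.degree f. c i * \<theta> ^ i))" ..
  define M where "M = (\<Sum>i<Polynomial.degree f. C * w \<theta> ^ i)"
  have \<theta>: "\<theta> \<in> K" by (rule adjoin_base(2)[OF csubfield_Rats])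
  have bound: "w y ^ m \<le> M" for m
  proof -
    have ym: "y ^ m \<in> K" by (rule csubfield_power[OF csubfield_K y(1)])
    have "cmod (emb z (y ^ m)) \<le> 1" if "z \<in> roots" for z
    proof -
      have "emb_abs z y < 1" using y(3) that by (auto simp: arch_places_def)
      hence "cmod (emb z y) \<le> 1" by (simp add: emb_abs_eq y(1))
      thus ?thesis using that y(1) by (simp add: emb_power norm_power power_le_one)
    qed
    hence "\<forall>z\<in>roots. cmod (emb z (y ^ m)) \<le> 1" by blast
    from C[rule_format, OF ym this[rule_format]] obtain c where
      c: "\<forall>i. c i \<in> \<rat> \<and> cmod (c i) \<le> C * 1" "y ^ m = (\<Sum>i<Polynomial.degree f. c i * \<theta> ^ i)" by blast
    have cw: "w (c i) \<le> C" for i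
    proof -
      obtain q where q: "c i = of_rat q" using c(1) by (metis Rats_cases)
      have "cmod (c i) \<le> C" using c(1) by simp
      thus ?thesis using wq[of q] by (simp add: q cmod_of_rat)
    qed
    have cK: "c i \<in> K" for i using c(1) Rats_K by blast
    have \<theta>i: "\<theta> ^ i \<in> K" for i by (rule csubfield_power[OF csubfield_K \<theta>])
    have "w (y ^ m) \<le> (\<Sum>i<Polynomial.degree f. w (c i * \<theta> ^ i))"
      unfolding c(2) by (rule absval_sum[OF csubfield_K w(1)]) (intro K_closed cK \<theta>i)
    also have "\<dots> \<le> M" unfolding M_def
    proof (rule sum_mono)
      fix i
      have "w (c i * \<theta> ^ i) = w (c i) * w \<theta> ^ i"
        by (simp add: absolute_valueD(3)[OF w(1) cK \<theta>i] absval_power[OF csubfield_K w(1) \<theta>])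
      also have "\<dots> \<le> C * w \<theta> ^ i"
        using cw[of i] absolute_valueD(1)[OF w(1) \<theta>] by (intro mult_right_mono) simp_all
      finally show "w (c i * \<theta> ^ i) \<le> C * w \<theta> ^ i" .
    qed
    finally show ?thesis by (simp add: absval_power[OF csubfield_K w(1) y(1)])
  qed
  obtain m where "M < w y ^ m" using real_arch_pow[OF y(2)] by blast
  thus False using bound[of m] by simp
qed

end

section \<open>Norms\<close>

lemma complex_Rats_subset_Reals: "(\<rat> :: complex set) \<subseteq> \<real>"
  by (auto elim!: Rats_cases')

lemma (in number_field_generator) cnj_root: "z \<in> roots \<Longrightarrow> cnj z \<in> roots"
proof -
  assume "z \<in> roots"
  moreover have "\<And>i. Polynomial.coeff f i \<in> \<real>"
    using f_props(1) complex_Rats_subset_Reals by (auto simp: polys_def)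
  ultimately show ?thesis by (simp add: roots_def flip: poly_cnj_real)
qed

lemma polys_Rats_cnj: "g \<in> polys \<rat> \<Longrightarrow> poly g (cnj z) = cnj (poly g z)"
proof -
  assume "g \<in> polys \<rat>"
  hence "\<And>i. Polynomial.coeff g i \<in> \<real>" using complex_Rats_subset_Reals by (auto simp: polys_def)
  thus ?thesis by (simp add: poly_cnj_real)
qed

text \<open>The two moduli determine the real part, and then the imaginary part up to sign. Applied
  to the conjugates of \<theta> and \<theta> + 1, this recovers a root up to conjugation from its
  absolute value on the field.\<close>

lemma cmod_eq_imp_cnj:
  assumes "cmod a = cmod b" "cmod (a + 1) = cmod (b + 1)"
  shows "a = b \<or> a = cnj b"
proof -
  have 1: "(Re a)\<^sup>2 + (Im a)\<^sup>2 = (Re b)\<^sup>2 + (Im b)\<^sup>2" using assms(1) by (simp add: cmod_def)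
  have "(Re a + 1)\<^sup>2 + (Im a)\<^sup>2 = (Re b + 1)\<^sup>2 + (Im b)\<^sup>2" using assms(2) by (simp add: cmod_def)
  hence "Re a = Re b" using 1 by (simp add: power2_sum)
  moreover from this 1 have "Im a = Im b \<or> Im a = - Im b" by (simp add: power2_eq_iff)
  ultimately show ?thesis by (auto simp: complex_eq_iff)
qed

lemma det_integral_multiple:
  fixes M :: "complex mat"
  assumes M: "M \<in> carrier_mat n n" and int: "\<And>i j. i < n \<Longrightarrow> j < n \<Longrightarrow> \<exists>k. c * M $$ (i, j) = of_int k"
  shows "\<exists>k. c ^ n * Determinant.det M = of_int k"
proof -
  obtain m where m: "\<And>i j. i < n \<Longrightarrow> j < n \<Longrightarrow> c * M $$ (i, j) = of_int (m i j)" using int by metis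
  define M' where "M' = Matrix.mat n n (\<lambda>(i, j). m i j)"
  have "c \<cdot>\<^sub>m M = map_mat of_int M'"
    by (rule eq_matI) (use M m in \<open>auto simp: M'_def\<close>)
  hence "Determinant.det (c \<cdot>\<^sub>m M) = of_int (Determinant.det M')" by simp
  thus ?thesis using M by auto
qed

context number_field_generator begin

text \<open>The product of the conjugates of \<open>y\<close> is the determinant of multiplication by \<open>y\<close>, a matrix with
  rational entries, because the Vandermonde matrix diagonalises it.\<close>

lemma prod_conjugates_det:
  assumes y: "y \<in> K" and M: "M \<in> carrier_mat (Polynomial.degree f) (Polynomial.degree f)"
    and MQ: "\<And>j k. j < Polynomial.degree f \<Longrightarrow> k < Polynomial.degree f \<Longrightarrow> M $$ (k, j) \<in> \<rat>"
    and rel: "\<And>j. j < Polynomial.degree f \<Longrightarrow> y * \<theta> ^ j = (\<Sum>k<Polynomial.degree f. M $$ (k, j) * \<theta> ^ k)"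
  shows "(\<Prod>z\<in>roots. emb z y) = Determinant.det M"
proof -
  define n where "n = Polynomial.degree f"
  obtain zs where zs: "set zs = roots" "distinct zs" using finite_distinct_list[OF finite_roots] by blast
  have len: "length zs = n" using distinct_card[OF zs(2)] zs(1) card_roots by (simp add: n_def)
  have zr: "zs ! i \<in> roots" if "i < n" for i using that len zs(1) nth_mem by blast
  have \<theta>: "\<theta> ^ k \<in> K" for k by (intro csubfield_power[OF csubfield_K] adjoin_base(2)[OF csubfield_Rats])
  \<comment> \<open>The Vandermonde matrix of the roots. Applying the embedding of root
    \<open>i\<close> to the relations \<open>rel\<close> gives row \<open>i\<close> of the identity
    \<open>V * M = D * V\<close>.\<close>
  define V where "V = Matrix.mat n n (\<lambda>(i, j). (zs ! i) ^ j)"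
  define D where "D = Matrix.mat n n (\<lambda>(i, j). if i = j then emb (zs ! i) y else 0)"
  have V: "V \<in> carrier_mat n n" and D: "D \<in> carrier_mat n n" by (simp_all add: V_def D_def)
  have M': "M \<in> carrier_mat n n" using M by (simp add: n_def)
  have VMDV: "V * M = D * V"
  proof (rule eq_matI)
    fix i j assume "i < dim_row (D * V)" "j < dim_col (D * V)"
    hence ij: "i < n" "j < n" using D V by auto
    have "(V * M) $$ (i, j) = (\<Sum>k<n. (zs ! i) ^ k * M $$ (k, j))"
      using V M' ij by (simp add: scalar_prod_def V_def atLeast0LessThan)
    also have "\<dots> = (\<Sum>k<n. emb (zs ! i) (M $$ (k, j) * \<theta> ^ k))"
    proof (rule sum.cong[OF refl])
      fix k assume "k \<in> {..<n}"
      hence "M $$ (k, j) \<in> \<rat>" using MQ[of j k] ij by (simp add: n_def)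
      thus "(zs ! i) ^ k * M $$ (k, j) = emb (zs ! i) (M $$ (k, j) * \<theta> ^ k)"
        using zr[OF ij(1)] \<theta> by (simp add: emb_mult Rats_K emb_rat emb_power emb_theta adjoin_base(2)[OF csubfield_Rats])
    qed
    also have "\<dots> = emb (zs ! i) (\<Sum>k<n. M $$ (k, j) * \<theta> ^ k)"
      by (rule emb_sum[symmetric, OF zr[OF ij(1)]], rule K_closed(4))
         (use MQ[of j] ij \<theta> in \<open>auto simp: n_def intro: Rats_K\<close>)
    also have "\<dots> = emb (zs ! i) (y * \<theta> ^ j)" using rel[of j] ij(2) by (simp add: n_def)
    also have "\<dots> = emb (zs ! i) y * (zs ! i) ^ j"
      using zr[OF ij(1)] \<theta> y by (simp add: emb_mult emb_power emb_theta adjoin_base(2)[OF csubfield_Rats])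
    also have "\<dots> = (\<Sum>k<n. if k = i then emb (zs ! i) y * (zs ! i) ^ j else 0)" using ij by simp
    also have "\<dots> = (\<Sum>k<n. (if i = k then emb (zs ! i) y else 0) * (zs ! k) ^ j)"
      by (rule sum.cong) auto
    also have "\<dots> = (D * V) $$ (i, j)"
      using V D ij by (simp add: scalar_prod_def V_def D_def atLeast0LessThan)
    finally show "(V * M) $$ (i, j) = (D * V) $$ (i, j)" .
  qed (use V D M' in auto)
  have "Determinant.det V * Determinant.det M = Determinant.det D * Determinant.det V"
    using arg_cong[OF VMDV, of Determinant.det]
    by (simp only: Determinant.det_mult[OF V M'] Determinant.det_mult[OF D V])
  \<comment> \<open>A vector in the kernel of \<open>V\<close> is the coefficient list of a
    polynomial of degree less than \<open>n\<close> that vanishes at all \<open>n\<close>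
    roots.\<close>
  moreover have "Determinant.det V \<noteq> 0"
  proof
    assume "Determinant.det V = 0"
    then obtain v where v: "v \<in> carrier_vec n" "v \<noteq> 0\<^sub>v n" "V *\<^sub>v v = 0\<^sub>v n"
      using det_0_iff_vec_prod_zero_field[OF V] by blast
    define p where "p = (\<Sum>k<n. Polynomial.monom (vec_index v k) k)"
    have coeff: "Polynomial.coeff p k = vec_index v k" if "k < n" for k
    proof -
      have "Polynomial.coeff p k = (\<Sum>j<n. if j = k then vec_index v k else 0)"
        unfolding p_def coeff_sum by (rule sum.cong) simp_all
      thus ?thesis using that by simp
    qed
    have "Polynomial.degree p < n"
      unfolding p_def using minpoly_degree_pos[OF csubfield_Rats f]
      by (intro degree_sum_less) (auto simp: n_def intro: le_less_trans[OF degree_monom_le])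
    have "poly p z = 0" if z: "z \<in> roots" for z
    proof -
      obtain i where i: "i < n" "z = zs ! i" using z zs(1) len by (metis in_set_conv_nth)
      have "(V *\<^sub>v v) $ i = 0" using v(3) i by simp
      hence "(\<Sum>k<n. z ^ k * vec_index v k) = 0"
        using i V v(1) by (simp add: V_def scalar_prod_def atLeast0LessThan)
      thus ?thesis by (simp add: p_def poly_sum poly_monom mult.commute)
    qed
    hence sub: "roots \<subseteq> {z. poly p z = 0}" by blast
    have "p = 0"
    proof (rule ccontr)
      assume nz: "p \<noteq> 0"
      have "card roots \<le> card {z. poly p z = 0}" by (rule card_mono[OF poly_roots_finite[OF nz] sub])
      also have "\<dots> \<le> Polynomial.degree p" by (rule card_poly_roots_bound[OF nz])
      finally show False using \<open>Polynomial.degree p < n\<close> by (simp add: card_roots n_def)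
    qed
    hence "v = 0\<^sub>v n" using coeff v(1) by (intro eq_vecI) auto
    thus False using v(2) by simp
  qed
  ultimately have "Determinant.det M = Determinant.det D" by simp
  also have "\<dots> = prod_list (diag_mat D)"
    by (rule det_upper_triangular[OF _ D]) (auto simp: D_def)
  also have "diag_mat D = map (\<lambda>i. emb (zs ! i) y) [0..<n]"
    by (simp add: diag_mat_def D_def)
  also have "\<dots> = map (\<lambda>z. emb z y) zs" using len by (intro nth_equalityI) auto
  also have "prod_list \<dots> = (\<Prod>z\<in>roots. emb z y)" using prod.distinct_set_conv_list[OF zs(2), of "\<lambda>z. emb z y"] zs(1) by simp
  finally show ?thesis by simp
qed

lemma coordinates_exist:
  assumes "x \<in> K"
  shows "\<exists>r. \<forall>k. r k \<in> \<rat> \<and> x = (\<Sum>k<Polynomial.degree f. r k * \<theta> ^ k)"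
proof -
  from coordinates_bound obtain C where C: "\<forall>x\<in>K. \<forall>B. (\<forall>z\<in>roots. cmod (emb z x) \<le> B) \<longrightarrow>
     (\<exists>c. (\<forall>i. c i \<in> \<rat> \<and> cmod (c i) \<le> C * B) \<and> x = (\<Sum>i<Polynomial.degree f. c i * \<theta> ^ i))" ..
  have "\<forall>z\<in>roots. cmod (emb z x) \<le> (\<Sum>z\<in>roots. cmod (emb z x))"
    by (intro ballI member_le_sum) (auto intro: finite_roots)
  from C[rule_format, OF assms this[rule_format]] show ?thesis by auto
qed

text \<open>The norm of the value is the determinant of a matrix whose entries are integral
  combinations of the coordinates of the products of coefficients of \<open>G\<close> with powers of
  \<theta>. These have a common denominator \<open>E\<close> not depending on \<open>a\<close>, so
  \<open>E ^ n\<close> times the norm is a nonzero integer.\<close>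

lemma norm_lower_bound:
  assumes G: "\<And>m. Poly_Mapping.lookup G m \<in> K"
  shows "\<exists>c>0. \<forall>a :: nat \<Rightarrow> int. peval G (\<lambda>i. of_int (a i)) \<noteq> 0 \<longrightarrow>
    c \<le> (\<Prod>z\<in>roots. cmod (emb z (peval G (\<lambda>i. of_int (a i)))))"
proof -
  define n where "n = Polynomial.degree f"
  have \<theta>: "\<theta> ^ k \<in> K" for k by (intro csubfield_power[OF csubfield_K] adjoin_base(2)[OF csubfield_Rats])
  have "\<exists>r. \<forall>k. r k \<in> \<rat> \<and> Poly_Mapping.lookup G m * \<theta> ^ j = (\<Sum>k<n. r k * \<theta> ^ k)" for m j
    unfolding n_def by (rule coordinates_exist) (intro K_closed G \<theta>)
  then obtain r where r: "\<And>m j k. r m j k \<in> \<rat>"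
    "\<And>m j. Poly_Mapping.lookup G m * \<theta> ^ j = (\<Sum>k<n. r m j k * \<theta> ^ k)" by metis
  define S where "S = {q :: rat. of_rat q \<in> (\<lambda>(m, j, k). r m j k) ` (Poly_Mapping.keys G \<times> {..<n} \<times> {..<n})}"
  have "finite S" unfolding S_def by (rule finite_inverse_image) (auto intro: injI)
  from common_denominator[OF this] obtain E where E: "E > 0" "\<forall>q\<in>S. \<exists>z. of_int E * q = (of_int z :: rat)" by auto
  have Er: "\<exists>t. of_int E * r m j k = of_int t" if "m \<in> Poly_Mapping.keys G" "j < n" "k < n" for m j k
  proof -
    obtain q where q: "r m j k = of_rat q" using r(1) by (metis Rats_cases)
    have "q \<in> S" unfolding S_def using that by (auto simp: image_iff simp flip: q)
    then obtain t where "of_int E * q = of_int t" using E(2) by blast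
    hence "of_rat (of_int E * q) = (of_int t :: complex)" by simp
    thus ?thesis by (intro exI[of _ t]) (simp add: q of_rat_mult)
  qed
  have "1 / real_of_int E ^ n \<le> (\<Prod>z\<in>roots. cmod (emb z (peval G (\<lambda>i. of_int (a i)))))"
    if nz: "peval G (\<lambda>i. of_int (a i)) \<noteq> 0" for a :: "nat \<Rightarrow> int"
  proof -
    define y where "y = peval G (\<lambda>i. of_int (a i))"
    have y: "y = (\<Sum>m\<in>Poly_Mapping.keys G. Poly_Mapping.lookup G m * of_int (mono_val a m))"
      unfolding y_def peval_mono_val mono_val_of_int ..
    have intK: "of_int t \<in> K" for t by (rule csubfield_of_int[OF csubfield_K])
    have yK: "y \<in> K" unfolding y by (intro csubfield_sum[OF csubfield_K] K_closed G intK)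
    define M where "M = Matrix.mat n n (\<lambda>(k, j). \<Sum>m\<in>Poly_Mapping.keys G. of_int (mono_val a m) * r m j k)"
    have M: "M \<in> carrier_mat n n" by (simp add: M_def)
    have "(\<Prod>z\<in>roots. emb z y) = Determinant.det M"
    proof (rule prod_conjugates_det[OF yK])
      show "M \<in> carrier_mat (Polynomial.degree f) (Polynomial.degree f)" using M by (simp add: n_def)
      fix j assume j: "j < Polynomial.degree f"
      show "M $$ (k, j) \<in> \<rat>" if "k < Polynomial.degree f" for k
        using j that by (simp add: M_def n_def r(1) Rats_sum)
      have "y * \<theta> ^ j = (\<Sum>m\<in>Poly_Mapping.keys G. of_int (mono_val a m) * (Poly_Mapping.lookup G m * \<theta> ^ j))"
        unfolding y by (simp add: sum_distrib_right sum_distrib_left mult_ac)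
      also have "\<dots> = (\<Sum>m\<in>Poly_Mapping.keys G. \<Sum>k<n. of_int (mono_val a m) * r m j k * \<theta> ^ k)"
        unfolding r(2) by (simp add: sum_distrib_left mult.assoc)
      also have "\<dots> = (\<Sum>k<n. \<Sum>m\<in>Poly_Mapping.keys G. of_int (mono_val a m) * r m j k * \<theta> ^ k)"
        by (rule sum.swap)
      also have "\<dots> = (\<Sum>k<n. M $$ (k, j) * \<theta> ^ k)"
        using j by (intro sum.cong) (simp_all add: M_def n_def sum_distrib_right)
      finally show "y * \<theta> ^ j = (\<Sum>k<Polynomial.degree f. M $$ (k, j) * \<theta> ^ k)" by (simp add: n_def)
    qed
    moreover have "\<exists>t. of_int E ^ n * Determinant.det M = of_int t"
    proof (rule det_integral_multiple[OF M])
      fix k j assume kj: "k < n" "j < n"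
      have "of_int E * M $$ (k, j) = (\<Sum>m\<in>Poly_Mapping.keys G. of_int (mono_val a m) * (of_int E * r m j k))"
        using kj by (simp add: M_def sum_distrib_left mult_ac)
      also have "\<dots> \<in> \<int>"
      proof (rule Ints_sum)
        fix m assume "m \<in> Poly_Mapping.keys G"
        with Er[OF this kj(2,1)] show "of_int (mono_val a m) * (of_int E * r m j k) \<in> \<int>" by auto
      qed
      finally show "\<exists>t. of_int E * M $$ (k, j) = of_int t" by (auto elim: Ints_cases)
    qed
    ultimately obtain t where t: "of_int E ^ n * (\<Prod>z\<in>roots. emb z y) = of_int t" by auto
    have "y \<noteq> 0" using nz by (simp add: y_def)
    hence "(\<Prod>z\<in>roots. emb z y) \<noteq> 0"
      using finite_roots emb_eq_0_iff[OF _ yK] by simp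
    hence "t \<noteq> 0" using t E(1) by (metis mult_eq_0_iff of_int_0 of_int_eq_0_iff power_not_zero less_irrefl)
    hence "1 \<le> \<bar>t\<bar>" by linarith
    hence "1 \<le> real_of_int \<bar>t\<bar>" by linarith
    also have "\<dots> = cmod (of_int E ^ n * (\<Prod>z\<in>roots. emb z y))" unfolding t by simp
    also have "\<dots> = real_of_int E ^ n * (\<Prod>z\<in>roots. cmod (emb z y))"
      using E(1) by (simp add: norm_mult norm_power prod_norm)
    finally show ?thesis using E(1) by (simp add: y_def field_simps)
  qed
  thus ?thesis using E(1) by (intro exI[of _ "1 / real_of_int E ^ n"]) simp
qed

end

text \<open>With \<i> in the field no embedding is real: conjugation pairs the roots without fixed
  points, and every archimedean completion is all of the complex numbers. Thus all archimedean
  places are of one kind.\<close>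

locale imaginary_number_field = number_field_generator +
  assumes ii: "\<i> \<in> K"
begin

lemma emb_ii: "z \<in> roots \<Longrightarrow> emb z \<i> = \<i> \<or> emb z \<i> = - \<i>"
proof -
  assume z: "z \<in> roots"
  have "emb z \<i> * emb z \<i> = emb z (-1)" using emb_mult[OF z ii ii] by simp
  also have "\<dots> = -1" using emb_rat[OF z, of "-1"] by simp
  finally have "(emb z \<i> - \<i>) * (emb z \<i> + \<i>) = 0" by (simp add: algebra_simps)
  thus ?thesis by (auto simp: eq_neg_iff_add_eq_0)
qed

lemma emb_cnj: "z \<in> roots \<Longrightarrow> x \<in> K \<Longrightarrow> emb (cnj z) x = cnj (emb z x)"
  by (elim K_cases) (simp add: emb_poly cnj_root polys_Rats_cnj)

lemma cnj_root_neq: "z \<in> roots \<Longrightarrow> cnj z \<noteq> z"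
  using emb_cnj[OF _ ii, of z] emb_ii[of z] by auto

text \<open>The values of the absolute value at \<theta> and \<theta> + 1 already determine the root
  up to conjugation.\<close>

lemma emb_abs_fibre:
  assumes "z \<in> roots"
  shows "{s \<in> roots. emb_abs s = emb_abs z} = {z, cnj z}"
proof (intro equalityI subsetI)
  fix s assume "s \<in> {s \<in> roots. emb_abs s = emb_abs z}"
  hence s: "s \<in> roots" "emb_abs s = emb_abs z" by auto
  have \<theta>: "\<theta> \<in> K" "\<theta> + 1 \<in> K" using adjoin_base(2)[OF csubfield_Rats] K_closed by auto
  have "cmod s = cmod z" using fun_cong[OF s(2), of \<theta>] \<theta> s(1) assms by (simp add: emb_abs_eq emb_theta)
  moreover have "cmod (s + 1) = cmod (z + 1)"
    using fun_cong[OF s(2), of "\<theta> + 1"] \<theta> s(1) assms by (simp add: emb_abs_eq emb_theta emb_add emb_1 K_closed)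
  ultimately show "s \<in> {z, cnj z}" using cmod_eq_imp_cnj[of s z] by auto
next
  fix s assume "s \<in> {z, cnj z}"
  moreover have "emb_abs (cnj z) = emb_abs z"
    unfolding emb_abs_def by (rule restrict_ext) (simp add: emb_cnj assms)
  ultimately show "s \<in> {s \<in> roots. emb_abs s = emb_abs z}" using assms cnj_root by auto
qed

text \<open>The roots are grouped by the absolute value they induce, and each group consists of two
  conjugate roots; hence the square.\<close>

lemma prod_arch_places:
  assumes "y \<in> K"
  shows "(\<Prod>z\<in>roots. cmod (emb z y)) = (\<Prod>w\<in>arch_places. w y)\<^sup>2"
proof -
  have "(\<Prod>z\<in>roots. cmod (emb z y)) = (\<Prod>w\<in>emb_abs ` roots. \<Prod>z\<in>{z \<in> roots. emb_abs z = w}. cmod (emb z y))"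
    by (rule prod.image_gen[OF finite_roots])
  also have "\<dots> = (\<Prod>w\<in>arch_places. (w y)\<^sup>2)" unfolding arch_places_def
  proof (rule prod.cong[OF refl])
    fix w assume "w \<in> emb_abs ` roots"
    then obtain z where z: "z \<in> roots" "w = emb_abs z" by blast
    show "(\<Prod>z\<in>{z \<in> roots. emb_abs z = w}. cmod (emb z y)) = (w y)\<^sup>2"
      unfolding z(2) emb_abs_fibre[OF z(1)] using cnj_root_neq[OF z(1)]
      by (simp add: emb_abs_eq emb_cnj z(1) assms power2_eq_square)
  qed
  finally show ?thesis by (simp add: prod_power_distrib)
qed

end

section \<open>Local degrees\<close>

lemma rational_sequence:
  "\<exists>q :: nat \<Rightarrow> rat. (\<lambda>n. of_rat (q n)) \<longlonglongrightarrow> (x::real)"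
proof -
  have "\<forall>n. \<exists>q. x < of_rat q \<and> of_rat q < x + inverse (real (Suc n))"
    by (intro allI of_rat_dense) simp
  from choice[OF this] obtain q :: "nat \<Rightarrow> rat" where
    q: "\<forall>n. x < of_rat (q n) \<and> of_rat (q n) < x + inverse (real (Suc n))" ..
  have "(\<lambda>n. x + inverse (real (Suc n))) \<longlonglongrightarrow> x + 0"
    by (intro tendsto_add tendsto_const LIMSEQ_inverse_real_of_nat)
  hence "(\<lambda>n. of_rat (q n)) \<longlonglongrightarrow> x"
    using q by (intro tendsto_sandwich[of "\<lambda>_. x" "\<lambda>n. of_rat (q n)" sequentially "\<lambda>n. x + inverse (real (Suc n))"])
       (auto intro!: always_eventually less_imp_le)
  thus ?thesis by blast
qed

lemma complex_of_rat: "(of_rat q :: complex) = complex_of_real (of_rat q)"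
  by (cases q) (simp add: of_rat_rat)

lemma dimension_complex_real: "ring.dimension complex_ring 2 \<real> UNIV"
proof -
  interpret cf: Ring.field complex_ring by (rule field_complex_ring)
  have "csubfield \<real>" by (simp add: csubfield_def)
  hence R: "subfield \<real> complex_ring" by (rule subfield_complex_ring)
  have "cf.dimension (Suc 1) \<real> (cf.line_extension \<real> \<i> \<real>)"
    by (rule cf.Suc_dim[OF _ _ cf.dimension_one[OF R]]) (simp_all add: complex_is_Real_iff)
  moreover have "cf.line_extension \<real> \<i> \<real> = UNIV"
  proof (intro equalityI subsetI UNIV_I)
    fix u :: complex
    have "u = complex_of_real (Im u) * \<i> + complex_of_real (Re u)" by (simp add: complex_eq_iff)
    thus "u \<in> cf.line_extension \<real> \<i> \<real>" unfolding cf.line_extension_mem_iff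
      by (intro bexI[of _ "complex_of_real (Im u)"] bexI[of _ "complex_of_real (Re u)"]) simp_all
  qed
  ultimately show ?thesis by (simp add: numeral_2_eq_2)
qed

context imaginary_number_field begin

text \<open>\<open>emb z\<close> is an isometry onto its image, so a sequence is Cauchy exactly when
  its image converges in the complete field of complex numbers. The subset \<open>k\<close> is a
  parameter so that this also covers sequences of rationals.\<close>

lemma cauchy_seqs_iff:
  assumes z: "z \<in> roots" and k: "k \<subseteq> K"
  shows "s \<in> cauchy_seqs k (emb_abs z) \<longleftrightarrow> range s \<subseteq> k \<and> convergent (\<lambda>n. emb z (s n))"
proof (cases "range s \<subseteq> k")
  case True
  hence "s n \<in> K" for n using k by auto
  hence "emb_abs z (s m - s n) = dist (emb z (s m)) (emb z (s n))" for m n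
    by (simp add: emb_abs_eq K_closed emb_diff z dist_norm)
  thus ?thesis using True by (simp add: cauchy_seqs_def Cauchy_convergent_iff[symmetric] Cauchy_def)
qed (simp add: cauchy_seqs_def)

lemma ring_cauchy_ring:
  assumes z: "z \<in> roots"
  shows "Ring.ring (cauchy_ring K (emb_abs z))"
proof -
  let ?R = "cauchy_ring K (emb_abs z)"
  note iff = cauchy_seqs_iff[OF z subset_refl]
  have mem: "s \<in> carrier ?R \<longleftrightarrow> (\<forall>n. s n \<in> K) \<and> convergent (\<lambda>n. emb z (s n))" for s
    by (auto simp: cauchy_ring_def iff)
  have add: "(\<lambda>n. s n + t n) \<in> carrier ?R" if "s \<in> carrier ?R" "t \<in> carrier ?R" for s t
    using that unfolding mem by (simp add: K_closed emb_add z convergent_add)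
  have mult: "(\<lambda>n. s n * t n) \<in> carrier ?R" if "s \<in> carrier ?R" "t \<in> carrier ?R" for s t
    using that unfolding mem by (simp add: K_closed emb_mult z convergent_mult)
  have minus: "(\<lambda>n. - s n) \<in> carrier ?R" if "s \<in> carrier ?R" for s
    using that unfolding mem by (simp add: K_closed emb_minus z convergent_minus_iff[symmetric])
  have zero: "(\<lambda>n. 0) \<in> carrier ?R" and one: "(\<lambda>n. 1) \<in> carrier ?R"
    unfolding mem by (simp_all add: K_closed convergent_const)
  have "\<exists>t\<in>carrier ?R. (\<lambda>n. t n + s n) = (\<lambda>n. 0)" if "s \<in> carrier ?R" for s
    by (rule bexI[OF _ minus[OF that]]) simp
  hence "abelian_group ?R"
    by (intro abelian_groupI) (simp_all add: cauchy_ring_def add[unfolded cauchy_ring_def, simplified] zero[unfolded cauchy_ring_def, simplified] add_ac)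
  moreover have "monoid ?R"
    by (intro monoidI) (simp_all add: cauchy_ring_def mult[unfolded cauchy_ring_def, simplified] one[unfolded cauchy_ring_def, simplified] mult_ac)
  ultimately show ?thesis
    by (intro ringI) (simp_all add: cauchy_ring_def distrib_left distrib_right)
qed

definition seq_lim :: "complex \<Rightarrow> (nat \<Rightarrow> complex) \<Rightarrow> complex" where
  "seq_lim z s = lim (\<lambda>n. emb z (s n))"

lemma seq_lim_tendsto:
  assumes "z \<in> roots" "s \<in> cauchy_seqs K (emb_abs z)"
  shows "(\<lambda>n. emb z (s n)) \<longlonglongrightarrow> seq_lim z s"
  using assms cauchy_seqs_iff[OF assms(1) subset_refl] unfolding seq_lim_def
  by (simp add: convergent_LIMSEQ_iff)

lemma seq_lim_eq: "(\<lambda>n. emb z (s n)) \<longlonglongrightarrow> l \<Longrightarrow> seq_lim z s = l"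
  unfolding seq_lim_def by (rule limI)

lemma seq_lim_hom:
  assumes z: "z \<in> roots"
  shows "ring_hom_ring (cauchy_ring K (emb_abs z)) complex_ring (seq_lim z)"
proof (rule ring_hom_ringI2[OF ring_cauchy_ring[OF z] field.is_ring[OF field_complex_ring]], rule ring_hom_memI)
  fix s t assume "s \<in> carrier (cauchy_ring K (emb_abs z))" "t \<in> carrier (cauchy_ring K (emb_abs z))"
  hence st: "s \<in> cauchy_seqs K (emb_abs z)" "t \<in> cauchy_seqs K (emb_abs z)" by (simp_all add: cauchy_ring_def)
  hence K: "s n \<in> K" "t n \<in> K" for n using cauchy_seqs_iff[OF z subset_refl] by auto
  show "seq_lim z (s \<otimes>\<^bsub>cauchy_ring K (emb_abs z)\<^esub> t) = seq_lim z s \<otimes>\<^bsub>complex_ring\<^esub> seq_lim z t"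
    using tendsto_mult[OF seq_lim_tendsto[OF z st(1)] seq_lim_tendsto[OF z st(2)]]
    by (intro seq_lim_eq) (simp add: cauchy_ring_def emb_mult z K)
  show "seq_lim z (s \<oplus>\<^bsub>cauchy_ring K (emb_abs z)\<^esub> t) = seq_lim z s \<oplus>\<^bsub>complex_ring\<^esub> seq_lim z t"
    using tendsto_add[OF seq_lim_tendsto[OF z st(1)] seq_lim_tendsto[OF z st(2)]]
    by (intro seq_lim_eq) (simp add: cauchy_ring_def emb_add z K)
next
  show "seq_lim z \<one>\<^bsub>cauchy_ring K (emb_abs z)\<^esub> = \<one>\<^bsub>complex_ring\<^esub>"
    by (intro seq_lim_eq) (simp add: cauchy_ring_def emb_1 z)
qed simp

lemma seq_lim_kernel:
  assumes z: "z \<in> roots"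
  shows "a_kernel (cauchy_ring K (emb_abs z)) complex_ring (seq_lim z) = null_seqs K (emb_abs z)"
proof -
  have "seq_lim z s = 0 \<longleftrightarrow> (\<lambda>n. emb_abs z (s n)) \<longlonglongrightarrow> 0" if s: "s \<in> cauchy_seqs K (emb_abs z)" for s
  proof -
    have "s n \<in> K" for n using s cauchy_seqs_iff[OF z subset_refl] by auto
    hence "(\<lambda>n. emb_abs z (s n)) \<longlonglongrightarrow> 0 \<longleftrightarrow> (\<lambda>n. emb z (s n)) \<longlonglongrightarrow> 0"
      by (simp add: emb_abs_eq tendsto_norm_zero_iff)
    thus ?thesis using seq_lim_tendsto[OF z s] seq_lim_eq LIMSEQ_unique by metis
  qed
  thus ?thesis unfolding a_kernel_def' null_seqs_def by (auto simp: cauchy_ring_def)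
qed

text \<open>The rational combinations of \<open>1\<close> and \<i> lie in the field, and their
  images are already dense in the plane.\<close>

lemma seq_lim_surj:
  assumes z: "z \<in> roots"
  shows "seq_lim z ` cauchy_seqs K (emb_abs z) = UNIV"
proof (intro equalityI subsetI UNIV_I)
  fix c :: complex
  define e where "e = emb z \<i>"
  \<comment> \<open>The embedding sends \<i> to \<i> or to its negative; the factor
    \<open>Im e\<close>, which is \<open>1\<close> or \<open>-1\<close>, compensates the
    sign.\<close>
  define y where "y = Im c * Im e"
  have e: "complex_of_real y * e = complex_of_real (Im c) * \<i>"
    using emb_ii[OF z] by (auto simp: e_def y_def complex_eq_iff)
  obtain q where q: "(\<lambda>n. of_rat (q n)) \<longlonglongrightarrow> Re c" using rational_sequence by blast
  obtain r where r: "(\<lambda>n. of_rat (r n)) \<longlonglongrightarrow> y" using rational_sequence by blast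
  define s where "s n = of_rat (q n) + of_rat (r n) * \<i>" for n
  have rK: "of_rat x \<in> K" for x by (rule Rats_K) simp
  have sK: "s n \<in> K" for n unfolding s_def by (intro K_closed rK ii)
  have "emb z (s n) = complex_of_real (of_rat (q n)) + complex_of_real (of_rat (r n)) * e" for n
    unfolding s_def e_def by (simp add: emb_add emb_mult z K_closed rK ii emb_rat complex_of_rat[symmetric])
  moreover have "(\<lambda>n. complex_of_real (of_rat (q n)) + complex_of_real (of_rat (r n)) * e) \<longlonglongrightarrow> complex_of_real (Re c) + complex_of_real y * e"
    by (intro tendsto_intros q r)
  moreover have "complex_of_real (Re c) + complex_of_real y * e = c"
    unfolding e by (simp add: complex_eq_iff)
  ultimately have lim: "(\<lambda>n. emb z (s n)) \<longlonglongrightarrow> c" by simp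
  hence "s \<in> cauchy_seqs K (emb_abs z)"
    using sK by (auto simp: cauchy_seqs_iff[OF z subset_refl] convergent_def)
  thus "c \<in> seq_lim z ` cauchy_seqs K (emb_abs z)"
    by (rule image_eqI[rotated]) (rule seq_lim_eq[OF lim, symmetric])
qed

lemma seq_lim_Rats:
  assumes z: "z \<in> roots"
  shows "seq_lim z ` cauchy_seqs \<rat> (emb_abs z) = \<real>"
proof (intro equalityI subsetI)
  have QK: "\<rat> \<subseteq> K" using Rats_K by blast
  fix c assume "c \<in> seq_lim z ` cauchy_seqs \<rat> (emb_abs z)"
  then obtain s where s: "s \<in> cauchy_seqs \<rat> (emb_abs z)" "c = seq_lim z s" by blast
  have sQ: "s n \<in> \<rat>" for n using s(1) cauchy_seqs_iff[OF z QK] by auto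
  have "s \<in> cauchy_seqs K (emb_abs z)" using s(1) QK by (auto simp: cauchy_seqs_iff[OF z QK] cauchy_seqs_iff[OF z subset_refl])
  from seq_lim_tendsto[OF z this] have lim: "(\<lambda>n. emb z (s n)) \<longlonglongrightarrow> c" using s(2) by simp
  have "emb z (s n) \<in> \<real>" for n
    using sQ[of n] complex_Rats_subset_Reals by (auto simp: emb_rat z)
  thus "c \<in> \<real>" by (rule closed_sequentially[OF closed_complex_Reals _ lim])
next
  have QK: "\<rat> \<subseteq> K" using Rats_K by blast
  fix c :: complex assume "c \<in> \<real>"
  then obtain x where x: "c = complex_of_real x" by (auto elim: Reals_cases)
  obtain q where q: "(\<lambda>n. of_rat (q n)) \<longlonglongrightarrow> x" using rational_sequence by blast
  have "(\<lambda>n. complex_of_real (of_rat (q n))) \<longlonglongrightarrow> c" unfolding x by (intro tendsto_intros q)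
  hence lim: "(\<lambda>n. emb z (of_rat (q n))) \<longlonglongrightarrow> c" by (simp add: emb_rat z complex_of_rat[symmetric])
  hence "(\<lambda>n. of_rat (q n)) \<in> cauchy_seqs \<rat> (emb_abs z)"
    by (auto simp: cauchy_seqs_iff[OF z QK] convergent_def)
  thus "c \<in> seq_lim z ` cauchy_seqs \<rat> (emb_abs z)"
    by (rule image_eqI[rotated]) (rule seq_lim_eq[OF lim, symmetric])
qed

text \<open>Limits induce an isomorphism from the completion to the complex numbers by the first
  isomorphism theorem, the null sequences being the kernel. It carries the completion of \<rat> to
  \<real>, so the local degree is the degree of the complex over the real numbers.\<close>

theorem local_degree_arch:
  assumes "w \<in> arch_places"
  shows "local_degree K w = 2"
proof -
  obtain z where z: "z \<in> roots" "w = emb_abs z" using assms by (auto simp: arch_places_def)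
  let ?R = "cauchy_ring K w" and ?C = "completion K w"
  interpret h: ring_hom_ring ?R complex_ring "seq_lim z" using seq_lim_hom[OF z(1)] z(2) by simp
  have ker: "a_kernel ?R complex_ring (seq_lim z) = null_seqs K w" using seq_lim_kernel[OF z(1)] z(2) by simp
  define Fr where "Fr = (\<lambda>A. the_elem (seq_lim z ` A))"
  have carr: "carrier ?R = cauchy_seqs K w" by (simp add: cauchy_ring_def)
  have "seq_lim z ` carrier ?R = carrier complex_ring" unfolding carr using seq_lim_surj[OF z(1)] z(2) by simp
  from h.FactRing_iso_set[OF this] have iso: "Fr \<in> ring_iso ?C complex_ring"
    unfolding ker completion_def Fr_def .
  have "ideal (null_seqs K w) ?R" using h.kernel_is_ideal unfolding ker .
  hence ringC: "Ring.ring ?C" unfolding completion_def by (rule ideal.quotient_is_ring)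
  \<comment> \<open>The dimension is known in \<open>complex_ring\<close>, so it is transported
    along the inverse isomorphism into the completion.\<close>
  define g where "g = inv_into (carrier ?C) Fr"
  have g: "g \<in> ring_iso complex_ring ?C" unfolding g_def by (rule ring_iso_set_sym[OF ringC iso])
  interpret g: ring_hom_ring complex_ring ?C g
    by (rule ring_hom_ringI2[OF field.is_ring[OF field_complex_ring] ringC]) (use g in \<open>simp add: ring_iso_def\<close>)
  have bij: "bij_betw g UNIV (carrier ?C)" using g by (simp add: ring_iso_def)
  have bijF: "inj_on Fr (carrier ?C)" using iso by (simp add: ring_iso_def bij_betw_def)
  have coset: "null_seqs K w +>\<^bsub>?R\<^esub> s \<in> carrier ?C" "g (seq_lim z s) = null_seqs K w +>\<^bsub>?R\<^esub> s" if "s \<in> cauchy_seqs K w" for s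
  proof -
    show 1: "null_seqs K w +>\<^bsub>?R\<^esub> s \<in> carrier ?C"
      unfolding completion_def FactRing_def A_RCOSETS_def' using that by (auto simp: carr)
    have "Fr (null_seqs K w +>\<^bsub>?R\<^esub> s) = seq_lim z s"
      using h.the_elem_simp[of s] that unfolding ker Fr_def carr by simp
    thus "g (seq_lim z s) = null_seqs K w +>\<^bsub>?R\<^esub> s" unfolding g_def using inv_into_f_f[OF bijF 1] by simp
  qed
  have sub: "cauchy_seqs \<rat> w \<subseteq> cauchy_seqs K w"
  proof
    fix s assume "s \<in> cauchy_seqs \<rat> w"
    moreover have "\<rat> \<subseteq> K" using Rats_K by blast
    ultimately show "s \<in> cauchy_seqs K w" unfolding cauchy_seqs_def by blast
  qed
  have "g ` \<real> = g ` seq_lim z ` cauchy_seqs \<rat> w" using seq_lim_Rats[OF z(1)] z(2) by simp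
  also have "\<dots> = completion_of_subfield K w \<rat>"
    unfolding completion_of_subfield_def image_image by (rule image_cong[OF refl]) (use coset(2) sub in blast)
  finally have gR: "g ` \<real> = completion_of_subfield K w \<rat>" .
  have gU: "g ` UNIV = carrier ?C" using bij by (simp add: bij_betw_def)
  have R: "subfield \<real> complex_ring" by (rule subfield_complex_ring) (simp add: csubfield_def)
  have "g 0 \<noteq> g 1"
  proof
    assume "g 0 = g 1"
    hence "(0 :: complex) = 1" using bij by (intro inj_onD[of g UNIV]) (simp_all add: bij_betw_def)
    thus False by simp
  qed
  hence one_zero: "\<one>\<^bsub>?C\<^esub> \<noteq> \<zero>\<^bsub>?C\<^esub>" using g.hom_one g.hom_zero by simp
  have "ring.dimension ?C 2 (g ` \<real>) (g ` UNIV)"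
    by (rule g.inj_hom_dimension[OF R one_zero _ dimension_complex_real]) (use bij in \<open>simp add: bij_betw_def\<close>)
  moreover have "subfield (g ` \<real>) ?C" by (rule g.img_is_subfield(2)[OF R one_zero])
  ultimately have "(ring.dim ?C over (g ` \<real>)) (g ` UNIV) = 2" using ring.dimI[OF ringC] by blast
  thus ?thesis unfolding local_degree_def over_def gR gU .
qed

end

section \<open>Divisors and heights over a number field\<close>

lemma lookup_mult_sum:
  "Poly_Mapping.lookup (F * G) k = (\<Sum>m\<in>Poly_Mapping.keys F. \<Sum>m'\<in>Poly_Mapping.keys G.
      if m + m' = k then Poly_Mapping.lookup F m * Poly_Mapping.lookup G m' else 0)" for F G :: mpoly
  unfolding mpoly_mult_eq lookup_sum lookup_single when_def ..

lemma lookup_mult_closed: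
  fixes F G :: mpoly
  assumes L: "csubfield L" and "\<And>m. Poly_Mapping.lookup F m \<in> L" "\<And>m. Poly_Mapping.lookup G m \<in> L"
  shows "Poly_Mapping.lookup (F * G) k \<in> L"
  unfolding lookup_mult_sum
  by (intro csubfield_sum[OF L]) (simp add: assms csubfieldD[OF L])

text \<open>Compare the coefficients at the sum of the leading monomial of \<open>E\<close> and the largest monomial of
  \<open>Q\<close> whose coefficient lies outside \<open>L\<close>.\<close>

lemma quotient_coefficients:
  fixes E Q :: mpoly
  assumes L: "csubfield L" and E: "E \<noteq> 0" "\<And>m. Poly_Mapping.lookup E m \<in> L"
    and F: "\<And>m. Poly_Mapping.lookup (E * Q) m \<in> L"
  shows "Poly_Mapping.lookup Q m \<in> L"
proof (rule ccontr)
  assume m: "Poly_Mapping.lookup Q m \<notin> L"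
  define S where "S = {m \<in> Poly_Mapping.keys Q. Poly_Mapping.lookup Q m \<notin> L}"
  have "Poly_Mapping.lookup Q m \<noteq> 0" using m csubfieldD(1)[OF L] by auto
  hence "m \<in> S" using m by (simp add: S_def in_keys_iff)
  hence S: "finite S" "S \<noteq> {}" by (auto simp: S_def)
  \<comment> \<open>\<open>Max\<close> refers to the linear order on exponent vectors, which is
    compatible with addition; so \<open>a0 + m0\<close> arises from one pair of monomials
    only.\<close>
  define m0 where "m0 = Max S"
  define a0 where "a0 = Max (Poly_Mapping.keys E)"
  have m0: "m0 \<in> S" unfolding m0_def by (rule Max_in[OF S])
  have a0: "a0 \<in> Poly_Mapping.keys E" unfolding a0_def by (rule Max_in) (use E(1) in simp_all)
  \<comment> \<open>The part of \<open>Q\<close> with coefficients outside \<open>L\<close>. The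
    rest has coefficients in \<open>L\<close>, so \<open>E * Q1\<close> still has all its
    coefficients in \<open>L\<close>.\<close>
  define Q1 where "Q1 = (\<Sum>m\<in>S. Poly_Mapping.single m (Poly_Mapping.lookup Q m))"
  have lookup_Q1: "Poly_Mapping.lookup Q1 k = (if k \<in> S then Poly_Mapping.lookup Q k else 0)" for k
  proof -
    have "Poly_Mapping.lookup Q1 k = (\<Sum>m\<in>S. if m = k then Poly_Mapping.lookup Q k else 0)"
      unfolding Q1_def lookup_sum by (rule sum.cong) (simp_all add: lookup_single when_def)
    thus ?thesis using S(1) by simp
  qed
  have keys_Q1: "Poly_Mapping.keys Q1 = S" by (auto simp: in_keys_iff[of _ Q1] lookup_Q1 S_def in_keys_iff[of _ Q])
  have "Poly_Mapping.lookup (Q - Q1) k \<in> L" for k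
    using csubfieldD(1)[OF L] by (auto simp: lookup_minus lookup_Q1 S_def in_keys_iff)
  hence "Poly_Mapping.lookup (E * (Q - Q1)) k \<in> L" for k by (intro lookup_mult_closed[OF L] E)
  hence "Poly_Mapping.lookup (E * Q) k - Poly_Mapping.lookup (E * (Q - Q1)) k \<in> L" for k
    by (intro csubfieldD(7)[OF L] F)
  moreover have "Poly_Mapping.lookup (E * Q1) k = Poly_Mapping.lookup (E * Q) k - Poly_Mapping.lookup (E * (Q - Q1)) k" for k
    by (simp add: right_diff_distrib lookup_minus)
  ultimately have "Poly_Mapping.lookup (E * Q1) (a0 + m0) \<in> L" by simp
  also have "Poly_Mapping.lookup (E * Q1) (a0 + m0) =
    (\<Sum>a\<in>Poly_Mapping.keys E. \<Sum>m\<in>S. if a = a0 then (if m = m0 then Poly_Mapping.lookup E a0 * Poly_Mapping.lookup Q m0 else 0) else 0)"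
    unfolding lookup_mult_sum keys_Q1
  proof (intro sum.cong refl)
    fix a m assume am: "a \<in> Poly_Mapping.keys E" "m \<in> S"
    have le: "a \<le> a0" "m \<le> m0" using am S(1) by (simp_all add: a0_def m0_def)
    have "a = a0 \<and> m = m0" if "a + m = a0 + m0"
    proof -
      have "\<not> a < a0"
      proof
        assume "a < a0"
        from add_less_le_mono[OF this le(2)] that show False by simp
      qed
      hence "a = a0" using order_le_imp_less_or_eq[OF le(1)] by blast
      thus ?thesis using that by simp
    qed
    thus "(if a + m = a0 + m0 then Poly_Mapping.lookup E a * Poly_Mapping.lookup Q1 m else 0) =
      (if a = a0 then (if m = m0 then Poly_Mapping.lookup E a0 * Poly_Mapping.lookup Q m0 else 0) else 0)"
      using m0 by (auto simp: lookup_Q1)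
  qed
  also have "\<dots> = (\<Sum>a\<in>Poly_Mapping.keys E. if a = a0 then \<Sum>m\<in>S. (if m = m0 then Poly_Mapping.lookup E a0 * Poly_Mapping.lookup Q m0 else 0) else 0)"
    by (intro sum.cong) simp_all
  also have "\<dots> = Poly_Mapping.lookup E a0 * Poly_Mapping.lookup Q m0" using a0 m0 S(1) by simp
  finally have "Poly_Mapping.lookup E a0 * Poly_Mapping.lookup Q m0 \<in> L" .
  hence "Poly_Mapping.lookup E a0 * Poly_Mapping.lookup Q m0 / Poly_Mapping.lookup E a0 \<in> L"
    by (intro csubfieldD(8)[OF L] E)
  hence "Poly_Mapping.lookup Q m0 \<in> L" using a0 by (simp add: in_keys_iff)
  thus False using m0 by (simp add: S_def)
qed

lemma form_dvd_degree:
  assumes E: "form N A e E" and F: "form N B d F" "F \<noteq> 0" and dvd: "E dvd F"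
  shows "e \<le> d"
proof -
  obtain Q where Q: "F = E * Q" using dvd by (rule dvdE)
  obtain m where m: "m \<in> Poly_Mapping.keys F" using F(2) by fastforce
  then obtain a b where "m = a + b" "a \<in> Poly_Mapping.keys E" unfolding Q using keys_mult[of E Q] by blast
  hence "mon_degree m = e + mon_degree b" using E by (simp add: form_def mon_degree_add)
  thus ?thesis using F(1) m by (simp add: form_def)
qed

lemma algebraic_int_multiple:
  fixes x :: complex
  assumes "algebraic x"
  shows "\<exists>l::int. l \<noteq> 0 \<and> (\<forall>k::int. algebraic_int (of_int (l * k) * x))"
proof -
  obtain p where p: "\<And>i. Polynomial.coeff p i \<in> \<int>" "p \<noteq> 0" "poly p x = 0"
    using assms by (auto simp: algebraic_def)
  define n where "n = Polynomial.degree p"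
  obtain l where l: "Polynomial.lead_coeff p = of_int l" using p(1) by (auto elim: Ints_cases)
  have l0: "l \<noteq> 0" using l p(2) by auto
  have n: "n > 0"
  proof (rule ccontr)
    assume "\<not> n > 0"
    hence "Polynomial.degree p = 0" by (simp add: n_def)
    then obtain c where "p = [:c:]" by (rule degree_eq_zeroE)
    thus False using p(2,3) by simp
  qed
  have "algebraic_int (of_int (l * k) * x)" for k
  proof -
    define D where "D = complex_of_int (l * k)"
    define q where "q = Polynomial.monom 1 n + (\<Sum>i<n. Polynomial.monom (Polynomial.coeff p i * of_int k * D ^ (n - 1 - i)) i)"
    have coeff: "Polynomial.coeff q j = (if j = n then 1 else if j < n then Polynomial.coeff p j * of_int k * D ^ (n - 1 - j) else 0)" for j
    proof -
      have "(\<Sum>i<n. Polynomial.coeff (Polynomial.monom (Polynomial.coeff p i * of_int k * D ^ (n - 1 - i)) i) j) =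
            (\<Sum>i<n. if i = j then Polynomial.coeff p j * of_int k * D ^ (n - 1 - j) else 0)"
        by (rule sum.cong) simp_all
      thus ?thesis unfolding q_def coeff_add coeff_sum by simp
    qed
    have "Polynomial.degree q = n"
    proof (rule antisym)
      show "Polynomial.degree q \<le> n" by (rule degree_le) (simp add: coeff)
      show "n \<le> Polynomial.degree q" by (rule le_degree) (simp add: coeff)
    qed
    hence 1: "Polynomial.lead_coeff q = 1" by (simp add: coeff)
    have D: "D ^ j \<in> \<int>" for j unfolding D_def by simp
    have 2: "\<forall>i. Polynomial.coeff q i \<in> \<int>" using p(1) D by (auto simp: coeff intro!: Ints_mult)
    have "0 = (\<Sum>i\<le>n. Polynomial.coeff p i * x ^ i)" using p(3) by (simp add: poly_altdef n_def)
    also have "\<dots> = of_int l * x ^ n + (\<Sum>i<n. Polynomial.coeff p i * x ^ i)"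
      using l by (simp add: n_def flip: lessThan_Suc_atMost)
    finally have s: "(\<Sum>i<n. Polynomial.coeff p i * x ^ i) = - of_int l * x ^ n"
      by (simp add: eq_neg_iff_add_eq_0 add.commute)
    have "(\<Sum>i<n. Polynomial.coeff p i * of_int k * D ^ (n - 1 - i) * (D * x) ^ i) =
          (\<Sum>i<n. of_int k * D ^ (n - 1) * (Polynomial.coeff p i * x ^ i))"
    proof (rule sum.cong[OF refl])
      fix i assume "i \<in> {..<n}"
      hence "D ^ (n - 1) = D ^ (n - 1 - i) * D ^ i" by (simp flip: power_add)
      thus "Polynomial.coeff p i * of_int k * D ^ (n - 1 - i) * (D * x) ^ i = of_int k * D ^ (n - 1) * (Polynomial.coeff p i * x ^ i)"
        by (simp add: power_mult_distrib mult_ac)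
    qed
    also have "\<dots> = of_int k * D ^ (n - 1) * (- of_int l * x ^ n)" by (simp only: sum_distrib_left[symmetric] s)
    also have "\<dots> = - (D * D ^ (n - 1)) * x ^ n" by (simp add: D_def mult_ac)
    also have "D * D ^ (n - 1) = D ^ n" using n by (cases n) simp_all
    finally have "poly q (D * x) = 0"
      by (simp add: q_def poly_sum poly_monom power_mult_distrib)
    with 1 2 show ?thesis unfolding D_def by (rule algebraic_int.intros)
  qed
  thus ?thesis using l0 by blast
qed

lemma algebraic_int_common_multiple:
  fixes A :: "complex set"
  assumes "finite A" "\<And>x. x \<in> A \<Longrightarrow> algebraic x"
  shows "\<exists>l::int. l \<noteq> 0 \<and> (\<forall>x\<in>A. \<forall>k::int. algebraic_int (of_int (l * k) * x))"
  using assms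
proof (induction A rule: finite_induct)
  case empty
  show ?case by (intro exI[of _ 1]) simp
next
  case (insert x A)
  have "\<exists>l::int. l \<noteq> 0 \<and> (\<forall>x\<in>A. \<forall>k::int. algebraic_int (of_int (l * k) * x))"
    by (rule insert.IH) (use insert.prems in simp)
  then obtain l :: int where l: "l \<noteq> 0" "\<forall>x\<in>A. \<forall>k::int. algebraic_int (of_int (l * k) * x)" by blast
  have "\<exists>l'::int. l' \<noteq> 0 \<and> (\<forall>k::int. algebraic_int (of_int (l' * k) * x))"
    by (rule algebraic_int_multiple) (use insert.prems in simp)
  then obtain l' :: int where l': "l' \<noteq> 0" "\<forall>k::int. algebraic_int (of_int (l' * k) * x)" by blast
  have "algebraic_int (of_int (l * l' * k) * y)" if "y \<in> insert x A" for y and k :: int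
  proof (cases "y = x")
    case True
    have "algebraic_int (of_int (l' * (l * k)) * x)" using l'(2) by blast
    thus ?thesis using True by (simp add: mult_ac)
  next
    case False
    hence "algebraic_int (of_int (l * (l' * k)) * y)" using that l(2) by blast
    thus ?thesis by (simp add: mult_ac)
  qed
  thus ?case using l(1) l'(1) by (intro exI[of _ "l * l'"]) simp
qed

lemma analytic_at_point_scale:
  assumes "analytic_at_point N u p"
  shows "analytic_at_point N (\<lambda>y. c * u y) p"
proof -
  obtain r a where r: "r > 0" and a: "\<forall>y\<in>polydisc N p r.
     ((\<lambda>m. a m * (\<Prod>i<N. (y i - p i) ^ Poly_Mapping.lookup m i)) has_sum u y) {m. Poly_Mapping.keys m \<subseteq> {..<N}}"
    using assms unfolding analytic_at_point_def by (elim exE conjE) (rule that)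
  have "\<forall>y\<in>polydisc N p r.
     ((\<lambda>m. c * a m * (\<Prod>i<N. (y i - p i) ^ Poly_Mapping.lookup m i)) has_sum c * u y) {m. Poly_Mapping.keys m \<subseteq> {..<N}}"
    using has_sum_cmult_right[OF bspec[OF a]] by (simp add: mult.assoc)
  thus ?thesis unfolding analytic_at_point_def using r
    by (intro exI[of _ r] conjI) (assumption, rule exI[of _ "\<lambda>m. c * a m"])
qed

text \<open>The constant is absorbed into the nonvanishing factor \<open>u\<close> of the local
  equation.\<close>

lemma normal_crossings_scale:
  assumes "normal_crossings N E" "c \<noteq> 0"
  shows "normal_crossings N (pconst c * E)"
  unfolding normal_crossings_def
proof (intro allI impI)
  fix j p assume j: "j \<le> N"
  have "normal_crossings_at N (\<lambda>y. peval E (chart j y)) p" using assms(1) j by (simp add: normal_crossings_def)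
  then obtain g k u r where *: "local_coordinates N g p" "k \<le> N" "analytic_at_point N u p" "u p \<noteq> 0" "r > 0"
     "\<forall>y\<in>polydisc N p r. peval E (chart j y) = u y * (\<Prod>l<k. g l y)"
    unfolding normal_crossings_at_def by (elim exE conjE) (rule that)
  have "\<forall>y\<in>polydisc N p r. peval (pconst c * E) (chart j y) = (c * u y) * (\<Prod>l<k. g l y)"
    using *(6) by (simp add: peval_mult mult.assoc)
  thus "normal_crossings_at N (\<lambda>y. peval (pconst c * E) (chart j y)) p"
    unfolding normal_crossings_at_def using * analytic_at_point_scale[OF *(3), of c] assms(2)
    by (intro exI[of _ g] exI[of _ k] exI[of _ "\<lambda>y. c * u y"] exI[of _ r] conjI) simp_all
qed

lemma padic_abs_of_int:
  fixes a :: int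
  assumes p: "Factorial_Ring.prime p"
  shows "padic_abs p (of_int a) \<ge> 0" "padic_abs p (of_int a) \<le> 1" "\<not> int p dvd a \<Longrightarrow> padic_abs p (of_int a) = 1"
proof -
  have p1: "real p \<ge> 1" using prime_gt_0_nat[OF p] by simp
  have *: "padic_abs p (of_int a) = (if a = 0 then 0 else inverse (real p ^ multiplicity (int p) a))"
    by (simp add: padic_abs_def power_int_minus)
  show "padic_abs p (of_int a) \<ge> 0" "padic_abs p (of_int a) \<le> 1"
    unfolding * using p1 by (simp_all add: inverse_le_1_iff one_le_power)
  show "padic_abs p (of_int a) = 1" if "\<not> int p dvd a"
    unfolding * using that by (auto simp: not_dvd_imp_multiplicity_0)
qed

section \<open>Global and local heights of primitive integral points\<close>

context imaginary_number_field begin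

definition arch_weight :: real where "arch_weight = 2 / real (field_degree K)"

lemma number_field_K: "number_field K"
  by (rule adjoin_number_field[OF f])

lemma arch_weight_pos: "arch_weight > 0"
  unfolding arch_weight_def using field_degree_pos[OF number_field_K] by simp

lemma place_abs_arch: "w \<in> arch_places \<Longrightarrow> place_abs K w x = w x powr arch_weight"
  by (simp add: place_abs_def local_degree_arch arch_weight_def)

lemma arch_place_of_int: "w \<in> arch_places \<Longrightarrow> w (of_int a) = real_of_int \<bar>a\<bar>"
  using arch_placeD(2)[of w "of_int a"] by simp

lemma arch_places_nonempty: "arch_places \<noteq> {}"
  using theta_root by (auto simp: arch_places_def)

lemma Max_place_abs_arch:
  fixes N :: nat and a :: "nat \<Rightarrow> int"
  assumes w: "w \<in> arch_places" and a: "Gcd (a ` {..N}) = 1"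
  shows "ln (Max ((\<lambda>i. place_abs K w (of_int (a i))) ` {..N})) = arch_weight * ln (of_int (height_max N a))"
proof -
  have H: "height_max N a \<ge> 1" by (rule height_max_pos[OF a])
  have "Max ((\<lambda>i. place_abs K w (of_int (a i))) ` {..N}) = of_int (height_max N a) powr arch_weight"
  proof (rule Max_eqI)
    fix y assume "y \<in> (\<lambda>i. place_abs K w (of_int (a i))) ` {..N}"
    then obtain i where i: "i \<le> N" "y = place_abs K w (of_int (a i))" by auto
    have "real_of_int \<bar>a i\<bar> \<le> of_int (height_max N a)" using height_max_ge[OF i(1), of a] by (simp only: of_int_le_iff)
    thus "y \<le> of_int (height_max N a) powr arch_weight"
      unfolding i(2) place_abs_arch[OF w] arch_place_of_int[OF w]
      using arch_weight_pos by (intro powr_mono2) simp_all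
  next
    obtain i where i: "i \<le> N" "\<bar>a i\<bar> = height_max N a" using height_max_attained by blast
    show "of_int (height_max N a) powr arch_weight \<in> (\<lambda>i. place_abs K w (of_int (a i))) ` {..N}"
      by (rule image_eqI[of _ _ i]) (use i in \<open>simp_all add: place_abs_arch[OF w] arch_place_of_int[OF w]\<close>)
  qed simp
  thus ?thesis using H by (simp add: ln_powr)
qed

text \<open>By the classification such a place is \<open>p\<close>-adic on the rationals. Integers
  have absolute value at most \<open>1\<close>, and one of the coprime coordinates is not divisible
  by \<open>p\<close>, so the maximum is \<open>1\<close> whatever the local degree.\<close>

lemma Max_place_abs_nonarch:
  fixes N :: nat and a :: "nat \<Rightarrow> int"
  assumes w: "w \<in> places K - arch_places" and a: "Gcd (a ` {..N}) = 1"
  shows "ln (Max ((\<lambda>i. place_abs K w (of_int (a i))) ` {..N})) = 0"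
proof -
  have "\<not> (\<forall>q::rat. w (of_rat q) = \<bar>of_rat q\<bar>)" using archimedean_place_classification w by blast
  then obtain p where p: "Factorial_Ring.prime p" "\<forall>q::rat. w (of_rat q) = padic_abs p q"
    using w unfolding places_def by blast
  have wi: "w (of_int k) = padic_abs p (of_int k)" for k using p(2)[rule_format, of "of_int k"] by simp
  define e where "e = real (local_degree K w) / real (field_degree K)"
  have e: "e \<ge> 0" by (simp add: e_def)
  have pa: "place_abs K w x = w x powr e" for x by (simp add: place_abs_def e_def)
  have "Max ((\<lambda>i. place_abs K w (of_int (a i))) ` {..N}) = 1"
  proof (rule Max_eqI)
    fix y assume "y \<in> (\<lambda>i. place_abs K w (of_int (a i))) ` {..N}"
    then obtain i where i: "y = place_abs K w (of_int (a i))" by auto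
    show "y \<le> 1" unfolding i pa wi using padic_abs_of_int(1,2)[OF p(1)] e by (intro powr_le1) simp_all
  next
    have "\<exists>i\<le>N. \<not> int p dvd a i"
    proof (rule ccontr)
      assume "\<not> ?thesis"
      hence "int p dvd Gcd (a ` {..N})" by (intro Gcd_greatest) auto
      hence "is_unit (int p)" using a by simp
      thus False using p(1) prime_gt_1_nat[OF p(1)] by simp
    qed
    then obtain i where i: "i \<le> N" "\<not> int p dvd a i" by blast
    show "1 \<in> (\<lambda>i. place_abs K w (of_int (a i))) ` {..N}"
      by (rule image_eqI[of _ _ i]) (use i padic_abs_of_int(3)[OF p(1) i(2)] in \<open>simp_all add: pa wi\<close>)
  qed simp
  thus ?thesis by simp
qed

text \<open>The infinite sum over all places is supported on the archimedean ones. The factor in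
  front of the logarithm stays as it is: it reappears on the other side of Vojta's inequality and is
  divided out there.\<close>

lemma weil_height_coprime:
  fixes N :: nat and a :: "nat \<Rightarrow> int"
  assumes a: "Gcd (a ` {..N}) = 1"
  shows "weil_height N K (\<lambda>i. of_int (a i)) = real (card arch_places) * arch_weight * ln (of_int (height_max N a))"
proof -
  have "weil_height N K (\<lambda>i. of_int (a i)) = (\<Sum>\<^sub>\<infinity>w\<in>arch_places. ln (Max ((\<lambda>i. place_abs K w (of_int (a i))) ` {..N})))"
    unfolding weil_height_def
    by (rule infsum_cong_neutral) (use arch_places_subset Max_place_abs_nonarch[OF _ a] in auto)
  also have "\<dots> = (\<Sum>w\<in>arch_places. ln (Max ((\<lambda>i. place_abs K w (of_int (a i))) ` {..N})))"
    by (rule infsum_finite[OF finite_arch_places])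
  also have "\<dots> = (\<Sum>w\<in>arch_places. arch_weight * ln (of_int (height_max N a)))"
    by (rule sum.cong[OF refl Max_place_abs_arch[OF _ a]])
  finally show ?thesis by simp
qed

text \<open>Vanishing coordinates have valuation \<infinity> and do not influence the minimum, which
  is attained at a coordinate of largest absolute value. A nonzero value of \<open>F\<close> makes
  every term finite.\<close>

lemma local_height_arch:
  fixes N :: nat and a :: "nat \<Rightarrow> int"
  assumes w: "w \<in> arch_places" and a: "Gcd (a ` {..N}) = 1"
    and F: "peval F (\<lambda>i. of_int (a i)) \<in> K" "peval F (\<lambda>i. of_int (a i)) \<noteq> 0"
  shows "local_height N K w F (\<lambda>i. of_int (a i)) =
    ereal (arch_weight * (real (divisor_degree F) * ln (of_int (height_max N a)) - ln (w (peval F (\<lambda>i. of_int (a i))))))"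
proof -
  define H where "H = height_max N a"
  have H: "H \<ge> 1" unfolding H_def by (rule height_max_pos[OF a])
  have val: "place_val K w x = ereal (- arch_weight * ln (w x))" if "x \<noteq> 0" for x
    using that by (simp add: place_val_def place_abs_arch[OF w] ln_powr)
  have "Min ((\<lambda>i. place_val K w (of_int (a i))) ` {..N}) = ereal (- arch_weight * ln (of_int H))"
  proof (rule Min_eqI)
    fix y assume "y \<in> (\<lambda>i. place_val K w (of_int (a i))) ` {..N}"
    then obtain i where i: "i \<le> N" "y = place_val K w (of_int (a i))" by auto
    show "ereal (- arch_weight * ln (of_int H)) \<le> y"
    proof (cases "a i = 0")
      case True
      thus ?thesis by (simp add: i(2) place_val_def)
    next
      case False
      have "real_of_int \<bar>a i\<bar> \<le> of_int H" using height_max_ge[OF i(1), of a] by (simp only: of_int_le_iff H_def)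
      hence "ln (real_of_int \<bar>a i\<bar>) \<le> ln (of_int H)" using False by (intro ln_mono) simp_all
      thus ?thesis using False arch_weight_pos
        by (simp add: i(2) val arch_place_of_int[OF w])
    qed
  next
    obtain i where i: "i \<le> N" "\<bar>a i\<bar> = H" using height_max_attained H_def by blast
    show "ereal (- arch_weight * ln (of_int H)) \<in> (\<lambda>i. place_val K w (of_int (a i))) ` {..N}"
      by (rule image_eqI[of _ _ i]) (use i H in \<open>auto simp: val arch_place_of_int[OF w]\<close>)
  qed simp
  hence "local_height N K w F (\<lambda>i. of_int (a i)) =
      ereal (- arch_weight * ln (w (peval F (\<lambda>i. of_int (a i)))) - real (divisor_degree F) * (- arch_weight * ln (of_int H)))"
    unfolding local_height_def val[OF F(2)] by simp
  moreover have "- q * x - d * (- q * y) = q * (d * y - x)" for q x d y :: real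
    by (simp add: algebra_simps)
  ultimately show ?thesis unfolding H_def by simp
qed

lemma sum_ln_arch_lower_bound:
  assumes G: "\<And>m. Poly_Mapping.lookup G m \<in> K"
  shows "\<exists>B. \<forall>a :: nat \<Rightarrow> int. peval G (\<lambda>i. of_int (a i)) \<noteq> 0 \<longrightarrow>
    B \<le> (\<Sum>w\<in>arch_places. ln (w (peval G (\<lambda>i. of_int (a i)))))"
proof -
  obtain c where c: "c > 0" "\<forall>a :: nat \<Rightarrow> int. peval G (\<lambda>i. of_int (a i)) \<noteq> 0 \<longrightarrow>
    c \<le> (\<Prod>z\<in>roots. cmod (emb z (peval G (\<lambda>i. of_int (a i)))))"
    using norm_lower_bound[OF G] by (elim exE conjE) (rule that)
  \<comment> \<open>The lower bound \<open>c\<close> concerns the product over all roots, in which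
    every archimedean place occurs twice.\<close>
  have "ln c / 2 \<le> (\<Sum>w\<in>arch_places. ln (w (peval G (\<lambda>i. of_int (a i)))))"
    if nz: "peval G (\<lambda>i. of_int (a i)) \<noteq> 0" for a :: "nat \<Rightarrow> int"
  proof -
    define y where "y = peval G (\<lambda>i. of_int (a i))"
    have yK: "y \<in> K" unfolding y_def peval_mono_val mono_val_of_int
      by (intro csubfield_sum[OF csubfield_K] K_closed G csubfield_of_int[OF csubfield_K])
    have pos: "w y > 0" if "w \<in> arch_places" for w
      using absolute_valueD(1,2)[OF arch_placeD(1)[OF that] yK] nz by (simp add: y_def order_less_le)
    have "c \<le> (\<Prod>z\<in>roots. cmod (emb z y))" using c(2)[rule_format, OF nz] by (simp only: y_def)
    hence "c \<le> (\<Prod>w\<in>arch_places. w y)\<^sup>2" by (simp only: prod_arch_places[OF yK])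
    hence "ln c \<le> ln ((\<Prod>w\<in>arch_places. w y)\<^sup>2)" using c(1) by (intro ln_mono) simp_all
    also have "\<dots> = 2 * ln (\<Prod>w\<in>arch_places. w y)"
      using prod_pos[of arch_places "\<lambda>w. w y"] pos by (simp add: ln_realpow)
    also have "ln (\<Prod>w\<in>arch_places. w y) = (\<Sum>w\<in>arch_places. ln (w y))"
      by (rule ln_prod[OF finite_arch_places]) (use pos in \<open>simp add: less_imp_neq[symmetric]\<close>)
    finally show ?thesis by (simp add: y_def)
  qed
  thus ?thesis by blast
qed

end

lemma number_field_containing:
  assumes "finite A" "\<And>x. x \<in> A \<Longrightarrow> algebraic x"
  shows "\<exists>\<theta> f. imaginary_number_field \<theta> f \<and> A \<subseteq> adjoin \<rat> \<theta>"
proof -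
  have "algebraic \<i>" by (rule algebraic_int_imp_algebraic) simp
  hence "\<exists>\<theta>. algebraic \<theta> \<and> insert \<i> A \<subseteq> adjoin \<rat> \<theta>"
    by (intro primitive_element) (use assms in auto)
  then obtain \<theta> where \<theta>: "algebraic \<theta>" "insert \<i> A \<subseteq> adjoin \<rat> \<theta>" by blast
  obtain f where f: "is_minpoly \<rat> f \<theta>" using algebraic_minpoly[OF \<theta>(1)] ..
  have "imaginary_number_field \<theta> f"
    by unfold_locales (use f \<theta>(2) in auto)
  thus ?thesis using \<theta>(2) by blast
qed

section \<open>The orbit\<close>

lemma proj_point_eqD:
  assumes "proj_point N y = proj_point N x"
  shows "\<exists>c. c \<noteq> 0 \<and> (\<forall>i\<le>N. y i = c * x i)"
proof -
  have "(\<lambda>i. if i \<le> N then y i else 0) \<in> proj_point N x" using proj_point_self[of N y] assms by simp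
  then obtain c where c: "c \<noteq> 0" "(\<lambda>i. if i \<le> N then y i else 0) = (\<lambda>i. if i \<le> N then c * x i else 0)"
    using proj_pointD by blast
  have "y i = c * x i" if "i \<le> N" for i using fun_cong[OF c(2), of i] that by simp
  thus ?thesis using c(1) by blast
qed

lemma coprime_coordinates:
  assumes "homog_coords N \<rat> x"
  shows "\<exists>a :: nat \<Rightarrow> int. Gcd (a ` {..N}) = 1 \<and> proj_point N x = proj_point N (\<lambda>i. of_int (a i))"
proof -
  have "\<forall>i\<in>{..N}. \<exists>q. x i = of_rat q" using assms by (auto simp: homog_coords_def Rats_def)
  from bchoice[OF this] obtain q where q: "\<forall>i\<in>{..N}. x i = of_rat (q i)" ..
  obtain E where E: "E > 0" "\<forall>r\<in>q ` {..N}. \<exists>z. of_int E * r = (of_int z :: rat)"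
    using common_denominator[of "q ` {..N}"] by blast
  hence "\<forall>i\<in>{..N}. \<exists>z. of_int E * q i = (of_int z :: rat)" by blast
  from bchoice[OF this] obtain b where b: "\<forall>i\<in>{..N}. of_int E * q i = (of_int (b i) :: rat)" ..
  have xb: "of_int E * x i = of_int (b i)" if "i \<le> N" for i
  proof -
    have "of_rat (of_int E * q i) = (of_int (b i) :: complex)" using b that by simp
    thus ?thesis using q that by (simp add: of_rat_mult)
  qed
  define G where "G = Gcd (b ` {..N})"
  obtain i0 where i0: "i0 \<le> N" "x i0 \<noteq> 0" using assms by (auto simp: homog_coords_def)
  have "b i0 \<noteq> 0"
  proof
    assume "b i0 = 0"
    hence "of_int E * x i0 = 0" using xb[OF i0(1)] by simp
    thus False using i0(2) E(1) by simp
  qed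
  hence G0: "G \<noteq> 0" using i0(1) by (auto simp: G_def Gcd_0_iff)
  define a where "a i = b i div G" for i
  have ba: "b i = G * a i" if "i \<le> N" for i
    unfolding a_def using that by (simp add: G_def Gcd_dvd)
  have "b ` {..N} = (\<lambda>t. G * t) ` a ` {..N}" unfolding image_image by (rule image_cong) (simp_all add: ba)
  hence "G = normalize (G * Gcd (a ` {..N}))" using Gcd_mult[of G "a ` {..N}"] by (simp add: G_def)
  moreover have "normalize G = G" unfolding G_def by (rule normalize_Gcd)
  ultimately have "\<bar>G\<bar> * 1 = \<bar>G\<bar> * Gcd (a ` {..N})" by (simp add: abs_mult)
  hence "Gcd (a ` {..N}) = 1" using G0 by simp
  moreover have "proj_point N x = proj_point N (\<lambda>i. of_int (a i))"
  proof (rule proj_point_scale[of "of_int G / of_int E"])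
    show "complex_of_int G / complex_of_int E \<noteq> 0" using G0 E(1) by simp
    fix i assume i: "i \<le> N"
    have "of_int E * x i = of_int G * of_int (a i)" using xb[OF i] ba[OF i] by simp
    thus "x i = complex_of_int G / complex_of_int E * complex_of_int (a i)"
      using E(1) by (simp add: field_simps)
  qed
  ultimately show ?thesis by blast
qed

text \<open>Northcott's finiteness for rational points: such a point has a coordinate vector in the
  integer box from \<open>-B\<close> to \<open>B\<close>. Vectors are restricted to the indices up
  to \<open>N\<close>, since the remaining values are arbitrary.\<close>

lemma finite_bounded_height:
  "finite {proj_point N (\<lambda>i. of_int (a i)) | a :: nat \<Rightarrow> int. height_max N a \<le> B}"
proof -
  have "{proj_point N (\<lambda>i. of_int (a i)) | a :: nat \<Rightarrow> int. height_max N a \<le> B} \<subseteq>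
    (\<lambda>a. proj_point N (\<lambda>i. of_int (a i))) ` (\<Pi>\<^sub>E i\<in>{..N}. {-B..B})"
  proof
    fix Q assume "Q \<in> {proj_point N (\<lambda>i. of_int (a i)) | a :: nat \<Rightarrow> int. height_max N a \<le> B}"
    then obtain a :: "nat \<Rightarrow> int" where a: "Q = proj_point N (\<lambda>i. of_int (a i))" "height_max N a \<le> B" by blast
    have "\<bar>a i\<bar> \<le> B" if "i \<le> N" for i by (rule order_trans[OF height_max_ge[OF that] a(2)])
    hence "- B \<le> a i \<and> a i \<le> B" if "i \<le> N" for i using that by (simp add: abs_le_iff minus_le_iff)
    hence "restrict a {..N} \<in> (\<Pi>\<^sub>E i\<in>{..N}. {-B..B})" by auto
    moreover have "Q = proj_point N (\<lambda>i. of_int (restrict a {..N} i))"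
      unfolding a(1) by (rule proj_point_scale[of 1]) simp_all
    ultimately show "Q \<in> (\<lambda>a. proj_point N (\<lambda>i. of_int (a i))) ` (\<Pi>\<^sub>E i\<in>{..N}. {-B..B})"
      by (rule image_eqI[of _ _ "restrict a {..N}", rotated])
  qed
  thus ?thesis by (rule finite_subset) (intro finite_imageI finite_PiE; simp)
qed

lemma homog_coords_coprime:
  fixes a :: "nat \<Rightarrow> int"
  assumes "Gcd (a ` {..N}) = 1" "csubfield K"
  shows "homog_coords N K (\<lambda>i. of_int (a i))"
proof -
  have "\<exists>i\<le>N. a i \<noteq> 0"
  proof (rule ccontr)
    assume "\<not> ?thesis"
    hence "a ` {..N} \<subseteq> {0}" by auto
    hence "Gcd (a ` {..N}) = 0" by (simp add: Gcd_0_iff)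
    thus False using assms(1) by simp
  qed
  thus ?thesis by (simp add: homog_coords_def csubfield_of_int[OF assms(2)])
qed

lemma homog_coords_mono: "homog_coords N A x \<Longrightarrow> A \<subseteq> B \<Longrightarrow> homog_coords N B x"
  by (auto simp: homog_coords_def)

section \<open>Iterates of the morphism, and the height bound from Vojta's inequality\<close>

locale rational_morphism =
  fixes N d :: nat and \<phi> :: "nat \<Rightarrow> mpoly"
  assumes d: "d \<ge> 2" and \<phi>: "proj_morphism N \<rat> d \<phi>"
begin

abbreviation "\<psi> \<equiv> iter_forms \<phi>"

lemma form_iter: "i \<le> N \<Longrightarrow> form N \<rat> (d ^ n) (\<psi> n i)"
proof (induction n arbitrary: i)
  case 0
  thus ?case using form_pvar[of i N \<rat>] by simp
next
  case (Suc n)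
  have "form N \<rat> (d * d ^ n) (psubst (\<phi> i) (\<psi> n))"
    by (rule form_psubst[OF semiring_set_Rats]) (use \<phi> Suc in \<open>simp_all add: proj_morphism_def\<close>)
  thus ?case by simp
qed

lemma peval_iter_Suc: "peval (\<psi> (Suc n) i) x = peval (\<phi> i) (\<lambda>j. peval (\<psi> n j) x)"
  by (simp add: peval_psubst)

lemma homog_iter:
  assumes "homog_coords N UNIV x"
  shows "homog_coords N UNIV (\<lambda>i. peval (\<psi> n i) x)"
proof (induction n)
  case 0
  thus ?case using assms by simp
next
  case (Suc n)
  have "\<exists>i\<le>N. peval (\<phi> i) (\<lambda>j. peval (\<psi> n j) x) \<noteq> 0"
    using \<phi> Suc unfolding proj_morphism_def by blast
  thus ?case unfolding homog_coords_def peval_iter_Suc by simp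
qed

lemma proj_morphism_iter: "proj_morphism N \<rat> (d ^ n) (\<psi> n)"
  unfolding proj_morphism_def using form_iter homog_iter by (simp add: homog_coords_def)

lemma proj_map_iter:
  assumes "homog_coords N UNIV x"
  shows "(proj_map N \<phi> ^^ n) (proj_point N x) = proj_point N (\<lambda>i. peval (\<psi> n i) x)"
proof (induction n)
  case (Suc n)
  have "proj_map N \<phi> (proj_point N (\<lambda>i. peval (\<psi> n i) x)) = proj_point N (\<lambda>i. peval (\<phi> i) (\<lambda>j. peval (\<psi> n j) x))"
    by (rule proj_map_point[of N d, OF _ homog_iter[OF assms]])
       (use \<phi> in \<open>auto simp: proj_morphism_def intro: form_mono\<close>)
  thus ?case by (simp add: Suc peval_psubst)
qed simp

lemma proj_map_funpow:
  assumes "Q \<in> proj_space N UNIV"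
  shows "(proj_map N \<phi> ^^ n) Q = proj_map N (\<psi> n) Q"
proof -
  obtain x where x: "homog_coords N UNIV x" "Q = proj_point N x" using assms by (auto simp: proj_space_def)
  show ?thesis unfolding x(2) proj_map_iter[OF x(1)]
    by (rule proj_map_point[symmetric, of N "d ^ n"]) (use form_mono[OF form_iter] x(1) in auto)
qed

lemma orbit_coordinates:
  assumes "P \<in> proj_space N \<rat>"
  shows "\<exists>a :: nat \<Rightarrow> int. Gcd (a ` {..N}) = 1 \<and> (proj_map N \<phi> ^^ k) P = proj_point N (\<lambda>i. of_int (a i))"
proof -
  obtain x where x: "homog_coords N \<rat> x" "P = proj_point N x" using assms by (auto simp: proj_space_def)
  have x': "homog_coords N UNIV x" by (rule homog_coords_mono[OF x(1)]) simp
  have "peval (\<psi> k i) x \<in> \<rat>" if "i \<le> N" for i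
    unfolding peval_def
  proof (intro Rats_sum Rats_mult Rats_prod Rats_power)
    fix m assume m: "m \<in> Poly_Mapping.keys (\<psi> k i)"
    show "Poly_Mapping.lookup (\<psi> k i) m \<in> \<rat>" using form_iter[OF that, of k] m by (simp add: form_def)
    fix j assume "j \<in> Poly_Mapping.keys m"
    hence "j \<le> N" using form_iter[OF that, of k] m by (auto simp: form_def)
    thus "x j \<in> \<rat>" using x(1) by (simp add: homog_coords_def)
  qed
  hence "homog_coords N \<rat> (\<lambda>i. peval (\<psi> k i) x)" using homog_iter[OF x'] by (simp add: homog_coords_def)
  from coprime_coordinates[OF this] show ?thesis unfolding x(2) proj_map_iter[OF x'] by simp
qed

lemma orbit_in_proj_space:
  assumes "P \<in> proj_space N \<rat>"
  shows "(proj_map N \<phi> ^^ k) P \<in> proj_space N UNIV"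
proof -
  obtain a :: "nat \<Rightarrow> int" where a: "Gcd (a ` {..N}) = 1" "(proj_map N \<phi> ^^ k) P = proj_point N (\<lambda>i. of_int (a i))"
    using orbit_coordinates[OF assms] by blast
  have "csubfield UNIV" by (simp add: csubfield_def)
  thus ?thesis unfolding a(2) proj_space_def using homog_coords_coprime[OF a(1)] by blast
qed

text \<open>Vojta's inequality for a multiple \<open>E\<close> of \<open>Dnc n\<close> over a number field containing its coefficients,
  with \<open>S\<close> the archimedean places. The cofactor \<open>Q\<close> of \<open>E\<close> in the pullback contributes at least a
  constant by the lower bound for norms.\<close>

lemma height_bound_of_ratio:
  assumes vojta: "vojta_conjecture N" and nc: "nc_subdivisor N (\<psi> n N) E" and nz: "\<psi> n N \<noteq> 0"
    and gap: "real (divisor_degree E) - (real N + 1) > t * real d ^ n"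
  shows "\<exists>\<Z> B. finite \<Z> \<and> (\<forall>V\<in>\<Z>. hypersurface N V) \<and>
    (\<forall>(a :: nat \<Rightarrow> int) (b :: nat \<Rightarrow> int) g. Gcd (a ` {..N}) = 1 \<longrightarrow> Gcd (b ` {..N}) = 1 \<longrightarrow>
      (\<forall>j\<le>N. peval (\<psi> n j) (\<lambda>i. of_int (a i)) = g * of_int (b j)) \<longrightarrow> b N \<noteq> 0 \<longrightarrow>
      ln \<bar>real_of_int (b N)\<bar> \<le> t * ln (of_int (height_max N b)) \<longrightarrow>
      proj_point N (\<lambda>i. of_int (a i)) \<notin> \<Union>\<Z> \<longrightarrow> height_max N a \<le> B)"
proof -
  have E: "divisor N {z. algebraic z} E" "normal_crossings N E" "E dvd \<psi> n N" using nc by (simp_all add: nc_subdivisor_def)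
  obtain e where e: "E \<noteq> 0" "form N {z. algebraic z} e E" using E(1) by (auto simp: divisor_def)
  have dE: "divisor_degree E = e" by (rule divisor_degree_form[OF e(2,1)])
  define A where "A = Poly_Mapping.lookup E ` Poly_Mapping.keys E"
  have A: "finite A" "\<And>x. x \<in> A \<Longrightarrow> algebraic x" using e(2) by (auto simp: A_def form_def)
  obtain \<theta> f where \<theta>: "imaginary_number_field \<theta> f" "A \<subseteq> adjoin \<rat> \<theta>" using number_field_containing[OF A] by blast
  interpret nf: imaginary_number_field \<theta> f by (rule \<theta>(1))
  define K where "K = adjoin \<rat> \<theta>"
  have K: "csubfield K" unfolding K_def by (rule nf.csubfield_K)
  obtain l :: int where l: "l \<noteq> 0" "\<forall>x\<in>A. \<forall>k::int. algebraic_int (of_int (l * k) * x)"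
    using algebraic_int_common_multiple[OF A] by blast
  \<comment> \<open>The conjecture asks for a form with algebraic integer coefficients; an integer
    multiple of \<open>E\<close> defines the same divisor.\<close>
  define E' where "E' = pconst (of_int l) * E"
  have lookup_E': "Poly_Mapping.lookup E' m = of_int l * Poly_Mapping.lookup E m" for m
    unfolding E'_def by (rule lookup_const_mult)
  have keys_E': "Poly_Mapping.keys E' = Poly_Mapping.keys E"
    using l(1) by (auto simp: in_keys_iff[of _ E'] in_keys_iff[of _ E] lookup_E')
  have E'0: "E' \<noteq> 0" using keys_E' e(1) by (metis keys_eq_empty)
  have E'_coeff: "Poly_Mapping.lookup E' m \<in> {z \<in> K. algebraic_int z}" if "m \<in> Poly_Mapping.keys E'" for m
  proof -
    have "Poly_Mapping.lookup E m \<in> A" using that keys_E' by (simp add: A_def)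
    moreover from this have "Poly_Mapping.lookup E m \<in> K" using \<theta>(2) by (auto simp: K_def)
    moreover have "algebraic_int (of_int (l * 1) * Poly_Mapping.lookup E m)" using l(2) calculation(1) by blast
    ultimately show ?thesis by (simp add: lookup_E' csubfieldD[OF K] csubfield_of_int[OF K])
  qed
  have form_E': "form N {z \<in> K. algebraic_int z} e E'"
    unfolding form_def
  proof (intro ballI conjI)
    fix m assume m: "m \<in> Poly_Mapping.keys E'"
    show "Poly_Mapping.lookup E' m \<in> {z \<in> K. algebraic_int z}" by (rule E'_coeff[OF m])
    show "Poly_Mapping.keys m \<subseteq> {..N}" "mon_degree m = e" using m e(2) unfolding keys_E' form_def by blast+
  qed
  have div_E': "divisor N {z \<in> K. algebraic_int z} E'" unfolding divisor_def using E'0 form_E' by blast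
  have dE': "divisor_degree E' = e" by (rule divisor_degree_form[OF form_E' E'0])
  have nc_E': "normal_crossings N E'" unfolding E'_def by (rule normal_crossings_scale[OF E(2)]) (use l(1) in simp)
  obtain Q0 where Q0: "\<psi> n N = E * Q0" using E(3) by (rule dvdE)
  define Q where "Q = pconst (1 / of_int l) * Q0"
  have "E' * Q = (pconst (of_int l) * pconst (1 / of_int l)) * (E * Q0)"
    unfolding E'_def Q_def by (simp only: mult_ac)
  also have "pconst (of_int l) * pconst (1 / of_int l) = 1"
    unfolding pconst_mult[symmetric] using l(1) by simp
  finally have EQ: "E' * Q = \<psi> n N" by (simp add: Q0)
  have QK: "Poly_Mapping.lookup Q m \<in> K" for m
  proof (rule quotient_coefficients[OF K E'0])
    show "Poly_Mapping.lookup E' m \<in> K" for m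
      using E'_coeff[of m] csubfieldD(1)[OF K] by (cases "m \<in> Poly_Mapping.keys E'") (auto simp: in_keys_iff)
    show "Poly_Mapping.lookup (E' * Q) m \<in> K" for m
      unfolding EQ using form_lookup[OF form_iter[OF order_refl] semiring_set_Rats] Rats_subset_csubfield[OF K] by blast
  qed
  obtain c0 where c0: "\<And>a :: nat \<Rightarrow> int. peval Q (\<lambda>i. of_int (a i)) \<noteq> 0 \<Longrightarrow>
    c0 \<le> (\<Sum>w\<in>nf.arch_places. ln (w (peval Q (\<lambda>i. of_int (a i)))))"
    using nf.sum_ln_arch_lower_bound[of Q] QK by (auto simp: K_def)
  obtain C2 where C2: "\<And>(a :: nat \<Rightarrow> int) (b :: nat \<Rightarrow> int) g. Gcd (a ` {..N}) = 1 \<Longrightarrow> Gcd (b ` {..N}) = 1 \<Longrightarrow>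
    \<forall>j\<le>N. peval (\<psi> n j) (\<lambda>i. of_int (a i)) = g * of_int (b j) \<Longrightarrow>
    \<bar>ln (cmod g)\<bar> \<le> C2 \<and> \<bar>ln (of_int (height_max N b)) - real (d ^ n) * ln (of_int (height_max N a))\<bar> \<le> C2"
    using height_bound[OF proj_morphism_iter[of n]] by (elim exE) (rule that, blast)
  \<comment> \<open>Half of the excess in \<open>gap\<close>. It serves as the \<epsilon> of Vojta's
    conjecture, and the other half leaves the positive coefficient of \<open>h\<close> at the
    end.\<close>
  define \<delta> where "\<delta> = (real e - (real N + 1) - t * real d ^ n) / 2"
  have \<delta>: "\<delta> > 0" using gap by (simp add: \<delta>_def dE)
  define q where "q = nf.arch_weight"
  define s where "s = real (card nf.arch_places)"
  have q: "q > 0" unfolding q_def by (rule nf.arch_weight_pos)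
  have s: "s > 0" unfolding s_def using nf.finite_arch_places nf.arch_places_nonempty by (simp add: card_gt_0_iff)
  have "number_field K \<and> divisor N {z \<in> K. algebraic_int z} E' \<and> normal_crossings N E' \<and>
     finite nf.arch_places \<and> nf.arch_places \<subseteq> places K"
    using nf.number_field_K div_E' nc_E' nf.finite_arch_places nf.arch_places_subset by (simp add: K_def)
  with vojta \<delta> obtain \<Z> C where \<Z>: "finite \<Z>" "\<forall>V\<in>\<Z>. hypersurface N V"
    "\<And>x. homog_coords N K x \<Longrightarrow> proj_point N x \<notin> \<Union>\<Z> \<Longrightarrow>
      (\<Sum>w\<in>nf.arch_places. local_height N K w E' x) < ereal ((real N + 1 + \<delta>) * weil_height N K x + C)"
    unfolding vojta_conjecture_def by meson
  \<comment> \<open>The constant of Vojta's inequality and the norm bound \<open>c0\<close>, divided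
    by the common weight \<open>q * s\<close>, plus the error of the height comparison. This error
    enters once through \<open>g\<close> and once through the height of \<open>b\<close>, there
    multiplied by \<open>t\<close>, which may be negative.\<close>
  define C3 where "C3 = (C - q * c0) / (q * s) + C2 * (1 + \<bar>t\<bar>)"
  define B where "B = \<lceil>exp (C3 / \<delta>)\<rceil>"
  have main: "height_max N a \<le> B"
    if a: "Gcd (a ` {..N}) = 1" and b: "Gcd (b ` {..N}) = 1"
      and g: "\<forall>j\<le>N. peval (\<psi> n j) (\<lambda>i. of_int (a i)) = g * of_int (b j)" and bN: "b N \<noteq> 0"
      and ratio: "ln \<bar>real_of_int (b N)\<bar> \<le> t * ln (of_int (height_max N b))"
      and notin: "proj_point N (\<lambda>i. of_int (a i)) \<notin> \<Union>\<Z>"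
    for a b :: "nat \<Rightarrow> int" and g
  proof -
    define x where "x = (\<lambda>i. complex_of_int (a i))"
    define h where "h = ln (real_of_int (height_max N a))"
    define h' where "h' = ln (real_of_int (height_max N b))"
    have H1: "height_max N a \<ge> 1" by (rule height_max_pos[OF a])
    have bounds: "\<bar>ln (cmod g)\<bar> \<le> C2" "\<bar>h' - real d ^ n * h\<bar> \<le> C2"
      using C2[OF a b g] by (simp_all add: h_def h'_def)
    have C2_nonneg: "C2 \<ge> 0" using bounds(1) by linarith
    have g0: "g \<noteq> 0"
    proof
      assume "g = 0"
      hence "peval (\<psi> n j) x = 0" if "j \<le> N" for j using g that by (simp add: x_def)
      moreover have "csubfield UNIV" by (simp add: csubfield_def)
      hence "homog_coords N UNIV (\<lambda>j. peval (\<psi> n j) x)"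
        unfolding x_def by (intro homog_iter homog_coords_coprime[OF a])
      ultimately show False by (auto simp: homog_coords_def)
    qed
    have Fx: "peval (\<psi> n N) x = g * of_int (b N)" using g by (simp add: x_def)
    hence Fx0: "peval (\<psi> n N) x \<noteq> 0" using g0 bN by simp
    have split: "peval E' x * peval Q x = peval (\<psi> n N) x" unfolding EQ[symmetric] by (rule peval_mult[symmetric])
    hence nz: "peval E' x \<noteq> 0" "peval Q x \<noteq> 0" using Fx0 by auto
    have evalK: "peval G x \<in> K" if "\<And>m. Poly_Mapping.lookup G m \<in> K" for G
      unfolding x_def peval_mono_val mono_val_of_int
      by (intro csubfield_sum[OF K] csubfieldD(4)[OF K] that csubfield_of_int[OF K])
    have E'K: "peval E' x \<in> K"
      by (rule evalK) (use form_lookup[OF form_mono[OF form_E', of K] csubfield_semiring[OF K]] in blast)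
    have QxK: "peval Q x \<in> K" by (rule evalK[OF QK])
    have "peval (\<psi> n N) x \<in> \<rat>" unfolding x_def peval_mono_val mono_val_of_int
      using form_lookup[OF form_iter[OF order_refl] semiring_set_Rats] by (intro Rats_sum Rats_mult) simp_all
    then obtain r where r: "peval (\<psi> n N) x = of_rat r" by (auto simp: Rats_def)
    define u where "u = ln (cmod (peval (\<psi> n N) x))"
    \<comment> \<open>The value of the pulled back form at \<open>x\<close> is rational, so its
      absolute value is the same at all archimedean places; this single number \<open>u\<close> is
      split between \<open>E'\<close> and \<open>Q\<close>.\<close>
    have local: "ln (w (peval E' x)) = u - ln (w (peval Q x))" if w: "w \<in> nf.arch_places" for w
    proof -
      have aw: "absolute_value K w" unfolding K_def by (rule nf.arch_placeD(1)[OF w])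
      have pos: "w (peval E' x) > 0" "w (peval Q x) > 0"
        using absolute_valueD(1,2)[OF aw E'K] absolute_valueD(1,2)[OF aw QxK] nz by (simp_all add: order_less_le)
      have "w (peval E' x) * w (peval Q x) = w (of_rat r)"
        using absolute_valueD(3)[OF aw E'K QxK] split r by simp
      also have "\<dots> = cmod (peval (\<psi> n N) x)" by (simp add: nf.arch_placeD(2)[OF w] r cmod_of_rat)
      finally have "ln (w (peval E' x) * w (peval Q x)) = u" by (simp add: u_def)
      thus ?thesis using pos by (simp add: ln_mult)
    qed
    have "(\<Sum>w\<in>nf.arch_places. local_height N K w E' x) =
          (\<Sum>w\<in>nf.arch_places. ereal (q * (real e * h - (u - ln (w (peval Q x))))))"
    proof (rule sum.cong[OF refl])
      fix w assume w: "w \<in> nf.arch_places"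
      show "local_height N K w E' x = ereal (q * (real e * h - (u - ln (w (peval Q x)))))"
        using nf.local_height_arch[OF w a, of E'] E'K nz(1) local[OF w]
        by (simp add: K_def x_def dE' q_def h_def)
    qed
    also have "\<dots> = ereal (q * (s * (real e * h - u) + (\<Sum>w\<in>nf.arch_places. ln (w (peval Q x)))))"
    proof -
      have "q * (real e * h - (u - y)) = q * (real e * h - u) + q * y" for y
        by (simp add: algebra_simps)
      hence "(\<Sum>w\<in>nf.arch_places. q * (real e * h - (u - ln (w (peval Q x))))) =
          s * (q * (real e * h - u)) + q * (\<Sum>w\<in>nf.arch_places. ln (w (peval Q x)))"
        by (simp only: sum.distrib sum_constant sum_distrib_left s_def)
      also have "s * (q * (real e * h - u)) + q * y = q * (s * (real e * h - u) + y)" for y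
        by (simp add: algebra_simps)
      finally show ?thesis by simp
    qed
    finally have lhs: "(\<Sum>w\<in>nf.arch_places. local_height N K w E' x) =
      ereal (q * (s * (real e * h - u) + (\<Sum>w\<in>nf.arch_places. ln (w (peval Q x)))))" .
    have rhs: "weil_height N K x = s * q * h"
      unfolding K_def x_def s_def q_def h_def by (rule nf.weil_height_coprime[OF a])
    have "homog_coords N K x" unfolding x_def by (rule homog_coords_coprime[OF a K])
    from \<Z>(3)[OF this] notin have ineq:
      "q * (s * (real e * h - u) + (\<Sum>w\<in>nf.arch_places. ln (w (peval Q x)))) < (real N + 1 + \<delta>) * (s * q * h) + C"
      unfolding lhs rhs by (simp add: x_def)
    have "c0 \<le> (\<Sum>w\<in>nf.arch_places. ln (w (peval Q x)))"
      using c0[of a] nz(2) by (simp add: x_def)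
    hence "q * (s * (real e * h - u) + c0) \<le> q * (s * (real e * h - u) + (\<Sum>w\<in>nf.arch_places. ln (w (peval Q x))))"
      using q by (intro mult_left_mono) simp_all
    with ineq have "q * (s * (real e * h - u) + c0) < (real N + 1 + \<delta>) * (s * q * h) + C" by linarith
    hence "(q * s) * (real e * h - u - (real N + 1 + \<delta>) * h) < C - q * c0" by (simp add: algebra_simps)
    hence 1: "real e * h - u - (real N + 1 + \<delta>) * h < (C - q * c0) / (q * s)"
      using q s by (simp add: pos_less_divide_eq mult.commute)
    \<comment> \<open>The ratio condition enters here: it bounds the size of the pulled back form at
      \<open>x\<close> by \<open>t\<close> times the logarithmic height of \<open>b\<close>, which
      is \<open>t * d ^ n * h\<close> up to a constant.\<close>
    have "u = ln (cmod g) + ln \<bar>real_of_int (b N)\<bar>"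
      using g0 bN by (simp add: u_def Fx norm_mult ln_mult)
    also have "\<dots> \<le> C2 + t * h'" using bounds(1) ratio by (simp add: h'_def)
    also have "t * h' \<le> t * (real d ^ n * h) + \<bar>t\<bar> * C2"
    proof -
      have "t * (h' - real d ^ n * h) \<le> \<bar>t\<bar> * \<bar>h' - real d ^ n * h\<bar>" by (metis abs_ge_self abs_mult)
      also have "\<dots> \<le> \<bar>t\<bar> * C2" using bounds(2) by (intro mult_left_mono) simp_all
      finally show ?thesis by (simp add: right_diff_distrib)
    qed
    finally have 2: "u \<le> C2 + (t * (real d ^ n * h) + \<bar>t\<bar> * C2)" by simp
    have "real e * h - (C2 + (t * (real d ^ n * h) + \<bar>t\<bar> * C2)) - (real N + 1 + \<delta>) * h < (C - q * c0) / (q * s)"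
      using 1 2 by linarith
    hence "(real e - t * real d ^ n - (real N + 1 + \<delta>)) * h < C3"
      by (simp add: C3_def algebra_simps)
    moreover have "real e - t * real d ^ n - (real N + 1 + \<delta>) = \<delta>" by (simp add: \<delta>_def field_simps)
    ultimately have "\<delta> * h < C3" by simp
    hence "h < C3 / \<delta>" using \<delta> by (simp add: pos_less_divide_eq mult.commute)
    hence "exp h < exp (C3 / \<delta>)" by simp
    hence "real_of_int (height_max N a) < exp (C3 / \<delta>)" using H1 by (simp add: h_def)
    thus ?thesis unfolding B_def by linarith
  qed
  show ?thesis by (rule exI[of _ \<Z>], rule exI[of _ B], intro conjI \<Z>(1,2), intro allI impI, rule main)
qed

end

theorem theorem3:
  fixes N d :: nat and \<phi> :: "nat \<Rightarrow> mpoly" and Dnc :: "nat \<Rightarrow> mpoly"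
    and c \<epsilon> :: real and P :: "(nat \<Rightarrow> complex) set"
  assumes "N \<ge> 1" and "d \<ge> 2"
    and "proj_morphism N \<rat> d \<phi>"
    and "\<And>n. nc_part N (pullback (iter_forms \<phi> n) (pvar N)) (Dnc n)"
    and "c = (SUP n. (real (divisor_degree (Dnc n)) - (real N + 1)) / real d ^ n)"
    and "vojta_conjecture N"
    and "P \<in> proj_space N \<rat>"
    and "\<epsilon> > 0"
  shows "\<not> zariski_dense N
    {Q. \<exists>m. \<exists>a :: nat \<Rightarrow> int. Q = (proj_map N \<phi> ^^ m) P \<and>
         Q = proj_point N (\<lambda>i. of_int (a i)) \<and> Gcd (a ` {..N}) = 1 \<and>
         a N \<noteq> 0 \<and> Max ((\<lambda>i. \<bar>a i\<bar>) ` {..N}) > 1 \<and>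
         ln \<bar>real_of_int (a N)\<bar> / ln (real_of_int (Max ((\<lambda>i. \<bar>a i\<bar>) ` {..N}))) \<le> c - \<epsilon>}"
    (is "\<not> zariski_dense N ?A")
proof -
  interpret rational_morphism N d \<phi> by unfold_locales (rule assms(2,3))+
  have nc: "nc_subdivisor N (\<psi> n N) (Dnc n)" for n using assms(4)[of n] by (simp add: nc_part_def)
  define t where "t = c - \<epsilon>"
  have early: "thin N ((\<lambda>m. (proj_map N \<phi> ^^ m) P) ` {..<n})" for n
    by (rule thin_finite[OF assms(1)]) (use orbit_in_proj_space[OF assms(7)] in auto)
  \<comment> \<open>A point of the orbit is either among the first \<open>n\<close>, or the image
    under the \<open>n\<close>-th iterate of an earlier point of the orbit with coprime coordinates
    \<open>a\<close>. The scalar \<open>g\<close> relates the values of the forms at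
    \<open>a\<close> to the coprime coordinates \<open>b\<close>.\<close>
  have decompose: "Q \<in> (\<lambda>m. (proj_map N \<phi> ^^ m) P) ` {..<n} \<or>
      (\<exists>(a :: nat \<Rightarrow> int) (b :: nat \<Rightarrow> int) g. Gcd (a ` {..N}) = 1 \<and> Gcd (b ` {..N}) = 1 \<and> g \<noteq> 0 \<and>
        (\<forall>j\<le>N. peval (\<psi> n j) (\<lambda>i. of_int (a i)) = g * of_int (b j)) \<and> b N \<noteq> 0 \<and>
        ln \<bar>real_of_int (b N)\<bar> \<le> t * ln (of_int (height_max N b)) \<and>
        Q = proj_map N (\<psi> n) (proj_point N (\<lambda>i. of_int (a i))))"
    if Q: "Q \<in> ?A" for Q n
  proof -
    from Q obtain m and b :: "nat \<Rightarrow> int" where mb: "Q = (proj_map N \<phi> ^^ m) P"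
      "Q = proj_point N (\<lambda>i. of_int (b i))" "Gcd (b ` {..N}) = 1" "b N \<noteq> 0" "height_max N b > 1"
      "ln \<bar>real_of_int (b N)\<bar> / ln (real_of_int (height_max N b)) \<le> t"
      unfolding t_def by blast
    show ?thesis
    proof (cases "m < n")
      case True
      thus ?thesis using mb(1) by blast
    next
      case False
      obtain a :: "nat \<Rightarrow> int" where a: "Gcd (a ` {..N}) = 1"
        "(proj_map N \<phi> ^^ (m - n)) P = proj_point N (\<lambda>i. of_int (a i))"
        using orbit_coordinates[OF assms(7)] by blast
      have "csubfield UNIV" by (simp add: csubfield_def)
      hence hom: "homog_coords N UNIV (\<lambda>i. complex_of_int (a i))" by (rule homog_coords_coprime[OF a(1)])
      have "m = n + (m - n)" using False by simp
      hence "Q = (proj_map N \<phi> ^^ n) ((proj_map N \<phi> ^^ (m - n)) P)"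
        unfolding mb(1) using funpow_add[of n "m - n" "proj_map N \<phi>"] by (metis comp_apply)
      hence Qa: "Q = (proj_map N \<phi> ^^ n) (proj_point N (\<lambda>i. of_int (a i)))" by (simp only: a(2))
      have "proj_point N (\<lambda>j. peval (\<psi> n j) (\<lambda>i. of_int (a i))) = proj_point N (\<lambda>i. of_int (b i))"
        using Qa mb(2) proj_map_iter[OF hom, of n] by simp
      from proj_point_eqD[OF this] obtain g where
        g: "g \<noteq> 0" "\<forall>j\<le>N. peval (\<psi> n j) (\<lambda>i. of_int (a i)) = g * of_int (b j)" by blast
      have "ln (real_of_int (height_max N b)) > 0" using mb(5) by simp
      hence "ln \<bar>real_of_int (b N)\<bar> \<le> t * ln (of_int (height_max N b))"
        using mb(6) by (simp add: pos_divide_le_eq)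
      moreover have "Q = proj_map N (\<psi> n) (proj_point N (\<lambda>i. of_int (a i)))"
        unfolding Qa by (rule proj_map_funpow) (use hom in \<open>auto simp: proj_space_def\<close>)
      ultimately show ?thesis using a(1) mb(3,4) g by blast
    qed
  qed
  have "thin N ?A"
  \<comment> \<open>If a pulled back form were zero, the last coordinate would vanish at all points
    from the \<open>n\<close>-th on. These are excluded from the set by
    \<open>a N \<noteq> 0\<close>, so only finitely many points would remain.\<close>
  proof (cases "\<exists>n. \<psi> n N = 0")
    case True
    then obtain n where n: "\<psi> n N = 0" ..
    have "?A \<subseteq> (\<lambda>m. (proj_map N \<phi> ^^ m) P) ` {..<n}"
    proof
      fix Q assume "Q \<in> ?A"
      from decompose[OF this, of n] show "Q \<in> (\<lambda>m. (proj_map N \<phi> ^^ m) P) ` {..<n}"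
      proof (elim disjE exE conjE)
        fix a b :: "nat \<Rightarrow> int" and g
        assume "g \<noteq> 0" "b N \<noteq> 0" "\<forall>j\<le>N. peval (\<psi> n j) (\<lambda>i. of_int (a i)) = g * of_int (b j)"
        moreover from this(3) have "peval (\<psi> n N) (\<lambda>i. of_int (a i)) = g * of_int (b N)" by simp
        ultimately show ?thesis using n by simp
      qed assumption
    qed
    with early show ?thesis by (rule thin_subset)
  next
    case False
    \<comment> \<open>A divisor of a nonzero form has at most its degree, so the quotients in the
      definition of \<open>c\<close> are at most \<open>1\<close>. Hence the real supremum is a true
      least upper bound, and a value below it is exceeded by some \<open>n\<close>.\<close>
    have deg: "divisor_degree (Dnc n) \<le> d ^ n" for n
    proof -
      have D: "divisor N {z. algebraic z} (Dnc n)" "Dnc n dvd \<psi> n N" using nc[of n] by (simp_all add: nc_subdivisor_def)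
      then obtain e where e: "Dnc n \<noteq> 0" "form N {z. algebraic z} e (Dnc n)" by (auto simp: divisor_def)
      have "e \<le> d ^ n" by (rule form_dvd_degree[OF e(2) form_iter[OF order_refl] _ D(2)]) (use False in blast)
      thus ?thesis using divisor_degree_form[OF e(2,1)] by simp
    qed
    define r where "r n = (real (divisor_degree (Dnc n)) - (real N + 1)) / real d ^ n" for n
    have dn: "real d ^ n > 0" for n using assms(2) by simp
    have "r n \<le> 1" for n
    proof -
      have "real (divisor_degree (Dnc n)) \<le> real (d ^ n)" using deg[of n] by (simp only: of_nat_le_iff)
      hence "real (divisor_degree (Dnc n)) - (real N + 1) \<le> real d ^ n" unfolding of_nat_power by linarith
      thus ?thesis unfolding r_def using dn[of n] by (simp only: divide_le_eq_1_pos)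
    qed
    hence "bdd_above (range r)" by (intro bdd_aboveI[of _ 1]) auto
    moreover have "t < (SUP n. r n)" using assms(8) by (simp add: t_def assms(5) r_def)
    ultimately obtain n where "t < r n" by (subst (asm) less_cSUP_iff) auto
    hence gap: "real (divisor_degree (Dnc n)) - (real N + 1) > t * real d ^ n"
      unfolding r_def using dn[of n] by (simp add: pos_less_divide_eq)
    have nz: "\<psi> n N \<noteq> 0" using False by blast
    obtain \<Z> B where \<Z>: "finite \<Z>" "\<forall>V\<in>\<Z>. hypersurface N V" and
      bound: "\<forall>(a :: nat \<Rightarrow> int) (b :: nat \<Rightarrow> int) g. Gcd (a ` {..N}) = 1 \<longrightarrow> Gcd (b ` {..N}) = 1 \<longrightarrow>
      (\<forall>j\<le>N. peval (\<psi> n j) (\<lambda>i. of_int (a i)) = g * of_int (b j)) \<longrightarrow> b N \<noteq> 0 \<longrightarrow>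
      ln \<bar>real_of_int (b N)\<bar> \<le> t * ln (of_int (height_max N b)) \<longrightarrow>
      proj_point N (\<lambda>i. of_int (a i)) \<notin> \<Union>\<Z> \<longrightarrow> height_max N a \<le> B"
      using height_bound_of_ratio[OF assms(6) nc nz gap] by (elim exE conjE) (rule that)
    \<comment> \<open>The vector \<open>a = 0\<close> may satisfy the height bound, but its
      \<open>proj_point\<close> is not a point of projective space; the last condition removes
      it.\<close>
    define W where "W = \<Union>\<Z> \<union> {Q \<in> {proj_point N (\<lambda>i. of_int (a i)) | a :: nat \<Rightarrow> int. height_max N a \<le> B}. Q \<in> proj_space N UNIV}"
    have "thin N W" unfolding W_def
    proof (rule thin_Un)
      show "thin N (\<Union>\<Z>)" by (rule thin_Union[OF \<Z>(1)]) (use \<Z>(2) hypersurface_thin in blast)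
      show "thin N {Q \<in> {proj_point N (\<lambda>i. of_int (a i)) | a :: nat \<Rightarrow> int. height_max N a \<le> B}. Q \<in> proj_space N UNIV}"
        by (rule thin_finite[OF assms(1) finite_subset[OF _ finite_bounded_height[of N B]]]) blast+
    qed
    moreover have "proj_morphism N UNIV (d ^ n) (\<psi> n)"
      using proj_morphism_iter[of n] unfolding proj_morphism_def by (auto intro: form_mono)
    moreover have "d ^ n > 0" by (rule zero_less_power) (use assms(2) in simp)
    ultimately have "thin N (proj_map N (\<psi> n) ` W)" by (intro thin_image)
    with early[of n] have "thin N ((\<lambda>m. (proj_map N \<phi> ^^ m) P) ` {..<n} \<union> proj_map N (\<psi> n) ` W)" by (rule thin_Un)
    moreover have "?A \<subseteq> (\<lambda>m. (proj_map N \<phi> ^^ m) P) ` {..<n} \<union> proj_map N (\<psi> n) ` W"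
    proof
      fix Q assume "Q \<in> ?A"
      from decompose[OF this, of n] show "Q \<in> (\<lambda>m. (proj_map N \<phi> ^^ m) P) ` {..<n} \<union> proj_map N (\<psi> n) ` W"
      proof (elim disjE exE conjE)
        fix a b :: "nat \<Rightarrow> int" and g
        assume *: "Gcd (a ` {..N}) = 1" "Gcd (b ` {..N}) = 1"
          "\<forall>j\<le>N. peval (\<psi> n j) (\<lambda>i. of_int (a i)) = g * of_int (b j)" "b N \<noteq> 0"
          "ln \<bar>real_of_int (b N)\<bar> \<le> t * ln (of_int (height_max N b))"
          "Q = proj_map N (\<psi> n) (proj_point N (\<lambda>i. of_int (a i)))"
        have "csubfield UNIV" by (simp add: csubfield_def)
        hence "proj_point N (\<lambda>i. of_int (a i)) \<in> proj_space N UNIV"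
          unfolding proj_space_def using homog_coords_coprime[OF *(1)] by blast
        moreover have "proj_point N (\<lambda>i. of_int (a i)) \<in> \<Union>\<Z> \<or> height_max N a \<le> B"
          using bound[rule_format, OF *(1,2) *(3)[rule_format] *(4,5)] by blast
        ultimately have "proj_point N (\<lambda>i. of_int (a i)) \<in> W" unfolding W_def by blast
        thus ?thesis using *(6) by blast
      qed blast
    qed
    ultimately show ?thesis by (rule thin_subset)
  qed
  thus ?thesis by (rule thin_not_dense)
qed

end
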